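(* Let $F\in C^2(\mathbb{R},\mathbb{R})$ with $F(0)=0$. Suppose that $G:w\mapsto\int_0^wF(\xi)\,d\xi$ takes only non-positive values on $\mathbb{R}$, and that $G\circ u\in L^1(\Omega)$ for $u\in L^2(\Omega)$ ($\Omega$ being an interval of $\mathbb{R}$, possibly unbounded). Then, for every $\Phi=(f_1,f_2)\in D(A)$, the unique local solution of Problem (P) with initial data $\Phi$ extends to a global solution of (P), i.e. there is a strongly differentiable $D(\mathcal A)$-valued function $\varphi=(u,u_t)$ on $[0,+\infty)$ that satisfies Problem (P) (equivalently its first-order form (Q) with $\varphi(0)=(\Phi,0)$).
   Context: Fix positive constants $c,a_1,a_2$ with $a_2>a_1$, and let $\Omega_1=\Omega_2=(0,+\infty)$. All functions are real-valued. Let $H=L^2(\Omega_1)\times L^2(\Omega_2)$ with norm $\|u\|_2=(\sum_{k}\int_{\Omega_k}|u_k|^2dx)^{1/2}$. Let $D(A)=\{v\in H^2(\Omega_1)\times H^2(\Omega_2): v_1(0)=v_2(0),\ v_1'(0^+)+v_2'(0^+)=0\}$ and $Av=(-c^2v_k''+a_kv_k)_{k=1,2}$. $A$ is a positive self-adjoint operator in $H$, and $D(\sqrt A)=\{v\in H^1(\Omega_1)\times H^1(\Omega_2): v_1(0)=v_2(0)\}$. Problem (P): find $u$ with values in $D(A)$, $u\in C^2$ in time with values in $H$, such that $\frac{d^2u}{dt^2}(t)+Au(t)=F(u(t))$ in $H$, $u(0)=\Phi$, $\frac{du}{dt}(0)=0$, where $F(u(t))=(F\circ u_1(t,\cdot),F\circ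 u_2(t,\cdot))$. First-order form (Q): for $\varphi=(u,v)\in D(\sqrt A)\oplus H$ put $\|\varphi\|=(\|\sqrt Au\|_2^2+\|v\|_2^2)^{1/2}$. Let $\mathcal A=i\begin{pmatrix}0&I\\-A&0\end{pmatrix}$, $D(\mathcal A)=D(A)\oplus D(\sqrt A)$, and $J(u,v)=(0,F\circ u)$. Then (Q) is $\frac{d\varphi}{dt}+i\mathcal A\varphi=J(\varphi)$, $\varphi(0)=\varphi_0$, i.e. $\frac{d}{dt}(u,v)=(v,-Au+F\circ u)$. The "local solution" is the unique continuously differentiable solution on some interval $[0,T)$, $T>0$. *)

theory Defs
  imports "HOL-Analysis.Analysis"
begin

definition square_integrable :: "'a measure \<Rightarrow> ('a \<Rightarrow> real) \<Rightarrow> bool" where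
  "square_integrable M f \<longleftrightarrow> f \<in> borel_measurable M \<and> integrable M (\<lambda>x. (f x)\<^sup>2)"

abbreviation half_line :: "real measure" where
  "half_line \<equiv> lebesgue_on {0<..}"

lemma square_integrable_mult:
  assumes "square_integrable M f" "square_integrable M g"
  shows "integrable M (\<lambda>x. f x * g x)"
proof (rule Bochner_Integration.integrable_bound[where f = "\<lambda>x. (f x)\<^sup>2 + (g x)\<^sup>2"])
  show "integrable M (\<lambda>x. (f x)\<^sup>2 + (g x)\<^sup>2)" "(\<lambda>x. f x * g x) \<in> borel_measurable M"
    using assms by (auto simp: square_integrable_def)
  have "\<bar>f x * g x\<bar> \<le> (f x)\<^sup>2 + (g x)\<^sup>2" for x
    using sum_squares_bound[of "\<bar>f x\<bar>" "\<bar>g x\<bar>"] mult_nonneg_nonneg[of "\<bar>f x\<bar>" "\<bar>g x\<bar>"]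
    unfolding abs_mult power2_abs by linarith
  then show "AE x in M. norm (f x * g x) \<le> norm ((f x)\<^sup>2 + (g x)\<^sup>2)"
    by auto
qed

lemma square_integrable_add:
  assumes "square_integrable M f" "square_integrable M g"
  shows "square_integrable M (\<lambda>x. f x + g x)"
  using assms square_integrable_mult[OF assms]
  by (auto simp: square_integrable_def power2_sum mult.assoc)

lemma square_integrable_scale:
  "square_integrable M f \<Longrightarrow> square_integrable M (\<lambda>x. r * f x)"
  by (auto simp: square_integrable_def power_mult_distrib)

lemma square_integrable_zero: "square_integrable M (\<lambda>x. 0)"
  by (auto simp: square_integrable_def)

definition l2_rel :: "(real \<Rightarrow> real) \<Rightarrow> (real \<Rightarrow> real) \<Rightarrow> bool" where
  "l2_rel f g \<longleftrightarrow> square_integrable half_line f \<and> square_integrable half_line g \<and>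
     (AE x in half_line. f x = g x)"

quotient_type l2 = "real \<Rightarrow> real" / partial: l2_rel
proof (rule part_equivpI)
  show "\<exists>x. l2_rel x x"
    using square_integrable_zero by (auto simp: l2_rel_def)
  show "symp l2_rel"
    by (auto simp: symp_def l2_rel_def elim: AE_mp)
  show "transp l2_rel"
    unfolding transp_def l2_rel_def by (auto elim!: AE_mp)
qed

instantiation l2 :: real_inner
begin

lift_definition zero_l2 :: l2 is "\<lambda>x. 0"
  by (simp add: l2_rel_def square_integrable_zero)

lift_definition plus_l2 :: "l2 \<Rightarrow> l2 \<Rightarrow> l2" is "\<lambda>f g x. f x + g x"
  unfolding l2_rel_def by (auto intro: square_integrable_add elim!: AE_mp)

lift_definition scaleR_l2 :: "real \<Rightarrow> l2 \<Rightarrow> l2" is "\<lambda>r f x. r * f x"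
  unfolding l2_rel_def by (auto intro: square_integrable_scale elim!: AE_mp)

lift_definition uminus_l2 :: "l2 \<Rightarrow> l2" is "\<lambda>f x. (-1) * f x"
  unfolding l2_rel_def using square_integrable_scale[of _ _ "-1"] by (auto elim!: AE_mp)

definition minus_l2 :: "l2 \<Rightarrow> l2 \<Rightarrow> l2" where
  "minus_l2 u v = u + (- v)"

lift_definition inner_l2 :: "l2 \<Rightarrow> l2 \<Rightarrow> real" is "\<lambda>f g. \<integral>x. f x * g x \<partial>half_line"
  unfolding l2_rel_def
  by (rule integral_cong_AE) (auto simp: square_integrable_def elim!: AE_mp)

definition norm_l2 :: "l2 \<Rightarrow> real" where
  "norm_l2 u = sqrt (inner u u)"

definition sgn_l2 :: "l2 \<Rightarrow> l2" where
  "sgn_l2 u = inverse (norm u) *\<^sub>R u"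

definition dist_l2 :: "l2 \<Rightarrow> l2 \<Rightarrow> real" where
  "dist_l2 u v = norm (u - v)"

definition uniformity_l2 :: "(l2 \<times> l2) filter" where
  "uniformity_l2 = (INF e\<in>{0<..}. principal {(u, v). dist u v < e})"

definition open_l2 :: "l2 set \<Rightarrow> bool" where
  "open_l2 U \<longleftrightarrow> (\<forall>x\<in>U. \<forall>\<^sub>F (x', y) in uniformity. x' = x \<longrightarrow> y \<in> U)"

instance
proof
  fix u v w :: l2 and r s :: real
  show "u + v + w = u + (v + w)"
    by transfer (auto simp: l2_rel_def add.assoc intro!: square_integrable_add)
  show "u + v = v + u"
    by transfer (auto simp: l2_rel_def add.commute intro!: square_integrable_add)
  show "0 + u = u"
    by transfer (auto simp: l2_rel_def)
  show "- u + u = 0"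
    by transfer (auto simp: l2_rel_def square_integrable_zero)
  show "u - v = u + - v"
    by (rule minus_l2_def)
  show "r *\<^sub>R (u + v) = r *\<^sub>R u + r *\<^sub>R v"
    by transfer (auto simp: l2_rel_def algebra_simps
        intro!: square_integrable_add square_integrable_scale)
  show "(r + s) *\<^sub>R u = r *\<^sub>R u + s *\<^sub>R u"
    by transfer (auto simp: l2_rel_def algebra_simps
        intro!: square_integrable_add square_integrable_scale)
  show "r *\<^sub>R s *\<^sub>R u = (r * s) *\<^sub>R u"
    by transfer (auto simp: l2_rel_def algebra_simps intro!: square_integrable_scale
        square_integrable_scale[of _ _ "_ * _", simplified mult.assoc])
  show "1 *\<^sub>R u = u"
    by transfer (auto simp: l2_rel_def)
  show "sgn u = inverse (norm u) *\<^sub>R u"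
    by (rule sgn_l2_def)
  show "dist u v = norm (u - v)"
    by (rule dist_l2_def)
  show "(uniformity :: (l2 \<times> l2) filter) = (INF e\<in>{0<..}. principal {(u, v). dist u v < e})"
    by (rule uniformity_l2_def)
  show "open U \<longleftrightarrow> (\<forall>x\<in>U. \<forall>\<^sub>F (x', y) in uniformity. x' = x \<longrightarrow> y \<in> U)" for U :: "l2 set"
    by (rule open_l2_def)
  show "inner u v = inner v u"
    by transfer (simp add: mult.commute)
  show "inner (u + v) w = inner u w + inner v w"
    by transfer (auto simp: l2_rel_def distrib_right intro!: Bochner_Integration.integral_add
        square_integrable_mult)
  show "inner (r *\<^sub>R u) v = r * inner u v"
    by transfer (simp add: mult.assoc)
  show "0 \<le> inner u u"
    by transfer simp
  show "inner u u = 0 \<longleftrightarrow> u = 0"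
  proof transfer
    fix f assume "l2_rel f f"
    then have f: "square_integrable half_line f" by (simp add: l2_rel_def)
    have "(\<integral>x. f x * f x \<partial>half_line) = 0 \<longleftrightarrow> (AE x in half_line. f x * f x = 0)"
      by (rule integral_nonneg_eq_0_iff_AE) (use f square_integrable_mult in auto)
    then show "(\<integral>x. f x * f x \<partial>half_line) = 0 \<longleftrightarrow> l2_rel f (\<lambda>x. 0)"
      using f by (simp add: l2_rel_def square_integrable_zero)
  qed
  show "norm u = sqrt (inner u u)"
    by (rule norm_l2_def)
qed

end

text \<open>The product \<open>real_inner\<close> structure gives exactly the norm \<open>\<parallel>u\<parallel>\<^sub>2\<close> on \<open>H\<close>.\<close>

type_synonym H = "l2 \<times> l2"

definition test_function :: "(real \<Rightarrow> real) \<Rightarrow> bool" where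
  "test_function \<phi> \<longleftrightarrow> (\<forall>k x. (deriv ^^ k) \<phi> field_differentiable at x) \<and>
     (\<exists>K. compact K \<and> K \<subseteq> {0<..} \<and> (\<forall>x. x \<notin> K \<longrightarrow> \<phi> x = 0))"

text \<open>The choice of representatives made by \<open>rep_l2\<close> is immaterial here and below, since all
  conditions are invariant under modification on null sets.\<close>

definition has_weak_derivative :: "l2 \<Rightarrow> l2 \<Rightarrow> bool" where
  "has_weak_derivative u w \<longleftrightarrow> (\<forall>\<phi>. test_function \<phi> \<longrightarrow>
     (\<integral>x. rep_l2 u x * deriv \<phi> x \<partial>half_line) = - (\<integral>x. rep_l2 w x * \<phi> x \<partial>half_line))"

definition weak_deriv :: "l2 \<Rightarrow> l2" where
  "weak_deriv u = (THE w. has_weak_derivative u w)"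

definition H1 :: "l2 set" where
  "H1 = {u. \<exists>w. has_weak_derivative u w}"

definition H2 :: "l2 set" where
  "H2 = {u \<in> H1. weak_deriv u \<in> H1}"

text \<open>The value \<open>u(0\<^sup>+)\<close>: an element of \<open>H1\<close> has a unique representative that is continuous
  up to the boundary point.\<close>

definition trace0 :: "l2 \<Rightarrow> real" where
  "trace0 u = (THE a. \<exists>g. continuous_on {0..} g \<and> (AE x in half_line. rep_l2 u x = g x) \<and> g 0 = a)"

text \<open>An unbounded operator is represented by its graph; \<open>Domain T\<close> is its domain and the
  composition \<open>S O S\<close> of graphs carries the natural domain of \<open>S\<^sup>2\<close>.\<close>

definition op_app :: "('a \<times> 'b) set \<Rightarrow> 'a \<Rightarrow> 'b" where
  "op_app T x = (THE y. (x, y) \<in> T)"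

definition adjoint_graph :: "('a::real_inner \<times> 'a) set \<Rightarrow> ('a \<times> 'a) set" where
  "adjoint_graph T = {(y, z). \<forall>(x, w) \<in> T. inner w y = inner x z}"

text \<open>The adjoint of a densely defined graph is single-valued and linear, so these need not be
  demanded separately.\<close>

definition self_adjoint :: "('a::real_inner \<times> 'a) set \<Rightarrow> bool" where
  "self_adjoint T \<longleftrightarrow> closure (Domain T) = UNIV \<and> adjoint_graph T = T"

definition positive_op :: "('a::real_inner \<times> 'a) set \<Rightarrow> bool" where
  "positive_op T \<longleftrightarrow> (\<forall>(x, w) \<in> T. 0 \<le> inner w x)"

text \<open>A positive self-adjoint operator on a Hilbert space has exactly one positive self-adjoint
  square root, so the choice operator makes no actual choice.\<close>

definition sqrt_op :: "('a::real_inner \<times> 'a) set \<Rightarrow> ('a \<times> 'a) set" where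
  "sqrt_op T = (SOME S. self_adjoint S \<and> positive_op S \<and> S O S = T)"

definition dom_A :: "H set" where
  "dom_A = {(v1, v2). v1 \<in> H2 \<and> v2 \<in> H2 \<and> trace0 v1 = trace0 v2 \<and>
     trace0 (weak_deriv v1) + trace0 (weak_deriv v2) = 0}"

definition A_fun :: "real \<Rightarrow> real \<Rightarrow> real \<Rightarrow> H \<Rightarrow> H" where
  "A_fun c a1 a2 = (\<lambda>(v1, v2).
     (- c\<^sup>2 *\<^sub>R weak_deriv (weak_deriv v1) + a1 *\<^sub>R v1,
      - c\<^sup>2 *\<^sub>R weak_deriv (weak_deriv v2) + a2 *\<^sub>R v2))"

definition sqrt_A :: "real \<Rightarrow> real \<Rightarrow> real \<Rightarrow> (H \<times> H) set" where
  "sqrt_A c a1 a2 = sqrt_op {(v, A_fun c a1 a2 v) | v. v \<in> dom_A}"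

text \<open>Composition with \<open>F\<close>. It is only meaningful where \<open>F \<circ> u\<close> is again square integrable; for
  \<open>F\<close> of class \<open>C\<^sup>1\<close> with \<open>F 0 = 0\<close> this holds for all \<open>u\<close> with \<open>H1\<close> components, since these
  are bounded.\<close>

definition superpos :: "(real \<Rightarrow> real) \<Rightarrow> H \<Rightarrow> H" where
  "superpos F = (\<lambda>(u1, u2). (abs_l2 (F \<circ> rep_l2 u1), abs_l2 (F \<circ> rep_l2 u2)))"

text \<open>The time interval \<open>I\<close> is \<open>{0..<T}\<close> for local and \<open>{0..}\<close> for global solutions.\<close>

definition solves_P ::
  "real \<Rightarrow> real \<Rightarrow> real \<Rightarrow> (real \<Rightarrow> real) \<Rightarrow> H \<Rightarrow> real set \<Rightarrow> (real \<Rightarrow> H) \<Rightarrow> bool" where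
  "solves_P c a1 a2 F \<Phi> I u \<longleftrightarrow> (\<forall>t\<in>I. u t \<in> dom_A) \<and> u 0 = \<Phi> \<and>
     (\<exists>u' u''.
        (\<forall>t\<in>I. (u has_vector_derivative u' t) (at t within I)) \<and>
        (\<forall>t\<in>I. (u' has_vector_derivative u'' t) (at t within I)) \<and>
        continuous_on I u'' \<and> u' 0 = 0 \<and>
        (\<forall>t\<in>I. u'' t + A_fun c a1 a2 (u t) = superpos F (u t)))"

definition energy_norm :: "real \<Rightarrow> real \<Rightarrow> real \<Rightarrow> H \<times> H \<Rightarrow> real" where
  "energy_norm c a1 a2 = (\<lambda>(u, v). sqrt ((norm (op_app (sqrt_A c a1 a2) u))\<^sup>2 + (norm v)\<^sup>2))"

definition dom_calA :: "real \<Rightarrow> real \<Rightarrow> real \<Rightarrow> (H \<times> H) set" where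
  "dom_calA c a1 a2 = dom_A \<times> Domain (sqrt_A c a1 a2)"

text \<open>With \<open>\<A> = i(0, I; -A, 0)\<close> and \<open>J(u, v) = (0, F \<circ> u)\<close> the two factors \<open>i\<close> in \<open>-i\<A>\<phi> + J(\<phi>)\<close>
  cancel, leaving a real expression.\<close>

definition rhs_Q :: "real \<Rightarrow> real \<Rightarrow> real \<Rightarrow> (real \<Rightarrow> real) \<Rightarrow> H \<times> H \<Rightarrow> H \<times> H" where
  "rhs_Q c a1 a2 F = (\<lambda>(u, v). (v, - A_fun c a1 a2 u + superpos F u))"

text \<open>Differentiability and continuity of the derivative are with respect to the energy norm,
  which is not the norm that the type \<open>H \<times> H\<close> carries.\<close>

definition energy_has_derivative ::
  "real \<Rightarrow> real \<Rightarrow> real \<Rightarrow> (real \<Rightarrow> H \<times> H) \<Rightarrow> H \<times> H \<Rightarrow> real \<Rightarrow> real set \<Rightarrow> bool" where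
  "energy_has_derivative c a1 a2 \<phi> D t I \<longleftrightarrow>
     ((\<lambda>s. energy_norm c a1 a2 ((1 / (s - t)) *\<^sub>R (\<phi> s - \<phi> t) - D)) \<longlongrightarrow> 0) (at t within I)"

definition energy_continuous_on ::
  "real \<Rightarrow> real \<Rightarrow> real \<Rightarrow> real set \<Rightarrow> (real \<Rightarrow> H \<times> H) \<Rightarrow> bool" where
  "energy_continuous_on c a1 a2 I \<psi> \<longleftrightarrow>
     (\<forall>t\<in>I. ((\<lambda>s. energy_norm c a1 a2 (\<psi> s - \<psi> t)) \<longlongrightarrow> 0) (at t within I))"

definition solves_Q ::
  "real \<Rightarrow> real \<Rightarrow> real \<Rightarrow> (real \<Rightarrow> real) \<Rightarrow> H \<times> H \<Rightarrow> real set \<Rightarrow> (real \<Rightarrow> H \<times> H) \<Rightarrow> bool" where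
  "solves_Q c a1 a2 F \<phi>0 I \<phi> \<longleftrightarrow> \<phi> 0 = \<phi>0 \<and>
     (\<forall>t\<in>I. \<phi> t \<in> dom_calA c a1 a2 \<and>
        energy_has_derivative c a1 a2 \<phi> (rhs_Q c a1 a2 F (\<phi> t)) t I) \<and>
     energy_continuous_on c a1 a2 I (\<lambda>t. rhs_Q c a1 a2 F (\<phi> t))"

definition C2_function :: "(real \<Rightarrow> real) \<Rightarrow> bool" where
  "C2_function F \<longleftrightarrow> (\<exists>F' F''. (\<forall>x. (F has_real_derivative F' x) (at x)) \<and>
     (\<forall>x. (F' has_real_derivative F'' x) (at x)) \<and> continuous_on UNIV F'')"

end

theory Submission
  imports Defs "HOL-Computational_Algebra.Formal_Power_Series"
begin

text \<open>With \<open>S = \<surd>A\<close> and \<open>p = S u\<close>, problem (Q) becomes \<open>(p, v)' = L (p, v) + N (p, v)\<close> on \<open>H \<times> H\<close>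
  with its ordinary norm, where \<open>L (p, v) = (S v, - S p)\<close> is skew-adjoint and has the bounded inverse
  \<open>(p, v) \<mapsto> (- R v, R p)\<close>, \<open>R = S\<inverse>\<close>. Elements in the range of \<open>R\<close> are bounded functions, so a
  superposition operator with a nonlinearity of class \<open>C\<^sup>2\<close> becomes continuously differentiable after
  composition with \<open>R\<close>, and it is globally Lipschitz continuous if the nonlinearity is compactly supported.

  The potential \<open>G\<close> is therefore multiplied by a cutoff function. This keeps it non-positive, so that
  conservation of energy bounds \<open>\<parallel>p\<parallel>\<close>, hence the supremum norm of \<open>u\<close>, by a constant that depends only on
  the initial value and not on the cutoff. If the cutoff leaves \<open>G\<close> unchanged up to this constant, then
  the global solution of the truncated problem solves the original one.\<close>

section \<open>Bounded operators as a normed algebra\<close>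

text \<open>\<open>sqrt_op\<close> selects a square root by Hilbert choice. Constructing one square
  root, by a binomial series, therefore only shows that the selected relation \<open>S\<close> is
  self-adjoint, positive and squares to \<open>A\<close>; linearity of \<open>S\<close> and its
  bounded inverse \<open>R\<close> are derived from these properties.

  A fixed point of the Duhamel formula is in general only a mild solution, whereas a solution with
  values in D(A) that is differentiable in the energy norm is wanted. Hence the time derivative
  \<psi> of \<phi> is a second unknown, and the equation is kept in the form G \<psi> = \<phi> + G
  (N \<phi>) with the bounded operator G = L^-1. The equation for \<psi> contains the term
  \<open>N' \<phi> \<psi>\<close>, which is not globally Lipschitz in the pair; this is why a
  retraction onto a ball appears.

  \<open>N'\<close> is Lipschitz only because \<open>R\<close> supplies supremum bounds: a product
  of two square integrable functions need not be square integrable, so one factor has to be bounded.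

  Multiplying the non-positive potential by a cutoff can only increase it, so the initial energy
  computed with the original potential dominates all truncated ones. The cutoff radius can thus be
  fixed before the truncation is made.\<close>

typedef (overloaded) 'a endo = "UNIV :: ('a::real_normed_vector \<Rightarrow>\<^sub>L 'a) set"
  by simp

setup_lifting type_definition_endo

lift_definition app :: "'a::real_normed_vector endo \<Rightarrow> 'a \<Rightarrow> 'a" is blinfun_apply .

lift_definition Endo :: "('a::real_normed_vector \<Rightarrow> 'a) \<Rightarrow> 'a endo" is Blinfun .

instantiation endo :: (real_normed_vector) real_normed_vector
begin

lift_definition zero_endo :: "'a endo" is 0 .
lift_definition plus_endo :: "'a endo \<Rightarrow> 'a endo \<Rightarrow> 'a endo" is "(+)" .
lift_definition minus_endo :: "'a endo \<Rightarrow> 'a endo \<Rightarrow> 'a endo" is "(-)" .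
lift_definition uminus_endo :: "'a endo \<Rightarrow> 'a endo" is uminus .
lift_definition scaleR_endo :: "real \<Rightarrow> 'a endo \<Rightarrow> 'a endo" is scaleR .
lift_definition norm_endo :: "'a endo \<Rightarrow> real" is norm .
definition sgn_endo :: "'a endo \<Rightarrow> 'a endo" where "sgn_endo x = inverse (norm x) *\<^sub>R x"
definition dist_endo :: "'a endo \<Rightarrow> 'a endo \<Rightarrow> real" where "dist_endo x y = norm (x - y)"
definition uniformity_endo :: "('a endo \<times> 'a endo) filter" where
  "uniformity_endo = (INF e\<in>{0<..}. principal {(x, y). dist x y < e})"
definition open_endo :: "'a endo set \<Rightarrow> bool" where
  "open_endo U \<longleftrightarrow> (\<forall>x\<in>U. \<forall>\<^sub>F (x', y) in uniformity. x' = x \<longrightarrow> y \<in> U)"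

instance
proof
  fix x y z :: "'a endo" and a b :: real
  show "x + y + z = x + (y + z)" "x + y = y + x" "0 + x = x" "- x + x = 0" "x - y = x + - y"
    by (transfer, simp)+
  show "a *\<^sub>R (x + y) = a *\<^sub>R x + a *\<^sub>R y" "(a + b) *\<^sub>R x = a *\<^sub>R x + b *\<^sub>R x"
    "a *\<^sub>R b *\<^sub>R x = (a * b) *\<^sub>R x" "1 *\<^sub>R x = x"
    by (transfer, simp add: algebra_simps)+
  show "norm x = 0 \<longleftrightarrow> x = 0" "norm (a *\<^sub>R x) = \<bar>a\<bar> * norm x" by (transfer, simp)+
  show "norm (x + y) \<le> norm x + norm y" by transfer (rule norm_triangle_ineq)
qed (simp_all add: sgn_endo_def dist_endo_def uniformity_endo_def open_endo_def)

end

lemma app_bounded_linear: "bounded_linear (app T)"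
  by transfer (rule blinfun.bounded_linear_right)

lemma app_endo_bounded_linear: "bounded_linear (\<lambda>T. app T x)"
proof
  show "app (S + T) x = app S x + app T x" "app (r *\<^sub>R T) x = r *\<^sub>R app T x" for S T r
    by (transfer, simp add: blinfun.add_left blinfun.scaleR_left)+
  have "norm (app T x) \<le> norm T * norm x" for T
    by transfer (rule norm_blinfun)
  then show "\<exists>K. \<forall>T. norm (app T x) \<le> norm T * K" by blast
qed

lemma norm_app: "norm (app T x) \<le> norm T * norm x"
  by transfer (rule norm_blinfun)

lemma app_Endo: "bounded_linear f \<Longrightarrow> app (Endo f) = f"
  by transfer (rule bounded_linear_Blinfun_apply)

lemma norm_endo_le: "(\<And>x. norm (app T x) \<le> b * norm x) \<Longrightarrow> 0 \<le> b \<Longrightarrow> norm T \<le> b"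
  by transfer (rule norm_blinfun_bound)

lemmas app_add = bounded_linear.linear[OF app_bounded_linear, THEN linear_add]
  and app_diff = bounded_linear.linear[OF app_bounded_linear, THEN linear_diff]
  and app_neg = bounded_linear.linear[OF app_bounded_linear, THEN linear_neg]
  and app_scaleR = bounded_linear.linear[OF app_bounded_linear, THEN linear_scale]
  and app_0 = bounded_linear.linear[OF app_bounded_linear, THEN linear_0]
  and endo_app_add = bounded_linear.linear[OF app_endo_bounded_linear, THEN linear_add]
  and endo_app_diff = bounded_linear.linear[OF app_endo_bounded_linear, THEN linear_diff]
  and endo_app_neg = bounded_linear.linear[OF app_endo_bounded_linear, THEN linear_neg]
  and endo_app_scaleR = bounded_linear.linear[OF app_endo_bounded_linear, THEN linear_scale]
  and endo_app_0 = bounded_linear.linear[OF app_endo_bounded_linear, THEN linear_0]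
  and endo_app_sum = bounded_linear.linear[OF app_endo_bounded_linear, THEN linear_sum]

instance endo :: (banach) banach
proof
  fix X :: "nat \<Rightarrow> 'a endo" assume X: "Cauchy X"
  have dist: "dist (Rep_endo x) (Rep_endo y) = dist x y" for x y :: "'a endo"
    unfolding dist_norm by transfer simp
  have "Cauchy (\<lambda>n. Rep_endo (X n))"
    using X unfolding Cauchy_def dist .
  then obtain L where "(\<lambda>n. Rep_endo (X n)) \<longlonglongrightarrow> L"
    using Cauchy_convergent convergent_def by blast
  then have "X \<longlonglongrightarrow> Abs_endo L"
    unfolding tendsto_iff by (simp add: dist[symmetric] Abs_endo_inverse)
  then show "convergent X" by (auto simp: convergent_def)
qed

text \<open>Composition as multiplication gives powers, geometric sums and \<open>exp\<close> of
  operators. A space without isolated points is not the zero space, whence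
  \<open>norm 1 = 1\<close>.\<close>

instantiation endo :: ("{real_normed_vector, perfect_space}") real_normed_algebra_1
begin

lift_definition one_endo :: "'a endo" is id_blinfun .
lift_definition times_endo :: "'a endo \<Rightarrow> 'a endo \<Rightarrow> 'a endo" is "(o\<^sub>L)" .

instance
proof
  fix x y z :: "'a endo" and a :: real
  show "x * y * z = x * (y * z)" "1 * x = x" "x * 1 = x"
    by (transfer, auto intro!: blinfun_eqI)+
  show "(x + y) * z = x * z + y * z" "x * (y + z) = x * y + x * z"
    "a *\<^sub>R x * y = a *\<^sub>R (x * y)" "x * a *\<^sub>R y = a *\<^sub>R (x * y)"
    by (transfer, auto intro!: blinfun_eqI simp: blinfun.bilinear_simps)+
  have 1: "norm (1 :: 'a endo) = 1" by transfer simp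
  then show "norm (1 :: 'a endo) = 1" .
  show "(0 :: 'a endo) \<noteq> 1" using 1 by (metis norm_zero zero_neq_one[where 'a=real])
  show "norm (x * y) \<le> norm x * norm y"
    by transfer (rule norm_blinfun_compose)
qed

end

lemma app_times: "app (S * T) x = app S (app T x)"
  by transfer simp

lemma app_one: "app 1 x = x"
  by transfer simp

lemmas app_simps = app_add app_diff app_neg app_scaleR app_0 endo_app_add endo_app_diff
  endo_app_neg endo_app_scaleR endo_app_0 app_times app_one

section \<open>Square roots of positive operators\<close>

definition symmetric_op :: "'a::real_inner endo \<Rightarrow> bool" where
  "symmetric_op T \<longleftrightarrow> (\<forall>x y. inner (app T x) y = inner x (app T y))"

lemma symmetric_opD: "symmetric_op T \<Longrightarrow> inner (app T x) y = inner x (app T y)"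
  by (simp add: symmetric_op_def)

text \<open>The order relation 0 <= C <= 1 between quadratic forms. It is met twice: by 1 - a A^-1,
  and by 1 + scl G^2 with \<open>G\<close> skew.\<close>

locale positive_contraction =
  fixes C :: "'a::{real_inner, banach, perfect_space} endo"
  assumes sym: "symmetric_op C"
    and pos: "0 \<le> inner (app C x) x"
    and le_one: "inner (app C x) x \<le> inner x x"
begin

text \<open>Positivity at \<open>x - app C x\<close>; the cubic term that appears is estimated by
  \<open>le_one\<close> at \<open>app C x\<close>.\<close>

lemma norm_app_sq_le: "(norm (app C x))\<^sup>2 \<le> inner (app C x) x"
proof -
  have "0 \<le> inner (app C (x - app C x)) (x - app C x)" by (rule pos)
  also have "\<dots> = inner (app C x) x - 2 * (norm (app C x))\<^sup>2 + inner (app C (app C x)) (app C x)"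
    using symmetric_opD[OF sym, of "app C x" x]
    by (simp add: app_diff inner_diff power2_norm_eq_inner inner_commute)
  also have "inner (app C (app C x)) (app C x) \<le> (norm (app C x))\<^sup>2"
    using le_one[of "app C x"] by (simp add: power2_norm_eq_inner)
  finally show ?thesis by simp
qed

lemma contraction: "norm (app C x) \<le> norm x"
proof -
  have "(norm (app C x))\<^sup>2 \<le> (norm x)\<^sup>2"
    using norm_app_sq_le[of x] le_one[of x] by (simp add: power2_norm_eq_inner)
  then show ?thesis by (rule power2_le_imp_le) simp
qed

lemma norm_le_one: "norm C \<le> 1"
  by (rule norm_endo_le) (simp_all add: contraction)

lemma norm_power_le_one: "norm (C ^ n) \<le> 1"
  using norm_power_ineq[of C n] power_le_one[OF norm_ge_zero norm_le_one, of n] by linarith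

lemma inner_power: "inner (app (C ^ m) x) (app (C ^ n) y) = inner (app (C ^ (m + n)) x) y"
proof (induction n arbitrary: y m)
  case (Suc n)
  have "app (C ^ Suc n) y = app (C ^ n) (app C y)"
    by (simp add: power_commutes app_times[symmetric])
  then have "inner (app (C ^ m) x) (app (C ^ Suc n) y) = inner (app (C ^ (m + n)) x) (app C y)"
    using Suc.IH by simp
  also have "\<dots> = inner (app (C ^ (m + Suc n)) x) y"
    by (simp add: symmetric_opD[OF sym] app_times)
  finally show ?case .
qed (simp add: app_one)

text \<open>The numbers \<open>a k\<close> are non-negative and decreasing, and the squared distance
  of two iterates is \<open>a (2 * m) - 2 * a (m + n) + a (2 * n)\<close>. So the iterates are
  Cauchy, and their limit is a fixed vector of \<open>C\<close>. This gives strong convergence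
  without spectral theory.\<close>

lemma power_tendsto_zero:
  assumes inj: "\<And>x. app C x = x \<Longrightarrow> x = 0"
  shows "(\<lambda>n. app (C ^ n) x) \<longlonglongrightarrow> 0"
proof -
  define a where "a k = inner (app (C ^ k) x) x" for k
  have even: "a (2 * k) = (norm (app (C ^ k) x))\<^sup>2" for k
    using inner_power[of k x k x] by (simp add: a_def power2_norm_eq_inner mult_2)
  have odd: "a (Suc (2 * k)) = inner (app C (app (C ^ k) x)) (app (C ^ k) x)" for k
    using inner_power[of "Suc k" x k x] by (simp add: a_def app_times mult_2)
  \<comment> \<open>Even indices give the squared norm and odd indices the form of \<open>C\<close>
    at the same iterate, so the two kinds of descent are \<open>le_one\<close> and
    \<open>norm_app_sq_le\<close>.\<close>
  have step: "a (Suc k) \<le> a k \<and> 0 \<le> a k" for k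
  proof (cases "even k")
    case True
    then obtain j where "k = 2 * j" by blast
    then show ?thesis
      using even[of j] odd[of j] le_one[of "app (C ^ j) x"] by (simp add: power2_norm_eq_inner)
  next
    case False
    then obtain j where k: "k = Suc (2 * j)" by (auto elim: oddE)
    have "a (Suc k) = (norm (app C (app (C ^ j) x)))\<^sup>2"
      using even[of "Suc j"] by (simp add: k app_times)
    then show ?thesis
      using k odd[of j] pos norm_app_sq_le[of "app (C ^ j) x"] by simp
  qed
  have "decseq a" using step by (simp add: decseq_Suc_iff)
  then obtain L where L: "a \<longlonglongrightarrow> L"
    using decseq_convergent[of a 0] step by metis
  have "Cauchy (\<lambda>n. app (C ^ n) x)"
  proof (rule metric_CauchyI)
    fix e :: real assume e: "e > 0"
    then obtain N where N: "\<And>n. n \<ge> N \<Longrightarrow> \<bar>a n - L\<bar> < e\<^sup>2 / 4"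
      using LIMSEQ_D[OF L, of "e\<^sup>2 / 4"] by auto
    have "dist (app (C ^ m) x) (app (C ^ n) x) < e" if "m \<ge> N" "n \<ge> N" for m n
    proof -
      have "(norm (app (C ^ m) x - app (C ^ n) x))\<^sup>2 = a (2 * m) - 2 * a (m + n) + a (2 * n)"
        unfolding even power2_norm_eq_inner inner_diff
        using inner_power[of m x n x] inner_power[of n x m x]
        by (simp add: a_def inner_commute add.commute)
      also have "\<dots> < e\<^sup>2"
        using N[of "2 * m"] N[of "2 * n"] N[of "m + n"] that by (simp add: abs_if split: if_splits)
      finally show ?thesis
        unfolding dist_norm using e by (simp add: power_less_imp_less_base)
    qed
    then show "\<exists>M. \<forall>m\<ge>M. \<forall>n\<ge>M. dist (app (C ^ m) x) (app (C ^ n) x) < e" by blast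
  qed
  then obtain w where w: "(\<lambda>n. app (C ^ n) x) \<longlonglongrightarrow> w"
    using Cauchy_convergent convergent_def by blast
  have "(\<lambda>n. app C (app (C ^ n) x)) \<longlonglongrightarrow> app C w"
    using bounded_linear.tendsto[OF app_bounded_linear w] .
  moreover have "(\<lambda>n. app C (app (C ^ n) x)) \<longlonglongrightarrow> w"
    using LIMSEQ_Suc[OF w] by (simp add: app_times)
  ultimately have "app C w = w" by (rule LIMSEQ_unique)
  then have "w = 0" by (rule inj)
  then show ?thesis using w by simp
qed

end

section \<open>The Taylor series of the square root of 1 - z\<close>

definition sqrt_coeff :: "nat \<Rightarrow> real" where
  "sqrt_coeff k = (-1) ^ k * ((1/2) gchoose k)"

lemma sqrt_coeff_0 [simp]: "sqrt_coeff 0 = 1"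
  by (simp add: sqrt_coeff_def)

text \<open>The coefficient of index 1 is -1/2, and from there on consecutive ones have the positive
  ratio \<open>(k + 1/2) / (k + 2)\<close>. The fixed sign lets a bound on the sum control the
  absolute values.\<close>

lemma sqrt_coeff_Suc_nonpos: "sqrt_coeff (Suc k) \<le> 0"
proof (induction k)
  case (Suc k)
  have "((1/2 :: real) gchoose Suc (Suc k)) * (2 * real k + 4)
      = - ((1/2) gchoose Suc k) * (2 * real k + 1)"
    using gbinomial_mult_1[of "1/2 :: real" "Suc k"] by (simp add: algebra_simps)
  then have "(1/2 :: real) gchoose Suc (Suc k)
      = - ((1/2) gchoose Suc k) * ((real k + 1/2) / (real k + 2))"
    by (simp add: field_simps)
  then have "sqrt_coeff (Suc (Suc k)) = sqrt_coeff (Suc k) * ((real k + 1/2) / (real k + 2))"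
    by (simp add: sqrt_coeff_def)
  then show ?case using Suc by (simp add: divide_nonpos_pos mult_nonpos_nonneg)
qed (simp add: sqrt_coeff_def)

text \<open>For 0 < z < 1 the series sums to 1 - sqrt (1 - z), which is at most 1; a finite partial
  sum is continuous in z, so z may tend to 1. The value 1 of the bound is what positivity of the
  operator square root rests on.\<close>

lemma sum_abs_sqrt_coeff_le: "(\<Sum>k<n. \<bar>sqrt_coeff (Suc k)\<bar>) \<le> 1"
proof -
  have *: "(\<Sum>k<n. \<bar>sqrt_coeff (Suc k)\<bar> * z ^ Suc k) \<le> 1" if z: "0 < z" "z < 1" for z :: real
  proof -
    have "(\<lambda>k. ((1/2) gchoose k) * (- z) ^ k) sums (1 + - z) powr (1/2)"
      using gen_binomial_real[of "- z" "1/2"] z by simp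
    then have "(\<lambda>k. sqrt_coeff k * z ^ k) sums (1 - z) powr (1/2)"
      by (simp add: sqrt_coeff_def power_minus[of z] mult_ac)
    then have "(\<lambda>k. sqrt_coeff (Suc k) * z ^ Suc k) sums ((1 - z) powr (1/2) - 1)"
      by (subst sums_Suc_iff) simp
    then have s: "(\<lambda>k. \<bar>sqrt_coeff (Suc k)\<bar> * z ^ Suc k) sums (1 - (1 - z) powr (1/2))"
      using sqrt_coeff_Suc_nonpos sums_minus by (fastforce simp: abs_of_nonpos)
    have "(\<Sum>k<n. \<bar>sqrt_coeff (Suc k)\<bar> * z ^ Suc k) \<le> 1 - (1 - z) powr (1/2)"
      unfolding sums_unique[OF s] using z by (intro sum_le_suminf sums_summable[OF s]) auto
    then show ?thesis using powr_ge_zero[of "1 - z" "1/2"] by linarith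
  qed
  have "((\<lambda>z. \<Sum>k<n. \<bar>sqrt_coeff (Suc k)\<bar> * z ^ Suc k) \<longlongrightarrow> (\<Sum>k<n. \<bar>sqrt_coeff (Suc k)\<bar> * 1 ^ Suc k)) (at_left 1)"
    by (intro tendsto_intros)
  moreover have "\<forall>\<^sub>F z in at_left (1::real). (\<Sum>k<n. \<bar>sqrt_coeff (Suc k)\<bar> * z ^ Suc k) \<le> 1"
    using eventually_at_left_field * by (metis (mono_tags, lifting) zero_less_one)
  ultimately show ?thesis
    using tendsto_upperbound[of _ _ "at_left (1::real)" 1] by (simp add: trivial_limit_at_left_real)
qed

lemma summable_abs_sqrt_coeff: "summable (\<lambda>k. \<bar>sqrt_coeff k\<bar>)"
  and suminf_abs_sqrt_coeff_le: "(\<Sum>k. \<bar>sqrt_coeff (Suc k)\<bar>) \<le> 1"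
proof -
  have s: "summable (\<lambda>k. \<bar>sqrt_coeff (Suc k)\<bar>)"
    by (rule bounded_imp_summable[of _ 1])
      (use sum_abs_sqrt_coeff_le in \<open>auto simp: lessThan_Suc_atMost[symmetric] simp del: sum.lessThan_Suc\<close>)
  then show "summable (\<lambda>k. \<bar>sqrt_coeff k\<bar>)" by (subst (asm) summable_Suc_iff)
  show "(\<Sum>k. \<bar>sqrt_coeff (Suc k)\<bar>) \<le> 1"
    by (rule suminf_le_const[OF s sum_abs_sqrt_coeff_le])
qed

text \<open>The square of the series is 1 - z; this is Vandermonde's identity for 1/2 + 1/2 =
  1.\<close>

lemma sqrt_coeff_convolution:
  "(\<Sum>k\<le>n. sqrt_coeff k * sqrt_coeff (n - k)) = (if n = 0 then 1 else if n = 1 then -1 else 0)"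
proof -
  have "(\<Sum>k\<le>n. sqrt_coeff k * sqrt_coeff (n - k))
      = (-1) ^ n * (\<Sum>k = 0..n. ((1/2) gchoose k) * ((1/2) gchoose (n - k)))"
    unfolding sum_distrib_left atMost_atLeast0
  proof (rule sum.cong)
    fix k assume "k \<in> {0..n}"
    then have "(-1) ^ n = (-1) ^ k * (-1 :: real) ^ (n - k)"
      by (simp add: power_add[symmetric])
    then show "sqrt_coeff k * sqrt_coeff (n - k)
        = (-1) ^ n * (((1/2) gchoose k) * ((1/2) gchoose (n - k)))"
      by (simp add: sqrt_coeff_def)
  qed simp
  also have "\<dots> = (-1) ^ n * ((1 :: real) gchoose n)"
    using gbinomial_Vandermonde[of "1/2 :: real" "1/2" n] by simp
  also have "(1 :: real) gchoose n = real (1 choose n)"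
    using binomial_gbinomial[of 1 n, where 'a = real] by simp
  also have "(-1) ^ n * real (1 choose n) = (if n = 0 then 1 else if n = 1 then -1 else 0)"
    by (cases n) (auto simp: binomial_eq_0)
  finally show ?thesis .
qed

text \<open>The series evaluated at \<open>C\<close>. Absolute summability of the coefficients gives
  convergence in operator norm although \<open>norm C\<close> may be 1, and the Cauchy product gives
  the square.\<close>

lemma (in positive_contraction) sqrt_one_minus:
  obtains R where "symmetric_op R" "\<And>x. 0 \<le> inner (app R x) x" "R * R = 1 - C"
proof -
  define f where "f k = sqrt_coeff k *\<^sub>R C ^ k" for k
  have norm_f: "norm (f k) \<le> \<bar>sqrt_coeff k\<bar>" for k
    unfolding f_def using norm_power_le_one[of k] mult_left_mono[of _ 1 "\<bar>sqrt_coeff k\<bar>"] by simp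
  have sn: "summable (\<lambda>k. norm (f k))"
    by (rule summable_comparison_test'[OF summable_abs_sqrt_coeff, of 0]) (simp add: norm_f)
  then have sf: "summable f" by (rule summable_norm_cancel)
  define R where "R = suminf f"
  have app_R: "(\<lambda>k. sqrt_coeff k *\<^sub>R app (C ^ k) x) sums app R x" for x
    using bounded_linear.sums[OF app_endo_bounded_linear summable_sums[OF sf], of x]
    by (simp add: f_def R_def endo_app_scaleR)
  show thesis
  proof
    have i: "(\<lambda>k. sqrt_coeff k * inner (app (C ^ k) x) y) sums inner (app R x) y" for x y
      using bounded_linear.sums[OF bounded_linear_inner_left[of y] app_R[of x]] by simp
    show "symmetric_op R"
      unfolding symmetric_op_def
    proof (intro allI)
      fix x y
      have eq: "inner (app (C ^ k) x) y = inner (app (C ^ k) y) x" for k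
        using inner_power[of k x 0 y] inner_power[of 0 x k y] by (simp add: app_one inner_commute)
      have "(\<lambda>k. sqrt_coeff k * inner (app (C ^ k) x) y) sums inner (app R y) x"
        by (simp only: eq) (rule i)
      from sums_unique2[OF i[of x y] this] show "inner (app R x) y = inner x (app R y)"
        using inner_commute by metis
    qed
    show "0 \<le> inner (app R x) x" for x
    proof -
      \<comment> \<open>Every coefficient after the constant one is non-positive, so the form of
        \<open>R\<close> is \<open>inner x x\<close> minus a sum that does not exceed
        \<open>inner x x\<close>.\<close>
      have "(\<lambda>k. sqrt_coeff (Suc k) * inner (app (C ^ Suc k) x) x) sums (inner (app R x) x - inner x x)"
        using i[of x x] by (subst sums_Suc_iff) (simp add: app_one)
      then have s: "(\<lambda>k. \<bar>sqrt_coeff (Suc k)\<bar> * inner (app (C ^ Suc k) x) x) sums (inner x x - inner (app R x) x)"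
        using sqrt_coeff_Suc_nonpos sums_minus by (fastforce simp: abs_of_nonpos)
      have t: "(\<lambda>k. \<bar>sqrt_coeff (Suc k)\<bar> * inner x x) sums ((\<Sum>k. \<bar>sqrt_coeff (Suc k)\<bar>) * inner x x)"
        using summable_abs_sqrt_coeff by (intro sums_mult2 summable_sums) (subst summable_Suc_iff)
      have "inner (app (C ^ k) x) x \<le> inner x x" for k
      proof -
        have "inner (app (C ^ k) x) x \<le> norm (app (C ^ k) x) * norm x" by (rule norm_cauchy_schwarz)
        also have "\<dots> \<le> (norm (C ^ k) * norm x) * norm x"
          by (intro mult_right_mono norm_app norm_ge_zero)
        also have "\<dots> \<le> (1 * norm x) * norm x"
          by (intro mult_right_mono norm_power_le_one norm_ge_zero)
        finally show ?thesis by (simp add: power2_norm_eq_inner[symmetric] power2_eq_square)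
      qed
      then have "inner x x - inner (app R x) x \<le> (\<Sum>k. \<bar>sqrt_coeff (Suc k)\<bar>) * inner x x"
        by (intro sums_le[OF _ s t] mult_left_mono) (auto simp del: power_Suc)
      also have "\<dots> \<le> 1 * inner x x"
        by (intro mult_right_mono suminf_abs_sqrt_coeff_le inner_ge_zero)
      finally show ?thesis by simp
    qed
    have "(\<lambda>k. \<Sum>i\<le>k. f i * f (k - i)) sums (R * R)"
      unfolding R_def by (rule Cauchy_product_sums[OF sn sn])
    moreover have "(\<Sum>i\<le>k. f i * f (k - i)) = (if k = 0 then 1 else if k = 1 then - C else 0)" for k
    proof -
      have "(\<Sum>i\<le>k. f i * f (k - i)) = (\<Sum>i\<le>k. (sqrt_coeff i * sqrt_coeff (k - i)) *\<^sub>R C ^ k)"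
        by (rule sum.cong) (simp_all add: f_def power_add[symmetric])
      also have "\<dots> = (if k = 0 then 1 else if k = 1 then -1 else 0) *\<^sub>R C ^ k"
        unfolding scaleR_sum_left[symmetric] sqrt_coeff_convolution ..
      finally show ?thesis by (auto split: if_splits)
    qed
    ultimately have "(\<lambda>k. if k = 0 then 1 else if k = 1 then - C else 0) sums (R * R)" by simp
    moreover have "(\<lambda>k::nat. if k = 0 then 1 else if k = 1 then - C else 0)
        sums (\<Sum>k\<in>{0, 1::nat}. if k = 0 then 1 else if k = 1 then - C else 0)"
      by (rule sums_finite) auto
    ultimately show "R * R = 1 - C" using sums_unique2 by fastforce
  qed
qed

section \<open>The unitary group of a skew-adjoint operator\<close>

definition skew_op :: "'a::real_inner endo \<Rightarrow> bool" where
  "skew_op T \<longleftrightarrow> (\<forall>x y. inner (app T x) y = - inner x (app T y))"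

lemma skew_opD: "skew_op T \<Longrightarrow> inner (app T x) y = - inner x (app T y)"
  by (simp add: skew_op_def)

lemma skew_op_diff: "skew_op S \<Longrightarrow> skew_op T \<Longrightarrow> skew_op (S - T)"
  by (simp add: skew_op_def app_simps inner_diff)

lemma inner_skew_self: "skew_op T \<Longrightarrow> inner (app T x) x = 0"
  using skew_opD[of T x x] by (simp add: inner_commute)

lemma exp_app_has_vector_derivative:
  fixes M :: "'a::{real_inner, banach, perfect_space} endo"
  shows "((\<lambda>t. app (exp (t *\<^sub>R M)) x) has_vector_derivative app (exp (t *\<^sub>R M)) (app M x)) (at t within S)"
  using bounded_linear.has_vector_derivative[OF app_endo_bounded_linear[of x]
      exp_scaleR_has_vector_derivative_right[of M t S]]
  by (simp add: app_times)

text \<open>The squared norm along the orbit has derivative 2 inner (M y) y, which is 0.\<close>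

lemma norm_exp_skew:
  fixes M :: "'a::{real_inner, banach, perfect_space} endo"
  assumes "skew_op M"
  shows "norm (app (exp (t *\<^sub>R M)) x) = norm x"
proof -
  let ?y = "\<lambda>t. app (exp (t *\<^sub>R M)) x"
  have M_exp: "app (exp (t *\<^sub>R M)) (app M x) = app M (?y t)" for t
    by (metis app_times exp_times_scaleR_commute)
  have "((\<lambda>t. inner (?y t) (?y t)) has_real_derivative 0) (at t)" for t
    using bounded_bilinear.has_vector_derivative[OF bounded_bilinear_inner
        exp_app_has_vector_derivative[of M x t UNIV] exp_app_has_vector_derivative[of M x t UNIV]]
      inner_skew_self[OF assms, of "?y t"]
    unfolding has_real_derivative_iff_has_vector_derivative
    by (simp add: M_exp inner_commute)
  then have "inner (?y t) (?y t) = inner (?y 0) (?y 0)"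
    using DERIV_isconst_all by blast
  then show ?thesis by (simp add: app_one norm_eq_sqrt_inner)
qed

text \<open>Mean value inequality: the derivative at each time is the isometry applied to
  \<open>app M x\<close>.\<close>

lemma norm_exp_skew_diff_le:
  fixes M :: "'a::{real_inner, banach, perfect_space} endo"
  assumes "skew_op M"
  shows "norm (app (exp (t *\<^sub>R M)) x - x) \<le> \<bar>t\<bar> * norm (app M x)"
proof -
  have "norm (app (exp (t *\<^sub>R M)) x - app (exp (0 *\<^sub>R M)) x) \<le> norm (app M x) * norm (t - 0)"
  proof (rule differentiable_bound[where S = UNIV and f' = "\<lambda>t h. h *\<^sub>R app (exp (t *\<^sub>R M)) (app M x)"])
    show "((\<lambda>t. app (exp (t *\<^sub>R M)) x) has_derivative (\<lambda>h. h *\<^sub>R app (exp (t *\<^sub>R M)) (app M x)))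
        (at t within UNIV)" for t
      using exp_app_has_vector_derivative by (simp add: has_vector_derivative_def)
    show "onorm (\<lambda>h. h *\<^sub>R app (exp (t *\<^sub>R M)) (app M x)) \<le> norm (app M x)" for t
      by (rule onorm_le) (simp add: norm_exp_skew[OF assms])
  qed auto
  then show ?thesis by (simp add: app_one mult.commute)
qed

text \<open>The generator of interest is the possibly unbounded inverse of \<open>G\<close>.
  Expressed by \<open>G\<close>, a vector of its domain is \<open>app G y\<close>, and the generator
  maps it to \<open>y\<close>.\<close>

locale skew_generator =
  fixes G :: "'a::{real_inner, banach, perfect_space} endo"
  assumes skew: "skew_op G"
    and inj: "app G x = 0 \<Longrightarrow> x = 0"
begin

text \<open>The form of \<open>G * G\<close> at \<open>x\<close> is minus the squared norm of
  \<open>app G x\<close>. This factor therefore puts \<open>C\<close> below between 0 and 1; the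
  summand 1 keeps the denominator positive.\<close>

definition scl :: real where "scl = 1 / (1 + (norm G)\<^sup>2)"

definition C :: "'a endo" where "C = 1 + scl *\<^sub>R (G * G)"

definition P :: "nat \<Rightarrow> 'a endo" where "P n = scl *\<^sub>R (\<Sum>j<n. C ^ j)"

text \<open>These are bounded approximations of the inverse of \<^term>\<open>G\<close>: since
  \<^term>\<open>C = 1 + scl *\<^sub>R (G * G)\<close>, the geometric sum gives \<^prop>\<open>M n * G = 1 - C ^ n\<close>.\<close>

definition M :: "nat \<Rightarrow> 'a endo" where "M n = - (G * P n)"

lemma scl_pos: "0 < scl" and scl_bound: "scl * (norm G)\<^sup>2 \<le> 1"
proof -
  have "0 < 1 + (norm G)\<^sup>2" by (rule add_pos_nonneg) auto
  then show "0 < scl" "scl * (norm G)\<^sup>2 \<le> 1" by (auto simp: scl_def field_simps)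
qed

lemma inner_GG: "inner (app (G * G) x) y = - inner (app G x) (app G y)"
  by (simp add: app_times skew_opD[OF skew, of "app G x"])

sublocale C: positive_contraction C
proof
  have "inner (app G (app G x)) y = inner x (app G (app G y))" for x y
    by (simp add: skew_opD[OF skew])
  then show "symmetric_op C"
    by (simp add: symmetric_op_def C_def app_simps inner_add)
  have *: "inner (app C x) x = inner x x - scl * (norm (app G x))\<^sup>2" for x
    using inner_GG[of x x]
    by (simp add: C_def endo_app_add app_one endo_app_scaleR inner_add power2_norm_eq_inner)
  show "0 \<le> inner (app C x) x" for x
  proof -
    have "scl * (norm (app G x))\<^sup>2 \<le> scl * ((norm G)\<^sup>2 * (norm x)\<^sup>2)"
      using norm_app[of G x] scl_pos
      by (intro mult_left_mono) (auto simp: power_mult_distrib[symmetric] intro!: power_mono)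
    also have "\<dots> \<le> 1 * (norm x)\<^sup>2"
      unfolding mult.assoc[symmetric] by (intro mult_right_mono scl_bound) simp
    finally show ?thesis by (simp add: * power2_norm_eq_inner)
  qed
  show "inner (app C x) x \<le> inner x x" for x
    using scl_pos by (simp add: *)
qed

text \<open>A fixed vector of \<open>C\<close> is annihilated by \<open>G * G\<close>, and pairing
  with the vector itself shows that \<open>G\<close> annihilates it.\<close>

lemma C_power_tendsto_0: "(\<lambda>n. app (C ^ n) x) \<longlonglongrightarrow> 0"
proof (rule C.power_tendsto_zero)
  fix x assume "app C x = x"
  then have "app (G * G) x = 0"
    using scl_pos by (simp add: C_def app_simps)
  then have "inner (app G x) (app G x) = 0"
    using inner_GG[of x x] by simp
  then show "x = 0" using inj by simp
qed

text \<open>All operators built here are polynomials in \<open>G\<close>. This lemma and the next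
  ones record that they commute, which is what allows exponentials to be compared.\<close>

lemma G_C: "G * C = C * G"
  by (simp add: C_def algebra_simps)

lemma G_power: "G * C ^ n = C ^ n * G"
  using power_commuting_commutes[of C G n] G_C by simp

lemma C_power_P: "C ^ n * P m = P m * C ^ n"
  by (simp add: P_def sum_distrib_left sum_distrib_right power_add[symmetric] add.commute)

lemma G_P: "G * P n = P n * G"
  by (simp add: P_def sum_distrib_left sum_distrib_right G_power)

lemma P_P: "P m * P n = P n * P m"
  unfolding P_def[of m] by (simp add: sum_distrib_left sum_distrib_right C_power_P)

lemma M_M: "M m * M n = M n * M m"
proof -
  have "G * P m * (G * P n) = G * G * (P m * P n)" for m n
  proof -
    have "G * P m * (G * P n) = G * (P m * G) * P n" by (simp only: mult.assoc)
    also have "\<dots> = G * (G * P m) * P n" by (simp only: G_P)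
    finally show ?thesis by (simp only: mult.assoc)
  qed
  then show ?thesis by (simp add: M_def P_P[of m n])
qed

lemma G_M: "G * M n = M n * G"
  unfolding M_def by (simp add: mult.assoc flip: G_P)

lemma M_G: "M n * G = 1 - C ^ n"
proof -
  have "(1 - C) * (\<Sum>j<n. C ^ j) = 1 - C ^ n"
  proof (induction n)
    case (Suc n)
    then show ?case by (simp add: distrib_left) (simp add: left_diff_distrib)
  qed simp
  moreover have "M n * G = (1 - C) * (\<Sum>j<n. C ^ j)"
  proof -
    have "1 - C = - (scl *\<^sub>R (G * G))" by (simp add: C_def)
    then show ?thesis
      unfolding M_def by (simp add: mult.assoc flip: G_P) (simp add: P_def mult.assoc)
  qed
  ultimately show ?thesis by simp
qed

lemma app_M_G: "app (M n) (app G y) = y - app (C ^ n) y"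
  using arg_cong[OF M_G, of "\<lambda>T. app T y"] by (simp add: app_simps)

lemma app_G_M: "app G (app (M n) y) = y - app (C ^ n) y"
  using arg_cong[OF M_G, of "\<lambda>T. app T y"] unfolding G_M[symmetric] by (simp add: app_simps)

text \<open>\<open>M n\<close> is an odd polynomial in the skew operator \<open>G\<close>:
  \<open>P n\<close> is a polynomial in \<open>G * G\<close> and thus symmetric.\<close>

lemma skew_M: "skew_op (M n)"
proof -
  have P: "inner (app (P n) x) y = inner x (app (P n) y)" for x y
  proof -
    have "inner (app (C ^ j) x) y = inner x (app (C ^ j) y)" for j
      using C.inner_power[of j x 0 y] C.inner_power[of 0 x j y] by (simp add: app_one)
    then show ?thesis
      by (simp add: P_def endo_app_scaleR endo_app_sum inner_sum_left inner_sum_right)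
  qed
  show ?thesis
    unfolding skew_op_def
  proof (intro allI)
    fix x y
    have "inner (app (M n) x) y = - inner (app G (app (P n) x)) y"
      by (simp add: M_def app_simps)
    also have "\<dots> = inner x (app (P n * G) y)"
      by (simp add: skew_opD[OF skew] P app_times)
    finally show "inner (app (M n) x) y = - inner x (app (M n) y)"
      by (simp add: M_def app_simps(6-) G_P)
  qed
qed

definition E :: "nat \<Rightarrow> real \<Rightarrow> 'a endo" where "E n t = exp (t *\<^sub>R M n)"

lemma norm_E: "norm (app (E n t) x) = norm x"
  unfolding E_def by (rule norm_exp_skew[OF skew_M])

text \<open>The exponents commute, so \<open>E n t\<close> is \<open>E m t\<close> times the
  exponential of the difference. The isometry \<open>E m t\<close> drops out and
  \<open>norm_exp_skew_diff_le\<close> remains.\<close>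

lemma norm_E_diff_le: "norm (app (E n t) x - app (E m t) x) \<le> \<bar>t\<bar> * norm (app (M n) x - app (M m) x)"
proof -
  let ?D = "exp (t *\<^sub>R (M n - M m))"
  have "E n t = exp (t *\<^sub>R M m + t *\<^sub>R (M n - M m))"
    by (simp add: E_def algebra_simps)
  also have "\<dots> = E m t * ?D"
    unfolding E_def by (rule exp_add_commuting) (simp add: algebra_simps M_M)
  finally have "app (E n t) x - app (E m t) x = app (E m t) (app ?D x - x)"
    by (simp add: app_simps)
  then have "norm (app (E n t) x - app (E m t) x) = norm (app ?D x - x)"
    by (simp add: norm_E)
  also have "\<dots> \<le> \<bar>t\<bar> * norm (app (M n - M m) x)"
    by (intro norm_exp_skew_diff_le skew_op_diff skew_M)
  finally show ?thesis by (simp add: endo_app_diff)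
qed

text \<open>The range of \<open>G\<close> is dense, and on it the bounded generators converge, since
  \<open>app (M n) (app G y)\<close> is \<open>y - app (C ^ n) y\<close>. Isometry extends the
  conclusion to every vector.\<close>

lemma E_uniformly_Cauchy:
  assumes "e > 0"
  shows "\<exists>N. \<forall>n\<ge>N. \<forall>m\<ge>N. \<forall>t. \<bar>t\<bar> \<le> T \<longrightarrow> norm (app (E n t) x - app (E m t) x) < e"
proof -
  obtain k where k: "norm (app (C ^ k) x) < e / 4"
    using LIMSEQ_D[OF C_power_tendsto_0, of "e / 4" x] assms by auto
  \<comment> \<open>\<open>M k\<close> approximates the inverse of \<open>G\<close>, so
    \<open>app G y\<close> misses \<open>x\<close> only by \<open>app (C ^ k) x\<close>, which costs
    at most twice e / 4.\<close>
  define y where "y = app (M k) x"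
  have x: "x = app G y + app (C ^ k) x"
    by (simp add: y_def app_G_M)
  have "0 < e / (4 * (\<bar>T\<bar> + 1))" using assms by (simp add: add_nonneg_pos)
  then obtain N where N: "\<And>n. n \<ge> N \<Longrightarrow> norm (app (C ^ n) y) < e / (4 * (\<bar>T\<bar> + 1))"
    using LIMSEQ_D[OF C_power_tendsto_0, of _ y] by (metis diff_zero)
  have "norm (app (E n t) x - app (E m t) x) < e" if "n \<ge> N" "m \<ge> N" "\<bar>t\<bar> \<le> T" for n m t
  proof -
    have "norm (app (E n t) x - app (E m t) x)
      = norm ((app (E n t) (app G y) - app (E m t) (app G y))
          + (app (E n t) (app (C ^ k) x) - app (E m t) (app (C ^ k) x)))"
      by (subst (1 2) x) (simp only: app_add add_diff_add)
    also have "\<dots> \<le> norm (app (E n t) (app G y) - app (E m t) (app G y))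
        + norm (app (E n t) (app (C ^ k) x) - app (E m t) (app (C ^ k) x))"
      by (rule norm_triangle_ineq)
    also have "norm (app (E n t) (app (C ^ k) x) - app (E m t) (app (C ^ k) x)) \<le> 2 * norm (app (C ^ k) x)"
      using norm_triangle_ineq4[of "app (E n t) (app (C ^ k) x)" "app (E m t) (app (C ^ k) x)"]
      by (simp add: norm_E)
    also have "norm (app (E n t) (app G y) - app (E m t) (app G y))
        \<le> \<bar>t\<bar> * norm (app (C ^ m) y - app (C ^ n) y)"
      using norm_E_diff_le[of n t "app G y" m] by (simp add: app_M_G)
    also have "\<dots> \<le> (\<bar>T\<bar> + 1) * (2 * (e / (4 * (\<bar>T\<bar> + 1))))"
    proof (rule mult_mono)
      show "norm (app (C ^ m) y - app (C ^ n) y) \<le> 2 * (e / (4 * (\<bar>T\<bar> + 1)))"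
        using norm_triangle_ineq4[of "app (C ^ m) y" "app (C ^ n) y"] N[of n] N[of m] that by simp
    qed (use that in auto)
    also have "\<dots> = e / 2" by (simp add: field_simps add_nonneg_eq_0_iff)
    finally show ?thesis using k by simp
  qed
  then show ?thesis by blast
qed

section \<open>The strong limit of the approximating groups\<close>

definition U :: "real \<Rightarrow> 'a \<Rightarrow> 'a" where "U t x = lim (\<lambda>n. app (E n t) x)"

lemma E_tendsto_U: "(\<lambda>n. app (E n t) x) \<longlonglongrightarrow> U t x"
proof -
  have "Cauchy (\<lambda>n. app (E n t) x)"
  proof (rule metric_CauchyI)
    fix e :: real assume "e > 0"
    from E_uniformly_Cauchy[OF this, of "\<bar>t\<bar>" x]
    show "\<exists>N. \<forall>m\<ge>N. \<forall>n\<ge>N. dist (app (E m t) x) (app (E n t) x) < e"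
      by (auto simp: dist_norm)
  qed
  then show ?thesis
    unfolding U_def by (intro convergent_LIMSEQ_iff[THEN iffD1] Cauchy_convergent)
qed

lemma E_uniform_limit: "uniform_limit {- T..T} (\<lambda>n t. app (E n t) x) (\<lambda>t. U t x) sequentially"
proof (rule uniform_limitI)
  fix e :: real assume "e > 0"
  then have "e / 2 > 0" by simp
  from E_uniformly_Cauchy[OF this, of T x] obtain N where
    N: "\<And>n m t. n \<ge> N \<Longrightarrow> m \<ge> N \<Longrightarrow> \<bar>t\<bar> \<le> T \<Longrightarrow> norm (app (E n t) x - app (E m t) x) < e / 2"
    by blast
  have "dist (app (E n t) x) (U t x) < e" if "n \<ge> N" "t \<in> {- T..T}" for n t
  proof -
    have "(\<lambda>m. norm (app (E n t) x - app (E m t) x)) \<longlonglongrightarrow> norm (app (E n t) x - U t x)"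
      by (intro tendsto_intros E_tendsto_U)
    moreover have "\<forall>m\<ge>N. norm (app (E n t) x - app (E m t) x) \<le> e / 2"
      using N that by (auto simp: abs_le_iff intro!: less_imp_le)
    ultimately have "norm (app (E n t) x - U t x) \<le> e / 2"
      by (intro LIMSEQ_le_const2) auto
    then show ?thesis using \<open>e > 0\<close> by (simp add: dist_norm)
  qed
  then show "\<forall>\<^sub>F n in sequentially. \<forall>t\<in>{- T..T}. dist (app (E n t) x) (U t x) < e"
    unfolding eventually_sequentially by blast
qed

lemma U_diff: "U t (x - y) = U t x - U t y"
  using E_tendsto_U[of t "x - y"] tendsto_diff[OF E_tendsto_U[of t x] E_tendsto_U[of t y]]
  by (simp add: app_diff LIMSEQ_unique)

lemma U_scaleR: "U t (r *\<^sub>R x) = r *\<^sub>R U t x"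
  using E_tendsto_U[of t "r *\<^sub>R x"] tendsto_scaleR[OF tendsto_const E_tendsto_U[of t x], of r]
  by (simp add: app_scaleR LIMSEQ_unique)

lemma norm_U: "norm (U t x) = norm x"
  using tendsto_norm[OF E_tendsto_U[of t x]] by (simp add: norm_E LIMSEQ_const_iff)

lemma U_0: "U 0 x = x"
  using E_tendsto_U[of 0 x] by (simp add: E_def app_one LIMSEQ_const_iff)

lemma U_minus: "U t (U (- t) x) = x"
proof -
  have "app (E n t) (app (E n (- t)) x) = x" for n
    using exp_minus_inverse[of "t *\<^sub>R M n"] by (simp add: E_def app_times[symmetric] app_one)
  \<comment> \<open>The inverse relation holds for each \<open>n\<close>; the isometry
    \<open>E n t\<close> moves the error of the limit to time - t, where it tends to 0 for a fixed
    vector.\<close>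
  then have eq: "norm (x - app (E n t) (U (- t) x)) = norm (app (E n (- t)) x - U (- t) x)" for n
    by (metis app_diff norm_E)
  have 0: "(\<lambda>n. norm (app (E n (- t)) x - U (- t) x)) \<longlonglongrightarrow> 0"
    by (rule tendsto_norm_zero) (rule LIM_zero[OF E_tendsto_U])
  have "(\<lambda>n. norm (x - app (E n t) (U (- t) x))) \<longlonglongrightarrow> norm (x - U t (U (- t) x))"
    by (intro tendsto_intros E_tendsto_U)
  from LIMSEQ_unique[OF this[unfolded eq] 0] have "norm (x - U t (U (- t) x)) = 0" .
  then show ?thesis by simp
qed

text \<open>\<open>G\<close> commutes with every power of \<open>M n\<close>, hence with the
  exponential series, hence with the strong limit.\<close>

lemma G_U: "app G (U t x) = U t (app G x)"
proof -
  have "G * E n t = E n t * G" for n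
  proof -
    have "G * (t *\<^sub>R M n) ^ k = (t *\<^sub>R M n) ^ k * G" for k
      by (rule power_commuting_commutes[symmetric]) (simp add: G_M)
    then show ?thesis
      using summable_exp_generic[of "t *\<^sub>R M n"]
      by (simp add: E_def exp_def suminf_mult[symmetric] suminf_mult2 del: scaleR_power)
  qed
  then have "app G (app (E n t) x) = app (E n t) (app G x)" for n
    by (metis app_times)
  then show ?thesis
    using bounded_linear.tendsto[OF app_bounded_linear E_tendsto_U[of t x], of G]
      E_tendsto_U[of t "app G x"] by (simp add: LIMSEQ_unique)
qed

lemma continuous_U: "continuous_on UNIV (\<lambda>t. U t x)"
proof -
  have "isCont (\<lambda>t. U t x) t" for t
  proof -
    have "continuous_on {- (\<bar>t\<bar> + 1)..\<bar>t\<bar> + 1} (\<lambda>t. U t x)"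
    proof (rule uniform_limit_theorem[OF _ E_uniform_limit])
      show "\<forall>\<^sub>F n in sequentially. continuous_on {- (\<bar>t\<bar> + 1)..\<bar>t\<bar> + 1} (\<lambda>t. app (E n t) x)"
        unfolding E_def continuous_on_eq_continuous_within
        by (intro always_eventually allI ballI
            has_vector_derivative_continuous[OF exp_app_has_vector_derivative])
    qed simp
    moreover have "t \<in> interior {- (\<bar>t\<bar> + 1)..\<bar>t\<bar> + 1}" by (auto simp: abs_if)
    ultimately show ?thesis using continuous_on_interior by blast
  qed
  then show ?thesis by (simp add: continuous_at_imp_continuous_on)
qed

text \<open>Joint continuity: continuity in time at the fixed vector \<open>x\<close>, and isometry
  for the difference \<open>z s - x\<close>.\<close>

lemma U_tendsto:
  assumes "(z \<longlongrightarrow> x) F" "(\<tau> \<longlongrightarrow> t) F"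
  shows "((\<lambda>s. U (\<tau> s) (z s)) \<longlongrightarrow> U t x) F"
proof -
  have "((\<lambda>s. U (\<tau> s) x) \<longlongrightarrow> U t x) F"
    using continuous_U assms(2) by (auto intro: isCont_tendsto_compose simp: continuous_on_eq_continuous_at)
  moreover have "((\<lambda>s. U (\<tau> s) (z s - x)) \<longlongrightarrow> 0) F"
    by (rule tendsto_norm_zero_cancel) (use assms(1) in \<open>simp add: norm_U tendsto_norm_zero LIM_zero\<close>)
  ultimately have "((\<lambda>s. U (\<tau> s) x + U (\<tau> s) (z s - x)) \<longlongrightarrow> U t x + 0) F"
    by (rule tendsto_add)
  then show ?thesis by (simp add: U_diff)
qed

text \<open>This identifies the generator as the inverse of \<open>G\<close>. The approximations
  \<open>app (E n t) (app G y)\<close> have derivatives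
  \<open>app (E n t) (y - app (C ^ n) y)\<close>, which converge to \<open>U t y\<close> uniformly
  on bounded time intervals.\<close>

lemma U_G_has_vector_derivative:
  "((\<lambda>t. U t (app G y)) has_vector_derivative U t y) (at t within S)"
proof -
  define T where "T = \<bar>t\<bar> + 1"
  have t: "t \<in> interior {- T..T}" by (auto simp: abs_if T_def)
  have "\<exists>g. \<forall>s\<in>{- T..T}. (\<lambda>n. app (E n s) (app G y)) \<longlonglongrightarrow> g s \<and>
      (g has_derivative (\<lambda>h. h *\<^sub>R U s y)) (at s within {- T..T})"
  proof (rule has_derivative_sequence)
    show "convex {- T..T}" by simp
    show "((\<lambda>t. app (E n t) (app G y)) has_derivative (\<lambda>h. h *\<^sub>R app (E n s) (app (M n) (app G y))))
        (at s within {- T..T})" for n s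
      using exp_app_has_vector_derivative by (simp add: has_vector_derivative_def E_def)
    show "\<forall>\<^sub>F n in sequentially. \<forall>s\<in>{- T..T}. \<forall>h.
        norm (h *\<^sub>R app (E n s) (app (M n) (app G y)) - h *\<^sub>R U s y) \<le> e * norm h"
      if "e > 0" for e
    proof -
      have e2: "e / 2 > 0" using that by simp
      have "\<forall>\<^sub>F n in sequentially. norm (app (C ^ n) y) < e / 2"
        using tendstoD[OF C_power_tendsto_0 e2] by (simp add: dist_norm)
      moreover have "\<forall>\<^sub>F n in sequentially. \<forall>s\<in>{- T..T}. dist (app (E n s) y) (U s y) < e / 2"
        using E_uniform_limit e2 by (rule uniform_limitD)
      ultimately show ?thesis
      proof eventually_elim
        case (elim n)
        show ?case
        proof (intro ballI allI)
          fix s h assume s: "s \<in> {- T..T}"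
          have "norm (app (E n s) (app (M n) (app G y)) - U s y)
              = norm ((app (E n s) y - U s y) - app (E n s) (app (C ^ n) y))"
            by (simp add: app_M_G app_diff algebra_simps)
          also have "\<dots> \<le> dist (app (E n s) y) (U s y) + norm (app (C ^ n) y)"
            by (metis dist_norm norm_E norm_triangle_ineq4)
          also have "\<dots> \<le> e" using elim s by fastforce
          finally show "norm (h *\<^sub>R app (E n s) (app (M n) (app G y)) - h *\<^sub>R U s y) \<le> e * norm h"
            by (simp add: scaleR_diff_right[symmetric] mult_left_mono mult.commute[of e])
        qed
      qed
    qed
    show "(\<lambda>n. app (E n t) (app G y)) \<longlonglongrightarrow> U t (app G y)"
      by (rule E_tendsto_U)
    show "t \<in> {- T..T}" using t interior_subset by blast
  qed
  then obtain g where g: "\<And>s. s \<in> {- T..T} \<Longrightarrow> (\<lambda>n. app (E n s) (app G y)) \<longlonglongrightarrow> g s"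
    "\<And>s. s \<in> {- T..T} \<Longrightarrow> (g has_vector_derivative U s y) (at s within {- T..T})"
    unfolding has_vector_derivative_def by blast
  have "g s = U s (app G y)" if "s \<in> {- T..T}" for s
    using LIMSEQ_unique[OF g(1)[OF that] E_tendsto_U] .
  moreover have tT: "t \<in> {- T..T}" using t interior_subset by blast
  ultimately have "((\<lambda>s. U s (app G y)) has_vector_derivative U t y) (at t within {- T..T})"
    by (intro has_vector_derivative_transform[OF tT _ g(2)[OF tT]]) simp
  then show ?thesis
    unfolding at_within_interior[OF t] by (rule has_vector_derivative_at_within)
qed

end

section \<open>Semilinear evolution equations\<close>

text \<open>Energy derivatives are defined by difference quotients; this is the bridge to them in
  both directions.\<close>

lemma has_vector_derivative_iff_tendsto:
  "(f has_vector_derivative D) (at t within S) \<longleftrightarrow>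
    ((\<lambda>s. (1 / (s - t)) *\<^sub>R (f s - f t)) \<longlongrightarrow> D) (at t within S)"
proof -
  have *: "norm (f s - f t - (s - t) *\<^sub>R D) / norm (s - t) = norm ((1 / (s - t)) *\<^sub>R (f s - f t) - D)"
    if "s \<noteq> t" for s
  proof -
    have "(1 / (s - t)) *\<^sub>R (f s - f t) - D = (1 / (s - t)) *\<^sub>R (f s - f t - (s - t) *\<^sub>R D)"
      using that by (simp add: scaleR_diff_right)
    then show ?thesis by simp
  qed
  have "((\<lambda>s. norm (f s - f t - (s - t) *\<^sub>R D) / norm (s - t)) \<longlongrightarrow> 0) (at t within S) \<longleftrightarrow>
      ((\<lambda>s. norm ((1 / (s - t)) *\<^sub>R (f s - f t) - D)) \<longlongrightarrow> 0) (at t within S)"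
    by (intro Lim_cong_within refl *)
  then show ?thesis
    unfolding has_vector_derivative_def has_derivative_iff_norm
    by (simp add: bounded_linear_scaleR_left Lim_null[symmetric] tendsto_norm_zero_iff)
qed

lemma at_within_Icc_eq_at_within_atLeast:
  fixes s t :: real
  assumes "0 \<le> s" "s < t"
  shows "at s within {0..t} = at s within {0..}"
  by (rule at_within_nhd[of _ "{..<t}"]) (use assms in auto)

lemma continuous_Lipschitz_compose:
  fixes f :: "real \<Rightarrow> 'a::real_normed_vector \<Rightarrow> 'b::real_normed_vector"
  assumes f: "\<And>x. continuous_on S (\<lambda>t. f t x)"
    and lip: "\<And>t x y. t \<in> S \<Longrightarrow> norm (f t x - f t y) \<le> K * norm (x - y)"
    and z: "continuous_on S z"
  shows "continuous_on S (\<lambda>t. f t (z t))"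
  unfolding continuous_on_def
proof
  fix t assume t: "t \<in> S"
  have "((\<lambda>s. f s (z t)) \<longlongrightarrow> f t (z t)) (at t within S)"
    using f t by (simp add: continuous_on_def)
  moreover have "((\<lambda>s. f s (z s) - f s (z t)) \<longlongrightarrow> 0) (at t within S)"
  proof (rule Lim_null_comparison)
    show "\<forall>\<^sub>F s in at t within S. norm (f s (z s) - f s (z t)) \<le> K * norm (z s - z t)"
      by (auto simp: eventually_at_filter lip)
    have "((\<lambda>s. K * norm (z s - z t)) \<longlongrightarrow> K * norm (z t - z t)) (at t within S)"
      using z t by (intro tendsto_intros) (simp add: continuous_on_def)
    then show "((\<lambda>s. K * norm (z s - z t)) \<longlongrightarrow> 0) (at t within S)" by simp
  qed
  ultimately have "((\<lambda>s. f s (z t) + (f s (z s) - f s (z t))) \<longlongrightarrow> f t (z t) + 0) (at t within S)"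
    by (rule tendsto_add)
  then show "((\<lambda>s. f s (z s)) \<longlongrightarrow> f t (z t)) (at t within S)" by simp
qed

text \<open>One sequence \<open>P\<close> of iterates is defined for all times, and its convergence
  is shown on each {0..T} with the Lipschitz constant for that T. The limit is thereby global at
  once, without a continuation argument.\<close>

theorem global_Picard:
  fixes f :: "real \<Rightarrow> 'a::banach \<Rightarrow> 'a"
  assumes f: "\<And>x. continuous_on {0..} (\<lambda>t. f t x)"
    and lip: "\<And>T. \<exists>K. \<forall>t\<in>{0..T}. \<forall>x y. norm (f t x - f t y) \<le> K * norm (x - y)"
  obtains y where "y 0 = y0"
    "\<And>t. 0 \<le> t \<Longrightarrow> (y has_vector_derivative f t (y t)) (at t within {0..})"
proof -
  define P where "P = rec_nat (\<lambda>t. y0) (\<lambda>_ z t. y0 + integral {0..t} (\<lambda>s. f s (z s)))"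
  have P_0: "P 0 t = y0" and P_Suc: "P (Suc k) t = y0 + integral {0..t} (\<lambda>s. f s (P k s))" for k t
    by (simp_all add: P_def)
  define y where "y t = y0 + (\<Sum>k. P (Suc k) t - P k t)" for t
  have main: "uniform_limit {0..T} P y sequentially \<and> continuous_on {0..T} y \<and>
      (\<forall>t\<in>{0..T}. y t = y0 + integral {0..t} (\<lambda>s. f s (y s))) \<and>
      continuous_on {0..T} (\<lambda>s. f s (y s))" if T: "0 \<le> T" for T
  proof -
    obtain K0 where K0: "\<And>t x y. t \<in> {0..T} \<Longrightarrow> norm (f t x - f t y) \<le> K0 * norm (x - y)"
      using lip by blast
    define K where "K = max K0 1"
    have K: "norm (f t x - f t y) \<le> K * norm (x - y)" if "t \<in> {0..T}" for t x y
      using K0[OF that, of x y] mult_right_mono[of K0 K "norm (x - y)"] by (simp add: K_def)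
    have K1: "1 \<le> K" by (simp add: K_def)
    have cf: "continuous_on {0..T} (\<lambda>t. f t (z t))" if "continuous_on {0..T} z" for z
      by (rule continuous_Lipschitz_compose[OF _ K that]) (auto intro: continuous_on_subset[OF f])
    have cint: "continuous_on {0..T} (\<lambda>t. y0 + integral {0..t} (\<lambda>s. f s (z s)))"
      if "continuous_on {0..T} z" for z
      by (intro continuous_intros indefinite_integral_continuous_1 integrable_continuous_real cf that)
    have cP: "continuous_on {0..T} (P k)" for k
    proof (induction k)
      case (Suc k)
      then show ?case using cint by (simp add: P_Suc[abs_def])
    qed (simp add: P_0[abs_def])
    have intP: "(\<lambda>s. f s (P k s)) integrable_on {0..t}" if "t \<in> {0..T}" for k t
      by (rule integrable_continuous_real, rule continuous_on_subset[OF cf[OF cP]]) (use that in auto)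
    obtain D where D: "\<And>t. t \<in> {0..T} \<Longrightarrow> norm (P (Suc 0) t - P 0 t) \<le> D"
    proof -
      have "bounded ((\<lambda>t. P (Suc 0) t - P 0 t) ` {0..T})"
        by (intro compact_imp_bounded compact_continuous_image continuous_intros cP) auto
      then show thesis using that unfolding bounded_iff by blast
    qed
    have D0: "0 \<le> D" using order_trans[OF norm_ge_zero D[of 0]] T by simp
    \<comment> \<open>Because of the weight \<open>exp (2 * K * t)\<close>, integration against
      \<open>K\<close> gains the factor 1/2 in each step, however long the time interval is.\<close>
    have step: "norm (P (Suc k) t - P k t) \<le> D * exp (2 * K * t) * (1/2) ^ k" if "t \<in> {0..T}" for k t
      using that
    proof (induction k arbitrary: t)
      case 0
      have "D * 1 \<le> D * exp (2 * K * t)"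
        using 0 K1 D0 by (intro mult_left_mono) auto
      then show ?case using D[OF 0] by simp
    next
      case (Suc k)
      have hi: "((\<lambda>s. K * (D * exp (2 * K * s) * (1/2) ^ k)) has_integral
          (D / 2 * exp (2 * K * t) * (1/2) ^ k - D / 2 * exp (2 * K * 0) * (1/2) ^ k)) {0..t}"
        using Suc.prems
        by (intro fundamental_theorem_of_calculus)
          (auto intro!: derivative_eq_intros
            simp: has_real_derivative_iff_has_vector_derivative[symmetric])
      have "norm (P (Suc (Suc k)) t - P (Suc k) t)
          = norm (integral {0..t} (\<lambda>s. f s (P (Suc k) s)) - integral {0..t} (\<lambda>s. f s (P k s)))"
        unfolding P_Suc[of "Suc k" t] P_Suc[of k t] by simp
      also have "\<dots> = norm (integral {0..t} (\<lambda>s. f s (P (Suc k) s) - f s (P k s)))"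
        by (simp only: integral_diff[OF intP intP, OF Suc.prems Suc.prems])
      also have "\<dots> \<le> integral {0..t} (\<lambda>s. K * (D * exp (2 * K * s) * (1/2) ^ k))"
      proof (rule integral_norm_bound_integral)
        show "(\<lambda>s. f s (P (Suc k) s) - f s (P k s)) integrable_on {0..t}"
          by (intro integrable_diff intP Suc.prems)
        show "(\<lambda>s. K * (D * exp (2 * K * s) * (1/2) ^ k)) integrable_on {0..t}"
          using hi by blast
        fix s assume s: "s \<in> {0..t}"
        then have sT: "s \<in> {0..T}" using Suc.prems by auto
        have "norm (f s (P (Suc k) s) - f s (P k s)) \<le> K * norm (P (Suc k) s - P k s)"
          by (rule K[OF sT])
        also have "\<dots> \<le> K * (D * exp (2 * K * s) * (1/2) ^ k)"
          using K1 by (intro mult_left_mono Suc.IH sT) auto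
        finally show "norm (f s (P (Suc k) s) - f s (P k s)) \<le> K * (D * exp (2 * K * s) * (1/2) ^ k)" .
      qed
      also have "\<dots> \<le> D * exp (2 * K * t) * (1/2) ^ Suc k"
        unfolding integral_unique[OF hi] using D0 by simp
      finally show ?case .
    qed
    have "uniform_limit {0..T} (\<lambda>n t. \<Sum>k<n. P (Suc k) t - P k t) (\<lambda>t. \<Sum>k. P (Suc k) t - P k t) sequentially"
    proof (rule Weierstrass_m_test)
      show "norm (P (Suc k) t - P k t) \<le> D * exp (2 * K * T) * (1/2) ^ k" if "t \<in> {0..T}" for k t
      proof -
        have "D * exp (2 * K * t) * (1/2) ^ k \<le> D * exp (2 * K * T) * (1/2) ^ k"
          using that D0 K1 by (intro mult_right_mono mult_left_mono) auto
        then show ?thesis using step[OF that, of k] by linarith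
      qed
      show "summable (\<lambda>k. D * exp (2 * K * T) * (1/2) ^ k)"
        by (intro summable_mult summable_geometric) simp
    qed
    then have "uniform_limit {0..T} (\<lambda>n t. y0 + (\<Sum>k<n. P (Suc k) t - P k t)) y sequentially"
      unfolding y_def by (intro uniform_limit_intros)
    moreover have "y0 + (\<Sum>k<n. P (Suc k) t - P k t) = P n t" for n t
      using sum_lessThan_telescope[of "\<lambda>k. P k t" n] by (simp add: P_0)
    ultimately have ul: "uniform_limit {0..T} P y sequentially"
      by (simp only:)
    have cy: "continuous_on {0..T} y"
      by (rule uniform_limit_theorem[OF _ ul]) (use cP in auto)
    moreover have "y t = y0 + integral {0..t} (\<lambda>s. f s (y s))" if t: "t \<in> {0..T}" for t
    proof -
      have ulf: "uniform_limit {0..t} (\<lambda>k s. f s (P k s)) (\<lambda>s. f s (y s)) sequentially"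
      proof (rule uniform_limitI)
        fix e :: real assume "e > 0"
        then have "e / K > 0" using K1 by simp
        with ul have "\<forall>\<^sub>F k in sequentially. \<forall>s\<in>{0..T}. dist (P k s) (y s) < e / K"
          by (rule uniform_limitD)
        then show "\<forall>\<^sub>F k in sequentially. \<forall>s\<in>{0..t}. dist (f s (P k s)) (f s (y s)) < e"
        proof eventually_elim
          case (elim k)
          show ?case
          proof
            fix s assume "s \<in> {0..t}"
            then have s: "s \<in> {0..T}" using t by auto
            then have "K * norm (P k s - y s) < K * (e / K)"
              using elim K1 by (intro mult_strict_left_mono) (auto simp: dist_norm)
            then show "dist (f s (P k s)) (f s (y s)) < e"
              using K[OF s, of "P k s" "y s"] K1 by (simp add: dist_norm)
          qed
        qed
      qed
      have "(\<lambda>k. integral {0..t} (\<lambda>s. f s (P k s))) \<longlonglongrightarrow> integral {0..t} (\<lambda>s. f s (y s))"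
      proof -
        have "continuous_on {0..t} (\<lambda>s. f s (P k s))" for k
          by (rule continuous_on_subset[OF cf[OF cP]]) (use t in auto)
        from uniform_limit_integral[OF ulf this sequentially_bot]
        obtain I J where IJ: "\<And>k. ((\<lambda>s. f s (P k s)) has_integral I k) {0..t}"
          "((\<lambda>s. f s (y s)) has_integral J) {0..t}" "(I \<longlongrightarrow> J) sequentially"
          by blast
        moreover have "I = (\<lambda>k. integral {0..t} (\<lambda>s. f s (P k s)))"
          by (rule ext) (simp add: integral_unique[OF IJ(1)])
        ultimately show ?thesis using IJ by (simp add: integral_unique)
      qed
      then have "(\<lambda>k. P (Suc k) t) \<longlonglongrightarrow> y0 + integral {0..t} (\<lambda>s. f s (y s))"
        unfolding P_Suc by (intro tendsto_intros)
      moreover have "(\<lambda>k. P (Suc k) t) \<longlonglongrightarrow> y t"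
        using tendsto_uniform_limitI[OF ul t] by (rule LIMSEQ_Suc)
      ultimately show ?thesis using LIMSEQ_unique by blast
    qed
    ultimately show ?thesis using ul cf by blast
  qed
  show thesis
  proof
    show "y 0 = y0" using main[of 0] by simp
    fix t :: real assume t: "0 \<le> t"
    have "((\<lambda>u. integral {0..u} (\<lambda>s. f s (y s))) has_vector_derivative f t (y t)) (at t within {0..t + 1})"
      using main[of "t + 1"] t by (intro integral_has_vector_derivative) auto
    then have "((\<lambda>u. y0 + integral {0..u} (\<lambda>s. f s (y s))) has_vector_derivative f t (y t)) (at t within {0..t + 1})"
      using has_vector_derivative_add[OF has_vector_derivative_const] by fastforce
    then have "(y has_vector_derivative f t (y t)) (at t within {0..t + 1})"
      using main[of "t + 1"] t
      by (elim has_vector_derivative_transform[rotated 2]) auto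
    then show "(y has_vector_derivative f t (y t)) (at t within {0..})"
      using at_within_Icc_eq_at_within_atLeast[of t "t + 1"] t by simp
  qed
qed

text \<open>Gronwall's argument: the squared norm times \<open>exp (- 2 * K * s)\<close> does not
  increase.\<close>

lemma norm_le_exp_if_inner_deriv_le:
  fixes y :: "real \<Rightarrow> 'a::real_inner"
  assumes y: "\<And>s. s \<in> {0..t} \<Longrightarrow> (y has_vector_derivative y' s) (at s within {0..t})"
    and le: "\<And>s. s \<in> {0..t} \<Longrightarrow> inner (y' s) (y s) \<le> K * (norm (y s))\<^sup>2"
    and "0 \<le> t"
  shows "norm (y t) \<le> norm (y 0) * exp (K * t)"
proof -
  define g where "g s = inner (y s) (y s) * exp (- 2 * K * s)" for s
  have "(g has_real_derivative
      (2 * inner (y' s) (y s) - 2 * K * inner (y s) (y s)) * exp (- 2 * K * s)) (at s within {0..t})"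
    if "s \<in> {0..t}" for s
  proof -
    have "((\<lambda>s. inner (y s) (y s)) has_real_derivative 2 * inner (y' s) (y s)) (at s within {0..t})"
      using bounded_bilinear.has_vector_derivative[OF bounded_bilinear_inner y[OF that] y[OF that]]
      unfolding has_real_derivative_iff_has_vector_derivative
      by (simp add: inner_commute)
    then show ?thesis
      unfolding g_def by (auto intro!: derivative_eq_intros simp: algebra_simps)
  qed
  note g' = this
  have "g t \<le> g 0"
  proof (rule DERIV_nonpos_imp_decreasing_open[OF assms(3)])
    show "continuous_on {0..t} g"
      by (rule DERIV_continuous_on[OF g'])
    fix s assume s: "0 < s" "s < t"
    then have "at s within {0..t} = at s" by (simp add: at_within_Icc_at)
    moreover have "(2 * inner (y' s) (y s) - 2 * K * inner (y s) (y s)) * exp (- 2 * K * s) \<le> 0"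
      using le[of s] s by (simp add: mult_nonpos_nonneg power2_norm_eq_inner)
    ultimately show "\<exists>D. DERIV g s :> D \<and> D \<le> 0"
      using g'[of s] s by auto
  qed
  then have "(norm (y t))\<^sup>2 \<le> (norm (y 0))\<^sup>2 * exp (2 * K * t)"
    by (simp add: g_def power2_norm_eq_inner exp_minus field_simps)
  also have "\<dots> = (norm (y 0) * exp (K * t))\<^sup>2"
    by (simp add: power_mult_distrib exp_double[symmetric] mult.assoc)
  finally show ?thesis by (rule power2_le_imp_le) simp
qed

section \<open>The radial retraction onto a ball\<close>

definition clamp_ball :: "real \<Rightarrow> 'a::real_normed_vector \<Rightarrow> 'a" where
  "clamp_ball r y = (r / max r (norm y)) *\<^sub>R y"

lemma clamp_ball_eq: "0 < r \<Longrightarrow> norm y \<le> r \<Longrightarrow> clamp_ball r y = y"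
  by (simp add: clamp_ball_def max_def)

lemma norm_clamp_ball:
  assumes "0 < r"
  shows "norm (clamp_ball r y) \<le> r" "norm (clamp_ball r y) \<le> norm y"
proof -
  have m: "0 < max r (norm y)" using assms by simp
  have "norm (clamp_ball r y) = r / max r (norm y) * norm y"
    using assms m by (simp add: clamp_ball_def)
  moreover have "r / max r (norm y) * norm y \<le> r"
    using assms m by (simp add: divide_le_eq mult_left_mono)
  moreover have "r / max r (norm y) * norm y \<le> 1 * norm y"
    using m by (intro mult_right_mono) auto
  ultimately show "norm (clamp_ball r y) \<le> r" "norm (clamp_ball r y) \<le> norm y" by simp_all
qed

lemma clamp_ball_Lipschitz:
  assumes r: "0 < r"
  shows "norm (clamp_ball r y - clamp_ball r z) \<le> 2 * norm (y - z)"
proof -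
  define a b where "a = max r (norm y)" and "b = max r (norm z)"
  have ab: "0 < a" "0 < b" "r \<le> a" "norm z \<le> b" using r by (auto simp: a_def b_def)
  have d: "\<bar>b - a\<bar> \<le> norm (y - z)"
    using norm_triangle_ineq3[of y z] by (auto simp: a_def b_def max_def abs_if split: if_splits)
  \<comment> \<open>One part comes from the points, with factor at most 1, the other from the two
    denominators; each is at most \<open>norm (y - z)\<close>, hence the constant 2.\<close>
  have "clamp_ball r y - clamp_ball r z = (r / a) *\<^sub>R (y - z) + (r / a * ((b - a) / b)) *\<^sub>R z"
  proof -
    have r: "r / b = r / a - r / a * ((b - a) / b)" using ab by (simp add: field_simps)
    show ?thesis
      unfolding clamp_ball_def a_def[symmetric] b_def[symmetric] r
      by (simp only: scaleR_diff_left scaleR_diff_right) simp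
  qed
  also have "norm \<dots> \<le> norm ((r / a) *\<^sub>R (y - z)) + norm ((r / a * ((b - a) / b)) *\<^sub>R z)"
    by (rule norm_triangle_ineq)
  also have "norm ((r / a) *\<^sub>R (y - z)) \<le> 1 * norm (y - z)"
    using mult_right_mono[of "r / a" 1 "norm (y - z)"] ab r by simp
  also have "norm ((r / a * ((b - a) / b)) *\<^sub>R z) = r / a * (\<bar>b - a\<bar> * (norm z / b))"
    using ab r by (simp add: abs_mult)
  also have "\<dots> \<le> 1 * (norm (y - z) * 1)"
    using ab r d by (intro mult_mono) auto
  finally show ?thesis by simp
qed

lemma continuous_clamp_ball:
  assumes "continuous_on S r" "continuous_on S y" "\<And>t. t \<in> S \<Longrightarrow> 0 < r t"
  shows "continuous_on S (\<lambda>t. clamp_ball (r t) (y t))"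
proof -
  have "max (r t) (norm (y t)) \<noteq> 0" if "t \<in> S" for t using assms(3)[OF that] by simp
  then show ?thesis unfolding clamp_ball_def by (intro continuous_intros assms) auto
qed

text \<open>The equation is \<phi>' = G^-1 \<phi> + N \<phi>. The bound \<open>K\<close> prevents
  blow-up of the time derivative of the solution, and \<open>K'\<close> makes the equation for this
  derivative Lipschitz in \<phi>.\<close>

locale semilinear_evolution = skew_generator G
  for G :: "'a::{real_inner, banach, perfect_space} endo" +
  fixes N :: "'a \<Rightarrow> 'a" and N' :: "'a \<Rightarrow> 'a \<Rightarrow> 'a" and K K' :: real
  assumes N: "(N has_derivative N' x) (at x)"
    and N'_bound: "norm (N' x h) \<le> K * norm h"
    and N'_Lipschitz: "norm (N' x h - N' y h) \<le> K' * norm (x - y) * norm h"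
begin

text \<open>The solution and its derivative \<open>\<psi> = U \<omega>\<close> are found together, from an ordinary
  differential equation with a right-hand side that is Lipschitz continuous once the linear
  argument of \<^term>\<open>N'\<close> is confined to a ball that \<open>\<psi>\<close> cannot leave.\<close>

lemma classical_solution:
  assumes \<psi>0: "app G \<psi>0 = \<phi>0 + app G (N \<phi>0)"
  obtains \<phi> \<psi> where "\<phi> 0 = \<phi>0" "\<psi> 0 = \<psi>0"
    "\<And>t. 0 \<le> t \<Longrightarrow> (\<phi> has_vector_derivative \<psi> t) (at t within {0..})"
    "continuous_on {0..} \<psi>"
    "\<And>t. 0 \<le> t \<Longrightarrow> app G (\<psi> t) = \<phi> t + app G (N (\<phi> t))"
proof -
  have lin: "bounded_linear (N' x)" for x
    using N by (rule has_derivative_bounded_linear)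
  have N'_diff: "N' x (g - h) = N' x g - N' x h" for x g h
    using lin by (simp add: bounded_linear.linear linear_diff)
  define L where "L = max K 0"
  define L' where "L' = max K' 0"
  have L: "0 \<le> L" "0 \<le> L'" by (simp_all add: L_def L'_def)
  have N'_bd: "norm (N' x h) \<le> L * norm h" for x h
    using N'_bound[of x h] mult_right_mono[of K L "norm h"] by (simp add: L_def)
  have N'_lip: "norm (N' x h - N' y h) \<le> L' * norm (x - y) * norm h" for x y h
    using N'_Lipschitz[of x h y] mult_right_mono[of K' L' "norm (x - y) * norm h"]
    by (simp add: L'_def mult.assoc)
  \<comment> \<open>A radius above the a priori bound \<open>norm \<psi>0 * exp (L * t)\<close>; the
    summand 1 makes it positive also for \<psi>0 = 0.\<close>
  define \<rho> where "\<rho> t = (norm \<psi>0 + 1) * exp (L * t)" for t :: real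
  have \<rho>_pos: "0 < \<rho> t" for t by (simp add: \<rho>_def add_nonneg_pos)
  \<comment> \<open>Formally \<psi>' = G^-1 \<psi> + N' \<phi> \<psi>. Writing \<psi> = U \<omega>
    removes the unbounded term and leaves \<omega>' = U (- t) (N' \<phi> \<psi>), next to \<phi>' =
    \<psi>.\<close>
  define f where "f t = (\<lambda>(x, w). (U t w, U (- t) (N' x (clamp_ball (\<rho> t) (U t w)))))" for t
  have f_cont: "continuous_on {0..} (\<lambda>t. f t z)" for z
  proof -
    obtain x w where z: "z = (x, w)" by (cases z)
    have U1: "continuous_on {0..} (\<lambda>t. U t w)"
      using continuous_U continuous_on_subset by blast
    have "continuous_on {0..} (\<lambda>t. N' x (clamp_ball (\<rho> t) (U t w)))"
      by (rule bounded_linear.continuous_on[OF lin], rule continuous_clamp_ball[OF _ U1 \<rho>_pos])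
        (auto simp: \<rho>_def intro!: continuous_intros)
    then have "continuous_on {0..} (\<lambda>t. U (- t) (N' x (clamp_ball (\<rho> t) (U t w))))"
      unfolding continuous_on_def by (auto intro!: U_tendsto tendsto_minus)
    then show ?thesis unfolding f_def z by (simp add: U1 continuous_on_Pair)
  qed
  have f_lip: "\<exists>B. \<forall>t\<in>{0..T}. \<forall>y z. norm (f t y - f t z) \<le> B * norm (y - z)" for T :: real
  proof (intro exI ballI allI)
    fix t :: real and y z :: "'a \<times> 'a" assume t: "t \<in> {0..T}"
    obtain x w where y: "y = (x, w)" by (cases y) blast
    obtain x' w' where z: "z = (x', w')" by (cases z) blast
    let ?P = "\<lambda>w. clamp_ball (\<rho> t) (U t w)"
    have xw: "norm (x - x') \<le> norm (y - z)" "norm (w - w') \<le> norm (y - z)"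
      using norm_fst_le[of "x - x'" "w - w'"] norm_snd_le[of "w - w'" "x - x'"] by (simp_all add: y z)
    have \<rho>: "\<rho> t \<le> \<rho> T"
      using t L unfolding \<rho>_def by (intro mult_left_mono) (auto intro: mult_left_mono)
    have "norm (f t y - f t z)
        \<le> norm (U t w - U t w') + norm (U (- t) (N' x (?P w)) - U (- t) (N' x' (?P w')))"
      unfolding f_def y z by (simp add: norm_Pair_le)
    also have "\<dots> = norm (w - w') + norm (N' x (?P w) - N' x' (?P w'))"
      by (simp add: U_diff[symmetric] norm_U)
    also have "N' x (?P w) - N' x' (?P w')
        = N' x (?P w - ?P w') + (N' x (?P w') - N' x' (?P w'))"
      by (simp add: N'_diff)
    also have "norm \<dots> \<le> L * (2 * norm (w - w')) + L' * norm (x - x') * \<rho> T"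
    proof (rule norm_triangle_mono)
      have "norm (N' x (?P w - ?P w')) \<le> L * norm (?P w - ?P w')" by (rule N'_bd)
      also have "norm (?P w - ?P w') \<le> 2 * norm (w - w')"
        using clamp_ball_Lipschitz[OF \<rho>_pos, of t "U t w" "U t w'"]
        by (simp add: U_diff[symmetric] norm_U)
      finally show "norm (N' x (?P w - ?P w')) \<le> L * (2 * norm (w - w'))"
        using L by (simp add: mult_left_mono)
      have "norm (N' x (?P w') - N' x' (?P w')) \<le> L' * norm (x - x') * norm (?P w')"
        by (rule N'_lip)
      also have "\<dots> \<le> L' * norm (x - x') * \<rho> T"
        using norm_clamp_ball(1)[OF \<rho>_pos, of t "U t w'"] \<rho> L
        by (intro mult_left_mono) auto
      finally show "norm (N' x (?P w') - N' x' (?P w')) \<le> L' * norm (x - x') * \<rho> T" .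
    qed
    also have "norm (w - w') + (L * (2 * norm (w - w')) + L' * norm (x - x') * \<rho> T)
        \<le> norm (y - z) + (L * (2 * norm (y - z)) + L' * norm (y - z) * \<rho> T)"
      using L xw less_imp_le[OF \<rho>_pos] by (intro add_mono mult_mono) auto
    also have "\<dots> = (1 + 2 * L + L' * \<rho> T) * norm (y - z)" by (simp add: algebra_simps)
    finally show "norm (f t y - f t z) \<le> (1 + 2 * L + L' * \<rho> T) * norm (y - z)" by simp
  qed
  obtain y where y0: "y 0 = (\<phi>0, \<psi>0)"
    and y': "\<And>t. 0 \<le> t \<Longrightarrow> (y has_vector_derivative f t (y t)) (at t within {0..})"
    using global_Picard[of f "(\<phi>0, \<psi>0)"] f_cont f_lip by blast
  define \<phi> where "\<phi> t = fst (y t)" for t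
  define \<omega> where "\<omega> t = snd (y t)" for t
  define \<psi> where "\<psi> t = U t (\<omega> t)" for t
  have \<phi>': "(\<phi> has_vector_derivative \<psi> t) (at t within {0..})" if "0 \<le> t" for t
    using bounded_linear.has_vector_derivative[OF bounded_linear_fst y'[OF that]]
    by (simp add: \<phi>_def[abs_def] \<omega>_def \<psi>_def f_def split_beta)
  have \<omega>': "(\<omega> has_vector_derivative U (- t) (N' (\<phi> t) (clamp_ball (\<rho> t) (\<psi> t)))) (at t within {0..})"
    if "0 \<le> t" for t
    using bounded_linear.has_vector_derivative[OF bounded_linear_snd y'[OF that]]
    by (simp add: \<phi>_def \<omega>_def[abs_def] \<psi>_def f_def split_beta)
  \<comment> \<open>The retraction does not increase norms and \<open>U\<close> preserves them, so
    Gronwall's argument for \<omega> involves only the bound on \<open>N'\<close>. It follows that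
    the retraction never acts along the solution.\<close>
  have \<psi>_bound: "norm (\<psi> t) \<le> \<rho> t" if t: "0 \<le> t" for t
  proof -
    have "norm (\<omega> t) \<le> norm (\<omega> 0) * exp (L * t)"
    proof (rule norm_le_exp_if_inner_deriv_le[OF _ _ t])
      fix s assume s: "s \<in> {0..t}"
      show "(\<omega> has_vector_derivative U (- s) (N' (\<phi> s) (clamp_ball (\<rho> s) (\<psi> s)))) (at s within {0..t})"
        using has_vector_derivative_within_subset[OF \<omega>'] s by auto
      have "inner (U (- s) (N' (\<phi> s) (clamp_ball (\<rho> s) (\<psi> s)))) (\<omega> s)
          \<le> norm (N' (\<phi> s) (clamp_ball (\<rho> s) (\<psi> s))) * norm (\<omega> s)"
        using norm_cauchy_schwarz norm_U by metis
      also have "\<dots> \<le> (L * norm (clamp_ball (\<rho> s) (\<psi> s))) * norm (\<omega> s)"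
        by (intro mult_right_mono N'_bd) auto
      also have "\<dots> \<le> (L * norm (\<omega> s)) * norm (\<omega> s)"
        using norm_clamp_ball(2)[OF \<rho>_pos, of s "\<psi> s"] L
        by (intro mult_right_mono mult_left_mono) (auto simp: \<psi>_def norm_U)
      finally show "inner (U (- s) (N' (\<phi> s) (clamp_ball (\<rho> s) (\<psi> s)))) (\<omega> s) \<le> L * (norm (\<omega> s))\<^sup>2"
        by (simp add: power2_eq_square)
    qed
    then have "norm (\<psi> t) \<le> norm \<psi>0 * exp (L * t)" by (simp add: \<psi>_def norm_U \<omega>_def y0)
    also have "\<dots> \<le> \<rho> t" by (simp add: \<rho>_def)
    finally show ?thesis .
  qed
  have \<psi>_cont: "continuous_on {0..} \<psi>"
  proof -
    have "(\<omega> \<longlongrightarrow> \<omega> t) (at t within {0..})" if "0 \<le> t" for t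
      using has_vector_derivative_continuous[OF \<omega>'[OF that]] by (simp add: continuous_within)
    then show ?thesis unfolding \<psi>_def continuous_on_def by (auto intro!: U_tendsto)
  qed
  \<comment> \<open>Product rule for \<open>U s (app G (\<omega> s))\<close>. The group is
    differentiated only on vectors in the range of \<open>G\<close>, which is why \<psi> is treated
    after application of \<open>G\<close>.\<close>
  have G\<psi>': "((\<lambda>s. app G (\<psi> s)) has_vector_derivative \<psi> t + app G (N' (\<phi> t) (\<psi> t))) (at t within {0..})"
    if t: "0 \<le> t" for t
  proof -
    let ?q = "\<lambda>s. 1 / (s - t)"
    have "((\<lambda>s. U s (app G (?q s *\<^sub>R (\<omega> s - \<omega> t)))) \<longlongrightarrow>
        U t (app G (U (- t) (N' (\<phi> t) (clamp_ball (\<rho> t) (\<psi> t)))))) (at t within {0..})"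
      using \<omega>'[OF t] unfolding has_vector_derivative_iff_tendsto
      by (intro U_tendsto bounded_linear.tendsto[OF app_bounded_linear] tendsto_ident_at)
    moreover have "((\<lambda>s. ?q s *\<^sub>R (U s (app G (\<omega> t)) - U t (app G (\<omega> t)))) \<longlongrightarrow> U t (\<omega> t)) (at t within {0..})"
      using U_G_has_vector_derivative[of "\<omega> t" t "{0..}"] unfolding has_vector_derivative_iff_tendsto .
    ultimately have "((\<lambda>s. U s (app G (?q s *\<^sub>R (\<omega> s - \<omega> t))) +
        ?q s *\<^sub>R (U s (app G (\<omega> t)) - U t (app G (\<omega> t)))) \<longlongrightarrow>
        U t (app G (U (- t) (N' (\<phi> t) (clamp_ball (\<rho> t) (\<psi> t))))) + U t (\<omega> t)) (at t within {0..})"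
      by (rule tendsto_add)
    moreover have "U s (app G (?q s *\<^sub>R (\<omega> s - \<omega> t))) + ?q s *\<^sub>R (U s (app G (\<omega> t)) - U t (app G (\<omega> t)))
        = ?q s *\<^sub>R (app G (\<psi> s) - app G (\<psi> t))" for s
      by (simp add: app_scaleR app_diff U_scaleR U_diff \<psi>_def G_U algebra_simps)
    moreover have "U t (app G (U (- t) (N' (\<phi> t) (clamp_ball (\<rho> t) (\<psi> t))))) + U t (\<omega> t)
        = \<psi> t + app G (N' (\<phi> t) (\<psi> t))"
      by (simp add: G_U U_minus clamp_ball_eq[OF \<rho>_pos \<psi>_bound[OF t]]) (simp add: \<psi>_def)
    ultimately show ?thesis unfolding has_vector_derivative_iff_tendsto by simp
  qed
  show thesis
  proof
    show "\<phi> 0 = \<phi>0" "\<psi> 0 = \<psi>0" by (simp_all add: \<phi>_def \<psi>_def \<omega>_def y0 U_0)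
    show "continuous_on {0..} \<psi>" by (rule \<psi>_cont)
    show "(\<phi> has_vector_derivative \<psi> t) (at t within {0..})" if "0 \<le> t" for t
      using \<phi>'[OF that] .
    \<comment> \<open>The defect of the equation after application of \<open>G\<close>. Its
      derivative is 0 by \<open>G\<psi>'\<close> and the chain rule, and it is 0 initially by the
      choice of \<psi>0.\<close>
    define g where "g t = app G (\<psi> t) - (\<phi> t + app G (N (\<phi> t)))" for t
    have "(g has_vector_derivative 0) (at t within {0..})" if t: "t \<in> {0..}" for t
    proof -
      have t0: "0 \<le> t" using t by simp
      have "((\<lambda>s. N (\<phi> s)) has_vector_derivative N' (\<phi> t) (\<psi> t)) (at t within {0..})"
        using has_derivative_compose[OF \<phi>'[OF t0, unfolded has_vector_derivative_def] N]
        by (simp add: has_vector_derivative_def bounded_linear.linear[OF lin] linear_scale)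
      from bounded_linear.has_vector_derivative[OF app_bounded_linear[of G] this]
      have "((\<lambda>s. \<phi> s + app G (N (\<phi> s))) has_vector_derivative \<psi> t + app G (N' (\<phi> t) (\<psi> t))) (at t within {0..})"
        by (rule has_vector_derivative_add[OF \<phi>'[OF t0]])
      from has_vector_derivative_diff[OF G\<psi>'[OF t0] this] show ?thesis by (simp add: g_def[abs_def])
    qed
    then obtain d where d: "\<And>t. t \<in> {0..} \<Longrightarrow> g t = d"
      using has_vector_derivative_zero_constant[of "{0..}" g] by auto
    have "g 0 = 0" by (simp add: g_def \<phi>_def \<psi>_def \<omega>_def y0 U_0 \<psi>0)
    then show "app G (\<psi> t) = \<phi> t + app G (N (\<phi> t))" if "0 \<le> t" for t
      using d[of 0] d[of t] that by (simp add: g_def)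
  qed
qed

end

section \<open>Square integrable functions\<close>

text \<open>Operators on \<open>H\<close> and on \<open>H \<times> H\<close> are treated as elements
  of a normed algebra with unit, so neither type may have isolated points.\<close>

instance prod :: (perfect_space, perfect_space) perfect_space
proof
  fix x :: "'a \<times> 'b"
  show "\<not> open {x}"
  proof
    assume "open {x}"
    then obtain A B where AB: "open A" "open B" "x \<in> A \<times> B" "A \<times> B \<subseteq> {x}"
      by (elim open_prod_elim) auto
    then have "A = {fst x}" by (cases x) auto
    then show False using AB(1) not_open_singleton by metis
  qed
qed

lemma half_line_in_sets: "{0<..} \<inter> space lebesgue \<in> sets (lebesgue :: real measure)"
  by simp

lemma borel_measurable_half_line: "f \<in> borel_measurable borel \<Longrightarrow> f \<in> borel_measurable half_line"
  by (intro measurable_restrict_space1 measurable_completion) simp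

lemma square_integrable_rep: "square_integrable half_line (rep_l2 u)"
  using Quotient_rep_reflp[OF Quotient_l2, of u] by (simp add: l2_rel_def)

lemma measurable_rep [measurable]: "rep_l2 u \<in> borel_measurable half_line"
  using square_integrable_rep by (simp add: square_integrable_def)

lemma integrable_rep_square: "integrable half_line (\<lambda>x. (rep_l2 u x)\<^sup>2)"
  using square_integrable_rep by (simp add: square_integrable_def)

lemma integrable_rep_mult: "integrable half_line (\<lambda>x. rep_l2 u x * rep_l2 v x)"
  by (intro square_integrable_mult square_integrable_rep)

lemma abs_rep: "abs_l2 (rep_l2 u) = u"
  by (rule Quotient_abs_rep[OF Quotient_l2])

lemma abs_l2_eq_iff:
  assumes "square_integrable half_line f" "square_integrable half_line g"
  shows "abs_l2 f = abs_l2 g \<longleftrightarrow> (AE x in half_line. f x = g x)"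
  using Quotient_rel[OF Quotient_l2, of f g] assms by (auto simp: l2_rel_def)

lemma rep_abs: "square_integrable half_line f \<Longrightarrow> AE x in half_line. rep_l2 (abs_l2 f) x = f x"
  using Quotient_rep_abs[OF Quotient_l2, of f] by (auto simp: l2_rel_def)

lemma abs_l2_cong:
  assumes "square_integrable half_line f" "AE x in half_line. f x = g x" "g \<in> borel_measurable half_line"
  shows "square_integrable half_line g" "abs_l2 g = abs_l2 f"
proof -
  have "integrable half_line (\<lambda>x. (g x)\<^sup>2)"
    by (rule integrable_cong_AE_imp[of _ "\<lambda>x. (f x)\<^sup>2"])
      (use assms in \<open>auto simp: square_integrable_def\<close>)
  then show g: "square_integrable half_line g"
    using assms by (simp add: square_integrable_def)
  then show "abs_l2 g = abs_l2 f"
    using assms by (subst abs_l2_eq_iff) auto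
qed

lemma l2_eqI: "AE x in half_line. rep_l2 u x = rep_l2 v x \<Longrightarrow> u = v"
  using abs_l2_eq_iff[OF square_integrable_rep square_integrable_rep, of u v] by (simp add: abs_rep)

lemma rep_add: "AE x in half_line. rep_l2 (u + v) x = rep_l2 u x + rep_l2 v x"
proof -
  have "u + v = abs_l2 (\<lambda>x. rep_l2 u x + rep_l2 v x)"
    by (simp add: plus_l2_def)
  then show ?thesis
    using rep_abs[OF square_integrable_add[OF square_integrable_rep square_integrable_rep]] by simp
qed

lemma rep_scaleR: "AE x in half_line. rep_l2 (r *\<^sub>R u) x = r * rep_l2 u x"
proof -
  have "r *\<^sub>R u = abs_l2 (\<lambda>x. r * rep_l2 u x)"
    by (simp add: scaleR_l2_def)
  then show ?thesis
    using rep_abs[OF square_integrable_scale[OF square_integrable_rep]] by simp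
qed

lemma rep_diff: "AE x in half_line. rep_l2 (u - v) x = rep_l2 u x - rep_l2 v x"
  using rep_add[of u "- v"] rep_scaleR[of "-1" v] by eventually_elim simp

lemma rep_zero: "AE x in half_line. rep_l2 0 x = 0"
  using rep_scaleR[of 0 0] by simp

lemma inner_l2_rep: "inner u v = (\<integral>x. rep_l2 u x * rep_l2 v x \<partial>half_line)"
  by (simp add: inner_l2_def)

lemma norm_l2_rep: "(norm u)\<^sup>2 = (\<integral>x. (rep_l2 (u :: l2) x)\<^sup>2 \<partial>half_line)"
  unfolding power2_norm_eq_inner inner_l2_rep by (simp add: power2_eq_square)

lemma norm_abs_l2:
  assumes "square_integrable half_line f"
  shows "(norm (abs_l2 f))\<^sup>2 = (\<integral>x. (f x)\<^sup>2 \<partial>half_line)"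
  unfolding norm_l2_rep
  by (rule integral_cong_AE) (use assms rep_abs[OF assms] in \<open>auto simp: square_integrable_def\<close>)

lemma inner_abs_l2:
  assumes "square_integrable half_line f" "square_integrable half_line g"
  shows "inner (abs_l2 f) (abs_l2 g) = (\<integral>x. f x * g x \<partial>half_line)"
  unfolding inner_l2_rep
  by (rule integral_cong_AE)
    (use assms rep_abs[OF assms(1)] rep_abs[OF assms(2)] in \<open>auto simp: square_integrable_def\<close>)

lemma abs_l2_diff:
  assumes "square_integrable half_line f" "square_integrable half_line g"
  shows "abs_l2 f - abs_l2 g = abs_l2 (\<lambda>x. f x - g x)"
proof (rule l2_eqI)
  have "square_integrable half_line (\<lambda>x. f x - g x)"
    using square_integrable_add[OF assms(1) square_integrable_scale[OF assms(2), of "-1"]] by simp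
  from rep_abs[OF this] rep_abs[OF assms(1)] rep_abs[OF assms(2)] rep_diff[of "abs_l2 f" "abs_l2 g"]
  show "AE x in half_line. rep_l2 (abs_l2 f - abs_l2 g) x = rep_l2 (abs_l2 (\<lambda>x. f x - g x)) x"
    by eventually_elim simp
qed

lemma norm_abs_l2_mono:
  assumes "square_integrable half_line f" "g \<in> borel_measurable half_line"
    and le: "AE x in half_line. \<bar>g x\<bar> \<le> \<bar>f x\<bar>"
  shows "square_integrable half_line g" "norm (abs_l2 g) \<le> norm (abs_l2 f)"
proof -
  have sq: "AE x in half_line. (g x)\<^sup>2 \<le> (f x)\<^sup>2"
    using le by eventually_elim (simp add: abs_le_square_iff)
  have "integrable half_line (\<lambda>x. (g x)\<^sup>2)"
    by (rule Bochner_Integration.integrable_bound[of _ "\<lambda>x. (f x)\<^sup>2"])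
      (use assms sq in \<open>auto simp: square_integrable_def\<close>)
  then show g: "square_integrable half_line g"
    using assms by (simp add: square_integrable_def)
  have "(norm (abs_l2 g))\<^sup>2 \<le> (norm (abs_l2 f))\<^sup>2"
    unfolding norm_abs_l2[OF g] norm_abs_l2[OF assms(1)]
    by (rule integral_mono_AE) (use assms g sq in \<open>auto simp: square_integrable_def\<close>)
  then show "norm (abs_l2 g) \<le> norm (abs_l2 f)"
    by (rule power2_le_imp_le) simp
qed

text \<open>Cauchy-Schwarz for the classes of the absolute values, which have the same
  norms.\<close>

lemma integral_abs_mult_le_norm:
  "(\<integral>x. \<bar>rep_l2 u x * rep_l2 v x\<bar> \<partial>half_line) \<le> norm u * norm v"
proof -
  have sq: "square_integrable half_line (\<lambda>x. \<bar>rep_l2 w x\<bar>)" for w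
    using integrable_rep_square[of w] by (simp add: square_integrable_def)
  have n: "norm (abs_l2 (\<lambda>x. \<bar>rep_l2 w x\<bar>)) = norm w" for w
  proof -
    have "(norm (abs_l2 (\<lambda>x. \<bar>rep_l2 w x\<bar>)))\<^sup>2 = (norm w)\<^sup>2"
      by (simp add: norm_abs_l2[OF sq]) (simp add: norm_l2_rep)
    then show ?thesis by simp
  qed
  have "(\<integral>x. \<bar>rep_l2 u x * rep_l2 v x\<bar> \<partial>half_line)
      = inner (abs_l2 (\<lambda>x. \<bar>rep_l2 u x\<bar>)) (abs_l2 (\<lambda>x. \<bar>rep_l2 v x\<bar>))"
    by (simp add: inner_abs_l2[OF sq sq] abs_mult)
  also have "\<dots> \<le> norm u * norm v"
    using norm_cauchy_schwarz[of "abs_l2 (\<lambda>x. \<bar>rep_l2 u x\<bar>)" "abs_l2 (\<lambda>x. \<bar>rep_l2 v x\<bar>)"]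
    by (simp add: n)
  finally show ?thesis .
qed

lemma square_integrable_exp: "square_integrable half_line (\<lambda>x. exp (- x))"
proof -
  have "(\<lambda>x::real. exp (- 2 * x)) integrable_on {0..}"
    using integrable_on_exp_minus_to_infinity[of 2 0] by simp
  then have "(\<lambda>x::real. exp (- 2 * x)) absolutely_integrable_on {0..}"
    by (intro nonnegative_absolutely_integrable_1) auto
  then have "(\<lambda>x::real. exp (- 2 * x)) absolutely_integrable_on {0<..}"
    by (rule set_integrable_subset) auto
  then have "integrable half_line (\<lambda>x. exp (- 2 * x))"
    by (subst (asm) integrable_restrict_space[symmetric, OF half_line_in_sets, unfolded set_integrable_def[symmetric]])
      (simp add: set_integrable_def)
  moreover have "(\<lambda>x. (exp (- x))\<^sup>2) = (\<lambda>x::real. exp (- 2 * x))"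
    by (simp add: exp_double[symmetric])
  ultimately show ?thesis
    unfolding square_integrable_def by (simp add: borel_measurable_half_line)
qed

text \<open>A strictly positive element with three uses: as a weight that turns L2 convergence into
  L1 convergence, as a non-zero vector, and as an \<open>H1\<close> function with boundary value
  1.\<close>

definition exp_l2 :: l2 where "exp_l2 = abs_l2 (\<lambda>x. exp (- x))"

lemma rep_exp_l2: "AE x in half_line. rep_l2 exp_l2 x = exp (- x)"
  unfolding exp_l2_def by (rule rep_abs[OF square_integrable_exp])

lemma AE_half_line_False: "\<not> (AE x in half_line. False)"
proof
  assume "AE x in half_line. False"
  then have "AE x in lebesgue. x \<notin> {0::real<..}"
    by (subst (asm) AE_restrict_space_iff[OF half_line_in_sets]) simp
  then have "emeasure lebesgue {0::real<..} = 0"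
    by (subst (asm) AE_iff_measurable[of "{0<..}"]) auto
  moreover have "emeasure lebesgue {0::real<..<1} \<le> emeasure lebesgue {0::real<..}"
    by (rule emeasure_mono) auto
  ultimately show False by simp
qed

lemma exp_l2_nonzero: "exp_l2 \<noteq> 0"
proof
  assume "exp_l2 = 0"
  then have "AE x in half_line. rep_l2 0 x = exp (- x)"
    using rep_exp_l2 by simp
  then have "AE x in half_line. False"
    using rep_zero by eventually_elim (metis exp_not_eq_zero)
  then show False using AE_half_line_False by blast
qed

instance l2 :: perfect_space
proof
  fix x :: l2
  show "\<not> open {x}"
  proof
    assume "open {x}"
    then obtain e where e: "e > 0" "ball x e \<subseteq> {x}"
      using openE by blast
    define y where "y = x + (e / (2 * norm exp_l2)) *\<^sub>R exp_l2"
    have "dist x y < e" using e exp_l2_nonzero by (simp add: y_def dist_norm)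
    then have "y = x" using e by auto
    then show False using e exp_l2_nonzero by (simp add: y_def)
  qed
qed

text \<open>After multiplication by the square integrable weight exp (- x) the sequence is Cauchy in
  L1, so a subsequence converges almost everywhere; then the weight is divided out.\<close>

lemma l2_Cauchy_AE_limit:
  fixes u :: "nat \<Rightarrow> l2"
  assumes "Cauchy u"
  obtains r f where "strict_mono r" "f \<in> borel_measurable half_line"
    "AE x in half_line. (\<lambda>i. rep_l2 (u (r i)) x) \<longlonglongrightarrow> f x"
proof -
  define s where "s n x = rep_l2 (u n) x * rep_l2 exp_l2 x" for n x
  have int: "integrable half_line (s n)" for n
    unfolding s_def by (rule integrable_rep_mult)
  have small: "\<exists>N. \<forall>i\<ge>N. \<forall>j\<ge>N. (\<integral>x. norm (s i x - s j x) \<partial>half_line) < e" if "e > 0" for e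
  proof -
    have "e / norm exp_l2 > 0" using that exp_l2_nonzero by simp
    then obtain N where N: "\<And>i j. i \<ge> N \<Longrightarrow> j \<ge> N \<Longrightarrow> norm (u i - u j) < e / norm exp_l2"
      using assms unfolding Cauchy_def dist_norm by meson
    have "(\<integral>x. norm (s i x - s j x) \<partial>half_line) < e" if "i \<ge> N" "j \<ge> N" for i j
    proof -
      have "(\<integral>x. norm (s i x - s j x) \<partial>half_line)
          = (\<integral>x. \<bar>rep_l2 (u i - u j) x * rep_l2 exp_l2 x\<bar> \<partial>half_line)"
      proof (rule integral_cong_AE)
        show "AE x in half_line. norm (s i x - s j x) = \<bar>rep_l2 (u i - u j) x * rep_l2 exp_l2 x\<bar>"
          using rep_diff[of "u i" "u j"] by eventually_elim (simp add: s_def left_diff_distrib)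
      qed (auto simp: s_def)
      also have "\<dots> \<le> norm (u i - u j) * norm exp_l2" by (rule integral_abs_mult_le_norm)
      also have "\<dots> < e"
        using N[OF that] exp_l2_nonzero by (simp add: pos_less_divide_eq)
      finally show ?thesis .
    qed
    then show ?thesis by blast
  qed
  obtain r where r: "strict_mono r" "AE x in half_line. Cauchy (\<lambda>i. s (r i) x)"
    using cauchy_L1_AE_cauchy_subseq[of half_line s, OF int small] by blast
  define f where "f x = lim (\<lambda>i. rep_l2 (u (r i)) x)" for x
  show thesis
  proof
    show "strict_mono r" by (rule r(1))
    show "f \<in> borel_measurable half_line"
      unfolding f_def by (rule borel_measurable_lim_metric) simp
    show "AE x in half_line. (\<lambda>i. rep_l2 (u (r i)) x) \<longlonglongrightarrow> f x"
      using r(2) rep_exp_l2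
    proof eventually_elim
      case (elim x)
      obtain l where "(\<lambda>i. s (r i) x) \<longlonglongrightarrow> l"
        using elim(1) Cauchy_convergent convergent_def by blast
      then have "(\<lambda>i. s (r i) x * exp x) \<longlonglongrightarrow> l * exp x" by (intro tendsto_intros)
      moreover have "s (r i) x * exp x = rep_l2 (u (r i)) x" for i
        by (simp add: s_def elim(2) exp_minus)
      ultimately have "(\<lambda>i. rep_l2 (u (r i)) x) \<longlonglongrightarrow> l * exp x" by simp
      then show ?case unfolding f_def by (simp add: limI)
    qed
  qed
qed

text \<open>The pointwise limit is also the limit in norm by Fatou's lemma: its squared distance to
  \<open>u n\<close> is at most the lower limit of the squared distances of \<open>u (r i)\<close>
  to \<open>u n\<close>.\<close>

instance l2 :: banach
proof
  fix u :: "nat \<Rightarrow> l2" assume u: "Cauchy u"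
  then obtain r f where r: "strict_mono r" and [measurable]: "f \<in> borel_measurable half_line"
    and lim: "AE x in half_line. (\<lambda>i. rep_l2 (u (r i)) x) \<longlonglongrightarrow> f x"
    by (rule l2_Cauchy_AE_limit)
  have *: "(\<integral>\<^sup>+x. ennreal ((f x - rep_l2 (u n) x)\<^sup>2) \<partial>half_line) \<le> ennreal (e\<^sup>2)"
    if e: "e > 0" and N: "\<And>i j. i \<ge> N \<Longrightarrow> j \<ge> N \<Longrightarrow> norm (u i - u j) < e" and n: "n \<ge> N" for n N e
  proof -
    have "(\<integral>\<^sup>+x. ennreal ((f x - rep_l2 (u n) x)\<^sup>2) \<partial>half_line)
        = (\<integral>\<^sup>+x. liminf (\<lambda>i. ennreal ((rep_l2 (u (r i)) x - rep_l2 (u n) x)\<^sup>2)) \<partial>half_line)"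
      using lim
      by (intro nn_integral_cong_AE, eventually_elim)
        (intro lim_imp_Liminf[symmetric] tendsto_intros tendsto_ennrealI, auto)
    also have "\<dots> \<le> liminf (\<lambda>i. \<integral>\<^sup>+x. ennreal ((rep_l2 (u (r i)) x - rep_l2 (u n) x)\<^sup>2) \<partial>half_line)"
      by (rule nn_integral_liminf) simp
    also have "(\<lambda>i. \<integral>\<^sup>+x. ennreal ((rep_l2 (u (r i)) x - rep_l2 (u n) x)\<^sup>2) \<partial>half_line)
        = (\<lambda>i. ennreal ((norm (u (r i) - u n))\<^sup>2))"
    proof
      fix i
      have "(\<integral>\<^sup>+x. ennreal ((rep_l2 (u (r i)) x - rep_l2 (u n) x)\<^sup>2) \<partial>half_line)
          = (\<integral>\<^sup>+x. ennreal ((rep_l2 (u (r i) - u n) x)\<^sup>2) \<partial>half_line)"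
        using rep_diff[of "u (r i)" "u n"] by (intro nn_integral_cong_AE, eventually_elim) simp
      also have "\<dots> = ennreal ((norm (u (r i) - u n))\<^sup>2)"
        unfolding norm_l2_rep by (intro nn_integral_eq_integral integrable_rep_square) simp
      finally show "(\<integral>\<^sup>+x. ennreal ((rep_l2 (u (r i)) x - rep_l2 (u n) x)\<^sup>2) \<partial>half_line)
          = ennreal ((norm (u (r i) - u n))\<^sup>2)" .
    qed
    also have "liminf (\<lambda>i. ennreal ((norm (u (r i) - u n))\<^sup>2)) \<le> ennreal (e\<^sup>2)"
    proof (rule Liminf_le)
      have "\<forall>\<^sub>F i in sequentially. N \<le> r i"
        using filterlim_subseq[OF r] by (simp add: filterlim_at_top)
      then show "\<forall>\<^sub>F i in sequentially. ennreal ((norm (u (r i) - u n))\<^sup>2) \<le> ennreal (e\<^sup>2)"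
        by eventually_elim (use N n e in \<open>auto intro!: ennreal_leI power_mono less_imp_le\<close>)
    qed simp
    finally show ?thesis .
  qed
  have sq_diff: "square_integrable half_line (\<lambda>x. f x - rep_l2 (u n) x)"
    if "e > 0" "\<And>i j. i \<ge> N \<Longrightarrow> j \<ge> N \<Longrightarrow> norm (u i - u j) < e" "n \<ge> N" for n N e
    unfolding square_integrable_def
    using order_le_less_trans[OF *[OF that] ennreal_less_top] by (auto intro!: integrableI_nonneg)
  obtain N1 where N1: "\<And>i j. i \<ge> N1 \<Longrightarrow> j \<ge> N1 \<Longrightarrow> norm (u i - u j) < 1"
    using u unfolding Cauchy_def dist_norm by (metis zero_less_one)
  have "square_integrable half_line (\<lambda>x. f x - rep_l2 (u N1) x)"
    by (rule sq_diff[OF zero_less_one N1 order_refl])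
  from square_integrable_add[OF this square_integrable_rep[of "u N1"]]
  have f: "square_integrable half_line f" by simp
  have "u \<longlonglongrightarrow> abs_l2 f"
  proof (rule LIMSEQ_I)
    fix e :: real assume "e > 0"
    then have e2: "e / 2 > 0" by simp
    then obtain N where N: "\<And>i j. i \<ge> N \<Longrightarrow> j \<ge> N \<Longrightarrow> norm (u i - u j) < e / 2"
      using u unfolding Cauchy_def dist_norm by meson
    have "norm (u n - abs_l2 f) < e" if n: "n \<ge> N" for n
    proof -
      note sq = sq_diff[OF e2 N n]
      have "abs_l2 f - u n = abs_l2 (\<lambda>x. f x - rep_l2 (u n) x)"
        using abs_l2_diff[OF f square_integrable_rep, of "u n"] by (simp add: abs_rep)
      then have "(norm (u n - abs_l2 f))\<^sup>2 = (\<integral>x. (f x - rep_l2 (u n) x)\<^sup>2 \<partial>half_line)"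
        by (simp add: norm_minus_commute norm_abs_l2[OF sq])
      also have "ennreal \<dots> = (\<integral>\<^sup>+x. ennreal ((f x - rep_l2 (u n) x)\<^sup>2) \<partial>half_line)"
        by (rule nn_integral_eq_integral[symmetric]) (use sq in \<open>auto simp: square_integrable_def\<close>)
      also have "\<dots> \<le> ennreal ((e / 2)\<^sup>2)" by (rule *[OF e2 N n])
      finally have "(norm (u n - abs_l2 f))\<^sup>2 \<le> (e / 2)\<^sup>2" by simp
      then have "norm (u n - abs_l2 f) \<le> e / 2"
        by (rule power2_le_imp_le) (use e2 in simp)
      then show ?thesis using e2 by simp
    qed
    then show "\<exists>N. \<forall>n\<ge>N. norm (u n - abs_l2 f) < e" by blast
  qed
  then show "convergent u" by (auto simp: convergent_def)
qed

section \<open>Test functions\<close>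

lemma poly_times_exp_tendsto_0: "((\<lambda>y::real. poly p y * exp (- y)) \<longlongrightarrow> 0) at_top"
proof -
  have "((\<lambda>y. \<Sum>i\<le>degree p. coeff p i * (y ^ i / exp y)) \<longlongrightarrow> (\<Sum>i\<le>degree p. coeff p i * 0)) at_top"
    by (intro tendsto_intros tendsto_power_div_exp_0)
  then show ?thesis
    by (simp add: poly_altdef sum_distrib_right exp_minus divide_inverse mult.assoc)
qed

text \<open>The family is closed under derivatives, with \<open>p\<close> a polynomial in 1 / x; so
  each member is smooth although it is glued to 0 at the origin.\<close>

definition flat :: "real poly \<Rightarrow> real \<Rightarrow> real" where
  "flat p x = (if 0 < x then poly p (1 / x) * exp (- (1 / x)) else 0)"

text \<open>With y = 1 / x and dy/dx = - y^2, the derivative of p(y) exp (- y) is y^2 (p(y) - p'(y))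
  exp (- y); the factor \<open>[:0, 0, 1:]\<close> is y^2.\<close>

lemma flat_has_derivative:
  "(flat p has_real_derivative flat ([:0, 0, 1:] * (p - pderiv p)) x) (at x)"
proof -
  consider "x > 0" | "x < 0" | "x = 0" by linarith
  then show ?thesis
  proof cases
    case 1
    have "((\<lambda>x. poly p (1 / x) * exp (- (1 / x))) has_real_derivative
        flat ([:0, 0, 1:] * (p - pderiv p)) x) (at x)"
      using 1 by (auto intro!: derivative_eq_intros DERIV_chain2[OF poly_DERIV]
          simp: flat_def power2_eq_square field_simps)
    then show ?thesis
      by (rule has_field_derivative_transform_within_open[of _ _ _ "{0<..}"])
        (use 1 in \<open>auto simp: flat_def\<close>)
  next
    case 2
    have "((\<lambda>x. 0) has_real_derivative 0) (at x)" by simp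
    then have "(flat p has_real_derivative 0) (at x)"
      by (rule has_field_derivative_transform_within_open[of _ _ _ "{..<0}"])
        (use 2 in \<open>auto simp: flat_def\<close>)
    then show ?thesis using 2 by (simp add: flat_def)
  next
    case 3
    \<comment> \<open>The difference quotient at 0 is of the same type: \<open>[:0, 1:]\<close>
      accounts for the division by h, and 1 / h tends to infinity.\<close>
    have "((\<lambda>h. poly ([:0, 1:] * p) (inverse h) * exp (- inverse h)) \<longlongrightarrow> 0) (at_right 0)"
      using filterlim_compose[OF poly_times_exp_tendsto_0 filterlim_inverse_at_top_right] .
    then have "((\<lambda>h. flat p h / h) \<longlongrightarrow> 0) (at_right 0)"
      by (rule Lim_transform_eventually)
        (auto simp: eventually_at_filter flat_def divide_inverse)
    moreover have "((\<lambda>h. flat p h / h) \<longlongrightarrow> 0) (at_left 0)"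
      by (rule Lim_transform_eventually[OF tendsto_const]) (auto simp: eventually_at_filter flat_def)
    ultimately have "((\<lambda>h. flat p h / h) \<longlongrightarrow> 0) (at 0)"
      by (simp add: filterlim_split_at)
    then show ?thesis using 3 by (simp add: DERIV_def flat_def)
  qed
qed

lemma flat_one_bounds: "0 \<le> flat 1 x" "flat 1 x \<le> 1"
  by (simp_all add: flat_def)

text \<open>An algebra of functions that is closed under derivatives, hence consists of smooth functions.\<close>

inductive flat_alg :: "(real \<Rightarrow> real) \<Rightarrow> bool" where
  flat: "flat_alg (\<lambda>x. flat p (a * x + b))"
| add: "flat_alg f \<Longrightarrow> flat_alg g \<Longrightarrow> flat_alg (\<lambda>x. f x + g x)"
| mult: "flat_alg f \<Longrightarrow> flat_alg g \<Longrightarrow> flat_alg (\<lambda>x. f x * g x)"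

lemma flat_alg_derivative:
  assumes "flat_alg f"
  obtains f' where "flat_alg f'" "\<And>x. (f has_real_derivative f' x) (at x)"
  using assms
proof (induction arbitrary: thesis)
  case (flat p a b)
  let ?q = "[:0, 0, 1:] * (p - pderiv p)"
  show ?case
  proof (rule flat)
    show "flat_alg (\<lambda>x. flat (smult a ?q) (a * x + b))" by (rule flat_alg.flat)
    have "((\<lambda>x. flat p (a * x + b)) has_real_derivative flat ?q (a * x + b) * a) (at x)" for x
      by (rule DERIV_chain2[OF flat_has_derivative]) (auto intro!: derivative_eq_intros)
    moreover have "flat ?q (a * x + b) * a = flat (smult a ?q) (a * x + b)" for x
      by (simp add: flat_def)
    ultimately show "((\<lambda>x. flat p (a * x + b)) has_real_derivative flat (smult a ?q) (a * x + b)) (at x)" for x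
      by simp
  qed
next
  case (add f g)
  obtain f' where f': "flat_alg f'" "\<And>x. (f has_real_derivative f' x) (at x)" using add.IH(1) by blast
  obtain g' where g': "flat_alg g'" "\<And>x. (g has_real_derivative g' x) (at x)" using add.IH(2) by blast
  show ?case
    by (rule add.prems[OF flat_alg.add[OF f'(1) g'(1)]]) (intro derivative_intros f' g')
next
  case (mult f g)
  obtain f' where f': "flat_alg f'" "\<And>x. (f has_real_derivative f' x) (at x)" using mult.IH(1) by blast
  obtain g' where g': "flat_alg g'" "\<And>x. (g has_real_derivative g' x) (at x)" using mult.IH(2) by blast
  show ?case
    by (rule mult.prems[OF flat_alg.add[OF flat_alg.mult[OF f'(1) mult.hyps(2)] flat_alg.mult[OF g'(1) mult.hyps(1)]]])
      (intro DERIV_mult f' g')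
qed

text \<open>Stated for a set closed under derivatives, so that it serves \<open>flat_alg\<close>
  itself and also \<open>flat_alg\<close> with one antiderivative inserted.\<close>

lemma iterated_deriv_differentiable:
  assumes step: "\<And>f. f \<in> S \<Longrightarrow> \<exists>f'\<in>S. \<forall>x. (f has_field_derivative f' x) (at x)" and "f \<in> S"
  shows "(deriv ^^ k) f field_differentiable at x"
proof -
  have deriv: "deriv f \<in> S" if f: "f \<in> S" for f
  proof -
    obtain f' where f': "f' \<in> S" "\<And>x. (f has_field_derivative f' x) (at x)" using step[OF f] by blast
    then have "deriv f = f'" by (intro ext DERIV_imp_deriv)
    then show ?thesis using f' by simp
  qed
  have "(deriv ^^ k) f \<in> S"
    by (induction k) (simp_all add: deriv \<open>f \<in> S\<close>)
  then show ?thesis using step unfolding field_differentiable_def by blast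
qed

lemma flat_alg_test_function:
  assumes "flat_alg \<phi>" "0 < a" "\<And>x. x \<notin> {a..b} \<Longrightarrow> \<phi> x = 0"
  shows "test_function \<phi>"
  unfolding test_function_def
proof
  show "\<forall>k x. (deriv ^^ k) \<phi> field_differentiable at x"
    using iterated_deriv_differentiable[of "Collect flat_alg" \<phi>] assms(1)
    by (metis flat_alg_derivative mem_Collect_eq)
  show "\<exists>K. compact K \<and> K \<subseteq> {0<..} \<and> (\<forall>x. x \<notin> K \<longrightarrow> \<phi> x = 0)"
    using assms(2,3) by (intro exI[of _ "{a..b}"]) auto
qed

lemma flat_alg_continuous: "flat_alg f \<Longrightarrow> continuous_on S f"
  by (meson DERIV_continuous_on flat_alg_derivative has_field_derivative_at_within)

text \<open>Smooth approximations of the indicator of the open interval from a to b, exact outside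
  of it. The arguments are written as slope times x plus constant to match
  \<open>flat_alg.flat\<close>.\<close>

definition bump :: "real \<Rightarrow> real \<Rightarrow> nat \<Rightarrow> real \<Rightarrow> real" where
  "bump a b n x = flat 1 (real n * x + (- real n * a)) * flat 1 (- real n * x + real n * b)"

lemma flat_alg_bump: "flat_alg (bump a b n)"
  unfolding bump_def[abs_def] by (intro flat_alg.mult flat_alg.flat)

lemma bump_bounds: "0 \<le> bump a b n x" "bump a b n x \<le> 1"
  using flat_one_bounds by (auto simp: bump_def intro: mult_le_one)

lemma bump_outside: "x \<notin> {a<..<b} \<Longrightarrow> bump a b n x = 0"
proof -
  have e: "real n * x + (- real n * a) = real n * (x - a)" "- real n * x + real n * b = real n * (b - x)"
    by (simp_all add: algebra_simps)
  assume "x \<notin> {a<..<b}"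
  then have "real n * (x - a) \<le> 0 \<or> real n * (b - x) \<le> 0"
    by (auto simp: mult_le_0_iff)
  then show ?thesis unfolding bump_def e by (auto simp: flat_def)
qed

lemma bump_inside:
  assumes "a < x" "x < b" "0 < n"
  shows "bump a b n x = exp (- (1 / (real n * (x - a)))) * exp (- (1 / (real n * (b - x))))"
proof -
  have e: "real n * x + (- real n * a) = real n * (x - a)" "- real n * x + real n * b = real n * (b - x)"
    by (simp_all add: algebra_simps)
  show ?thesis unfolding bump_def e using assms by (simp add: flat_def)
qed

lemma bump_tendsto: "(\<lambda>n. bump a b n x) \<longlonglongrightarrow> indicator {a<..<b} x"
proof (cases "x \<in> {a<..<b}")
  case True
  have "(\<lambda>n. exp (- (1 / (x - a) * (1 / real n))) * exp (- (1 / (b - x) * (1 / real n))))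
      \<longlonglongrightarrow> exp (- (1 / (x - a) * 0)) * exp (- (1 / (b - x) * 0))"
    by (intro tendsto_intros lim_1_over_n)
  moreover have "\<forall>\<^sub>F n in sequentially. exp (- (1 / (x - a) * (1 / real n))) * exp (- (1 / (b - x) * (1 / real n)))
      = bump a b n x"
    using eventually_gt_at_top[of 0]
    by eventually_elim (use True in \<open>simp add: bump_inside mult.commute\<close>)
  ultimately show ?thesis
    using True Lim_transform_eventually by fastforce
qed (simp add: bump_outside)

text \<open>Open intervals are an intersection-stable generator of the Borel sets, so the integral
  over every Borel set is 0, and a density with this property vanishes almost everywhere.\<close>

lemma AE_lborel_zero_if_interval_integrals_zero:
  fixes k :: "real \<Rightarrow> real"
  assumes k: "integrable lborel k"
    and int: "\<And>a b. (\<integral>x. indicator {a<..<b} x * k x \<partial>lborel) = 0"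
  shows "AE x in lborel. k x = 0"
proof -
  have set_int: "set_integrable lborel A k" if "A \<in> sets lborel" for A
    using integrable_mult_indicator[OF that k] by (simp add: set_integrable_def)
  \<comment> \<open>The integral over the whole line, as a limit over growing intervals; the
    complement case of the induction rests on it.\<close>
  have total: "(\<integral>x. k x \<partial>lborel) = 0"
  proof -
    have "(\<lambda>n. \<integral>x. indicator {- real n<..<real n} x * k x \<partial>lborel) \<longlonglongrightarrow> (\<integral>x. k x \<partial>lborel)"
    proof (rule integral_dominated_convergence[where w = "\<lambda>x. norm (k x)"])
      show "AE x in lborel. (\<lambda>n. indicator {- real n<..<real n} x * k x) \<longlonglongrightarrow> k x"
      proof (rule AE_I2)
        fix x :: real
        obtain N where N: "\<bar>x\<bar> < real N" using reals_Archimedean2 by blast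
        have "\<forall>\<^sub>F n in sequentially. k x = indicator {- real n<..<real n} x * k x"
          using eventually_ge_at_top[of N] by eventually_elim (use N in \<open>auto simp: indicator_def\<close>)
        then show "(\<lambda>n. indicator {- real n<..<real n} x * k x) \<longlonglongrightarrow> k x"
          by (rule Lim_transform_eventually[OF tendsto_const])
      qed
    qed (use k in \<open>auto simp: indicator_def\<close>)
    then show ?thesis by (simp add: int LIMSEQ_const_iff)
  qed
  have stable: "Int_stable (range (\<lambda>(a, b). {a<..<b::real}))"
    by (auto simp: Int_stable_def)
  have borel: "sets borel = sigma_sets UNIV (range (\<lambda>(a, b). {a<..<b::real}))"
    using arg_cong[OF borel_eq_box[where 'a = real], of sets] by (simp add: box_real)
  have pow: "range (\<lambda>(a, b). {a<..<b::real}) \<subseteq> Pow UNIV" by auto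
  have zero: "(LINT x:A|lborel. k x) = 0" if "A \<in> sigma_sets UNIV (range (\<lambda>(a, b). {a<..<b}))" for A
    using stable pow that
  proof (induction rule: sigma_sets_induct_disjoint)
    case (basic A)
    then show ?case using int by (auto simp: set_lebesgue_integral_def)
  next
    case empty
    then show ?case by (simp add: set_lebesgue_integral_def)
  next
    case (compl A)
    have A: "A \<in> sets lborel"
      using compl.hyps by (simp add: borel)
    have "(LINT x:UNIV - A|lborel. k x) = (\<integral>x. k x - indicator A x *\<^sub>R k x \<partial>lborel)"
      unfolding set_lebesgue_integral_def
      by (rule Bochner_Integration.integral_cong) (auto simp: indicator_def)
    also have "\<dots> = 0"
      using set_int[OF A] k compl.IH total
      by (simp add: set_integrable_def set_lebesgue_integral_def)
    finally show ?case .
  next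
    case (union A)
    have A: "A i \<in> sets lborel" for i
      using union.hyps by (auto simp: borel)
    have "(LINT x:(\<Union>i. A i)|lborel. k x) = (\<Sum>i. LINT x:A i|lborel. k x)"
      by (rule lebesgue_integral_countable_add)
        (use A union.hyps in \<open>auto simp: disjoint_family_on_def intro!: set_int\<close>)
    then show ?case using union.IH by simp
  qed
  show ?thesis
    by (rule sigma_finite_measure.density_zero[OF sigma_finite_lborel k]) (use zero in \<open>simp add: borel\<close>)
qed

section \<open>Weak derivatives on the half line\<close>

lemma integrable_half_line_iff:
  fixes f :: "real \<Rightarrow> real"
  assumes "f \<in> borel_measurable borel"
  shows "integrable half_line f \<longleftrightarrow> integrable lborel (\<lambda>x. indicator {0<..} x * f x)"
  using assms integrable_restrict_space[OF half_line_in_sets, of f]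
  by (simp add: integrable_completion)

lemma integral_half_line_lborel:
  fixes f :: "real \<Rightarrow> real"
  assumes "f \<in> borel_measurable borel"
  shows "(\<integral>x. f x \<partial>half_line) = (\<integral>x. indicator {0<..} x * f x \<partial>lborel)"
  using assms integral_restrict_space[OF half_line_in_sets, of f]
  by (simp add: integral_completion)

text \<open>Fubini's theorem is applied to \<open>lborel\<close>, whereas \<open>half_line\<close>
  carries Lebesgue measurable functions. The values 0 on the left allow indicators of half-infinite
  intervals to be used for integrals from 0.\<close>

lemma half_line_borel_version:
  fixes f :: "real \<Rightarrow> real"
  assumes "f \<in> borel_measurable half_line"
  obtains f' where "f' \<in> borel_measurable borel" "AE x in half_line. f' x = f x"
    "\<And>x. x \<le> 0 \<Longrightarrow> f' x = 0"
proof -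
  have "(\<lambda>x. if x \<in> {0<..} then f x else 0) \<in> borel_measurable lebesgue"
    by (rule borel_measurable_if_I[OF assms]) simp
  then obtain g where g: "g \<in> borel_measurable lborel"
    "AE x in lborel. (if x \<in> {0<..} then f x else 0) = g x"
    using completion_ex_borel_measurable_real by blast
  define f' where "f' x = indicator {0<..} x * g x" for x :: real
  show thesis
  proof
    show "f' \<in> borel_measurable borel" using g(1) by (simp add: f'_def[abs_def])
    show "f' x = 0" if "x \<le> 0" for x using that by (simp add: f'_def)
    have "AE x in lebesgue. x \<in> {0<..} \<longrightarrow> f' x = f x"
      using AE_completion[OF g(2)] by eventually_elim (auto simp: f'_def)
    then show "AE x in half_line. f' x = f x"
      by (subst AE_restrict_space_iff[OF half_line_in_sets]) auto
  qed
qed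

section \<open>Primitives and integration by parts\<close>

definition prim :: "(real \<Rightarrow> real) \<Rightarrow> real \<Rightarrow> real" where
  "prim f x = (\<integral>y. indicator {0<..<x} y * f y \<partial>half_line)"

lemma prim_cong_AE:
  assumes "AE x in half_line. f x = g x" "f \<in> borel_measurable half_line" "g \<in> borel_measurable half_line"
  shows "prim f x = prim g x"
  unfolding prim_def
proof (rule integral_cong_AE)
  have ind: "indicator {0<..<x} \<in> borel_measurable half_line"
    by (rule borel_measurable_half_line) simp
  show "(\<lambda>y. indicator {0<..<x} y * f y) \<in> borel_measurable half_line"
    by (rule borel_measurable_times[OF ind assms(2)])
  show "(\<lambda>y. indicator {0<..<x} y * g y) \<in> borel_measurable half_line"
    by (rule borel_measurable_times[OF ind assms(3)])
qed (use assms in auto)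

lemma prim_0 [simp]: "prim f 0 = 0"
  by (simp add: prim_def)

text \<open>The plane is split along the diagonal: where y < x, integrating over y produces
  \<open>G x\<close>; where x <= y, integrating over x produces \<open>F y\<close>.\<close>

lemma Fubini_half_square:
  fixes f g :: "real \<Rightarrow> real"
  assumes f: "integrable lborel f" and g: "integrable lborel g"
  defines "F \<equiv> \<lambda>x. \<integral>y. indicator {..<x} y * f y \<partial>lborel"
    and "G \<equiv> \<lambda>x. \<integral>y. indicator {..<x} y * g y \<partial>lborel"
  shows "(\<integral>x. f x * G x \<partial>lborel) + (\<integral>x. F x * g x \<partial>lborel) = (\<integral>x. f x \<partial>lborel) * (\<integral>x. g x \<partial>lborel)"
proof -
  have [measurable]: "f \<in> borel_measurable borel" "g \<in> borel_measurable borel"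
    using f g by auto
  have int: "integrable (lborel \<Otimes>\<^sub>M lborel) (\<lambda>(x, y). indicator A (x, y) * (f x * g y))"
    if A [measurable]: "A \<in> sets (borel \<Otimes>\<^sub>M borel)" for A :: "(real \<times> real) set"
  proof (rule Bochner_Integration.integrable_bound)
    show "integrable (lborel \<Otimes>\<^sub>M lborel) (\<lambda>(x, y). f x * g y)"
    proof (rule lborel_pair.Fubini_integrable)
      show "integrable lborel (\<lambda>x. \<integral>y. norm (case (x, y) of (x, y) \<Rightarrow> f x * g y) \<partial>lborel)"
        using f g by (simp add: abs_mult)
    qed (use f g in auto)
    show "AE p in lborel \<Otimes>\<^sub>M lborel. norm (case p of (x, y) \<Rightarrow> indicator A (x, y) * (f x * g y))
        \<le> norm (case p of (x, y) \<Rightarrow> f x * g y)"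
      by (auto simp: indicator_def)
    show "(\<lambda>(x, y). indicator A (x, y) * (f x * g y)) \<in> borel_measurable (lborel \<Otimes>\<^sub>M lborel)"
      by measurable
  qed
  have "{(x, y). y < x} = {p \<in> space (borel \<Otimes>\<^sub>M borel). snd p < (fst p :: real)}"
    "{(x, y). x \<le> y} = {p \<in> space (borel \<Otimes>\<^sub>M borel). fst p \<le> (snd p :: real)}"
    by (auto simp: space_pair_measure)
  then have A [measurable]: "{(x, y). y < x} \<in> sets (borel \<Otimes>\<^sub>M (borel :: real measure))"
    "{(x, y). x \<le> y} \<in> sets (borel \<Otimes>\<^sub>M (borel :: real measure))"
    by simp_all
  have "(\<integral>x. f x * G x \<partial>lborel) = (\<integral>x. \<integral>y. indicator {(x, y). y < x} (x, y) * (f x * g y) \<partial>lborel \<partial>lborel)"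
    unfolding G_def
    by (intro Bochner_Integration.integral_cong refl)
      (simp add: integral_mult_right_zero[symmetric] indicator_def mult_ac del: integral_mult_right_zero)
  moreover have "(\<integral>x. F x * g x \<partial>lborel) = (\<integral>x. \<integral>y. indicator {(x, y). x \<le> y} (x, y) * (f x * g y) \<partial>lborel \<partial>lborel)"
  proof -
    have "(\<integral>x. indicator {(x, y). x \<le> y} (x, y) * (f x * g y) \<partial>lborel) = F y * g y" for y
    proof -
      \<comment> \<open>\<open>F\<close> is defined with x < y; the single point x = y is a null
        set.\<close>
      have "(\<integral>x. indicator {(x, y). x \<le> y} (x, y) * (f x * g y) \<partial>lborel)
          = (\<integral>x. (indicator {..<y} x * f x) * g y \<partial>lborel)"
        using AE_lborel_singleton[of y] by (intro integral_cong_AE) (auto simp: indicator_def)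
      then show ?thesis by (simp add: F_def)
    qed
    then have "(\<integral>x. F x * g x \<partial>lborel)
        = (\<integral>y. \<integral>x. indicator {(x, y). x \<le> y} (x, y) * (f x * g y) \<partial>lborel \<partial>lborel)" by simp
    also have "\<dots> = (\<integral>x. \<integral>y. indicator {(x, y). x \<le> y} (x, y) * (f x * g y) \<partial>lborel \<partial>lborel)"
      by (rule lborel_pair.Fubini_integral[OF int[OF A(2)]])
    finally show ?thesis .
  qed
  ultimately have "(\<integral>x. f x * G x \<partial>lborel) + (\<integral>x. F x * g x \<partial>lborel)
      = (\<integral>p. (case p of (x, y) \<Rightarrow> indicator {(x, y). y < x} (x, y) * (f x * g y)) \<partial>(lborel \<Otimes>\<^sub>M lborel))
      + (\<integral>p. (case p of (x, y) \<Rightarrow> indicator {(x, y). x \<le> y} (x, y) * (f x * g y)) \<partial>(lborel \<Otimes>\<^sub>M lborel))"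
    by (simp only: lborel_pair.integral_fst[OF int[OF A(1)]] lborel_pair.integral_fst[OF int[OF A(2)]])
  also have "\<dots> = (\<integral>p. (case p of (x, y) \<Rightarrow> indicator UNIV (x, y) * (f x * g y)) \<partial>(lborel \<Otimes>\<^sub>M lborel))"
    by (subst Bochner_Integration.integral_add[symmetric, OF int[OF A(1)] int[OF A(2)]])
      (auto intro!: Bochner_Integration.integral_cong simp: indicator_def)
  also have "\<dots> = (\<integral>x. \<integral>y. indicator UNIV (x, y) * (f x * g y) \<partial>lborel \<partial>lborel)"
    using sets.top[of "borel \<Otimes>\<^sub>M (borel :: real measure)"]
    by (intro lborel_pair.integral_fst[OF int, symmetric]) (simp add: space_pair_measure)
  finally show ?thesis by simp
qed

text \<open>Integration by parts for primitives of merely integrable functions. It is an instance of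
  \<open>Fubini_half_square\<close>, so no differentiation of the primitives takes place.\<close>

lemma prim_mult:
  assumes f: "integrable half_line (\<lambda>x. indicator {0<..<b} x * f x)" "f \<in> borel_measurable half_line"
    and g: "integrable half_line (\<lambda>x. indicator {0<..<b} x * g x)" "g \<in> borel_measurable half_line"
  shows "(\<integral>x. indicator {0<..<b} x * (f x * prim g x) \<partial>half_line)
      + (\<integral>x. indicator {0<..<b} x * (prim f x * g x) \<partial>half_line) = prim f b * prim g b"
proof -
  \<comment> \<open>Replaces \<open>f\<close> by a Borel function on the line, cut at b for
    integrability; up to b its primitive is unchanged.\<close>
  have key: "\<exists>f'. f' \<in> borel_measurable borel \<and> (AE x in half_line. f' x = f x) \<and> (\<forall>x\<le>0. f' x = 0)
      \<and> integrable lborel (\<lambda>x. indicator {..<b} x * f' x)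
      \<and> (\<forall>x\<le>b. prim f x = (\<integral>y. indicator {..<x} y * (indicator {..<b} y * f' y) \<partial>lborel))"
    if f: "integrable half_line (\<lambda>x. indicator {0<..<b} x * f x)" "f \<in> borel_measurable half_line" for f
  proof -
    obtain f' where f': "f' \<in> borel_measurable borel" "AE x in half_line. f' x = f x"
      "\<And>x. x \<le> 0 \<Longrightarrow> f' x = 0"
      using half_line_borel_version[OF f(2)] by blast
    have ind: "indicator {0<..} x * (indicator {0<..<c} x * f' x) = indicator {..<c} x * f' x" for x c :: real
      using f'(3)[of x] by (auto simp: indicator_def not_less)
    have "integrable half_line (\<lambda>x. indicator {0<..<b} x * f' x)"
      by (rule integrable_cong_AE_imp[OF f(1)])
        (use f' in \<open>auto intro!: borel_measurable_half_line\<close>)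
    then have "integrable lborel (\<lambda>x. indicator {..<b} x * f' x)"
      using f'(1) by (simp add: integrable_half_line_iff ind)
    moreover have "prim f x = (\<integral>y. indicator {..<x} y * (indicator {..<b} y * f' y) \<partial>lborel)" if "x \<le> b" for x
    proof -
      have "prim f x = prim f' x"
        by (rule prim_cong_AE) (use f f' in \<open>auto intro: borel_measurable_half_line\<close>)
      also have "\<dots> = (\<integral>y. indicator {..<x} y * f' y \<partial>lborel)"
        using f'(1) by (simp add: prim_def integral_half_line_lborel ind)
      also have "\<dots> = (\<integral>y. indicator {..<x} y * (indicator {..<b} y * f' y) \<partial>lborel)"
        using that by (intro Bochner_Integration.integral_cong) (auto simp: indicator_def)
      finally show ?thesis .
    qed
    ultimately show ?thesis using f' by blast
  qed
  obtain f' where f': "f' \<in> borel_measurable borel" "AE x in half_line. f' x = f x" "\<forall>x\<le>0. f' x = 0"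
    "integrable lborel (\<lambda>x. indicator {..<b} x * f' x)"
    "\<forall>x\<le>b. prim f x = (\<integral>y. indicator {..<x} y * (indicator {..<b} y * f' y) \<partial>lborel)"
    using key[OF f] by blast
  obtain g' where g': "g' \<in> borel_measurable borel" "AE x in half_line. g' x = g x" "\<forall>x\<le>0. g' x = 0"
    "integrable lborel (\<lambda>x. indicator {..<b} x * g' x)"
    "\<forall>x\<le>b. prim g x = (\<integral>y. indicator {..<x} y * (indicator {..<b} y * g' y) \<partial>lborel)"
    using key[OF g] by blast
  let ?f = "\<lambda>x. indicator {..<b} x * f' x" and ?g = "\<lambda>x. indicator {..<b} x * g' x"
  let ?F = "\<lambda>x. \<integral>y. indicator {..<x} y * ?f y \<partial>lborel" and ?G = "\<lambda>x. \<integral>y. indicator {..<x} y * ?g y \<partial>lborel"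
  have meas: "?F \<in> borel_measurable borel" "?G \<in> borel_measurable borel"
  proof -
    have "(\<lambda>x. \<integral>y. indicator {..<x} y * h y \<partial>lborel) \<in> borel_measurable borel"
      if [measurable]: "h \<in> borel_measurable borel" for h :: "real \<Rightarrow> real"
    proof -
      have "(\<lambda>x. \<integral>y. (if y < x then h y else 0) \<partial>lborel) \<in> borel_measurable borel"
        by measurable
      moreover have "indicator {..<x} y * h y = (if y < x then h y else 0)" for x y
        by (simp add: indicator_def)
      ultimately show ?thesis by simp
    qed
    then show "?F \<in> borel_measurable borel" "?G \<in> borel_measurable borel" using f'(1) g'(1) by simp_all
  qed
  have "prim f b * prim g b = (\<integral>x. ?f x \<partial>lborel) * (\<integral>x. ?g x \<partial>lborel)"
    using f'(5) g'(5) by (simp add: mult.assoc[symmetric] indicator_inter_arith[symmetric])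
  also have "\<dots> = (\<integral>x. ?f x * ?G x \<partial>lborel) + (\<integral>x. ?F x * ?g x \<partial>lborel)"
    by (rule Fubini_half_square[symmetric, OF f'(4) g'(4)])
  also have "(\<integral>x. ?f x * ?G x \<partial>lborel) = (\<integral>x. indicator {0<..<b} x * (f' x * ?G x) \<partial>half_line)"
    using f'(1,3) meas
    by (subst integral_half_line_lborel)
      (auto intro!: Bochner_Integration.integral_cong simp: indicator_def not_less)
  also have "\<dots> = (\<integral>x. indicator {0<..<b} x * (f x * ?G x) \<partial>half_line)"
  proof (rule integral_cong_AE)
    show "(\<lambda>x. indicator {0<..<b} x * (f x * ?G x)) \<in> borel_measurable half_line"
      "(\<lambda>x. indicator {0<..<b} x * (f' x * ?G x)) \<in> borel_measurable half_line"
      by (intro borel_measurable_times f(2) borel_measurable_half_line[OF f'(1)]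
          borel_measurable_half_line[OF meas(2)] borel_measurable_half_line[OF borel_measurable_indicator]; simp)+
  qed (use f'(2) in auto)
  also have "\<dots> = (\<integral>x. indicator {0<..<b} x * (f x * prim g x) \<partial>half_line)"
    using g'(5) by (intro Bochner_Integration.integral_cong) (auto simp: indicator_def)
  also have "(\<integral>x. ?F x * ?g x \<partial>lborel) = (\<integral>x. indicator {0<..<b} x * (?F x * g' x) \<partial>half_line)"
    using g'(1,3) meas
    by (subst integral_half_line_lborel)
      (auto intro!: Bochner_Integration.integral_cong simp: indicator_def not_less)
  also have "\<dots> = (\<integral>x. indicator {0<..<b} x * (?F x * g x) \<partial>half_line)"
  proof (rule integral_cong_AE)
    show "(\<lambda>x. indicator {0<..<b} x * (?F x * g x)) \<in> borel_measurable half_line"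
      "(\<lambda>x. indicator {0<..<b} x * (?F x * g' x)) \<in> borel_measurable half_line"
      by (intro borel_measurable_times g(2) borel_measurable_half_line[OF g'(1)]
          borel_measurable_half_line[OF meas(1)] borel_measurable_half_line[OF borel_measurable_indicator]; simp)+
  qed (use g'(2) in auto)
  also have "\<dots> = (\<integral>x. indicator {0<..<b} x * (prim f x * g x) \<partial>half_line)"
    using f'(5) by (intro Bochner_Integration.integral_cong) (auto simp: indicator_def)
  finally show ?thesis by simp
qed

lemma borel_measurable_half_line_indicator [measurable]:
  "A \<in> sets borel \<Longrightarrow> (indicator A :: real \<Rightarrow> real) \<in> borel_measurable half_line"
  by (intro borel_measurable_half_line borel_measurable_indicator)

lemma continuous_imp_measurable_half_line:
  fixes f :: "real \<Rightarrow> real"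
  shows "continuous_on {0..} f \<Longrightarrow> f \<in> borel_measurable half_line"
  by (intro continuous_imp_measurable_on_sets_lebesgue) (auto elim: continuous_on_subset)

lemma AE_half_line_Ex:
  assumes "AE x in half_line. P x" "0 \<le> a" "a < b"
  shows "\<exists>x\<in>{a<..<b}. P x"
proof (rule ccontr)
  assume "\<not> ?thesis"
  then have "AE x in lebesgue. x \<notin> {a<..<b}"
    using assms(1) unfolding AE_restrict_space_iff[OF half_line_in_sets]
    by (elim AE_mp) (use assms(2) in auto)
  then have "emeasure lebesgue {a<..<b} = 0"
    by (subst (asm) AE_iff_measurable[of "{a<..<b}"]) auto
  then show False using assms(3) by simp
qed

lemma indicator_square_integrable:
  assumes "A \<in> sets borel" "A \<subseteq> {a..b}" "a \<le> b"
  shows "square_integrable half_line (indicator A)"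
    and "(norm (abs_l2 (indicator A)))\<^sup>2 \<le> b - a"
proof -
  have sq: "(\<lambda>x. (indicator A x)\<^sup>2) = (indicator A :: real \<Rightarrow> real)"
    by (auto simp: indicator_def)
  have meas: "A \<inter> {0<..} \<in> sets half_line"
    using assms(1) by (subst sets_restrict_space_iff) auto
  have em: "emeasure half_line (A \<inter> {0<..}) \<le> ennreal (b - a)"
  proof -
    have "emeasure half_line (A \<inter> {0<..}) = emeasure lebesgue (A \<inter> {0<..})"
      using assms(1) by (subst emeasure_restrict_space) auto
    also have "\<dots> \<le> emeasure lebesgue {a..b}"
      using assms by (intro emeasure_mono) auto
    finally show ?thesis using assms(3) by simp
  qed
  have ind: "integrable half_line (indicator (A \<inter> {0<..}) :: real \<Rightarrow> real)"
    by (rule integrable_real_indicator[OF meas]) (use em in \<open>auto simp: less_top[symmetric] top_unique\<close>)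
  then have "integrable half_line (indicator A :: real \<Rightarrow> real)"
    by (rule Bochner_Integration.integrable_cong[THEN iffD1, rotated 2])
      (auto simp: indicator_def)
  then show s: "square_integrable half_line (indicator A)"
    unfolding square_integrable_def sq using assms(1) by simp
  have "(norm (abs_l2 (indicator A)))\<^sup>2 = (\<integral>x. indicator (A \<inter> {0<..}) x \<partial>half_line)"
    unfolding norm_abs_l2[OF s] sq
    by (rule Bochner_Integration.integral_cong) (auto simp: indicator_def)
  also have "\<dots> = measure half_line (A \<inter> {0<..})" using meas by simp
  also have "\<dots> \<le> b - a"
    using em assms(3) unfolding measure_def by (intro enn2real_leI) auto
  finally show "(norm (abs_l2 (indicator A)))\<^sup>2 \<le> b - a" .
qed

lemma square_integrable_interval: "square_integrable half_line (indicator {0<..<b})"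
proof (cases "0 \<le> b")
  case True
  then show ?thesis by (intro indicator_square_integrable(1)[of _ 0 b]) auto
next
  case False
  then have "indicator {0<..<b} = (\<lambda>x::real. 0::real)" by (auto simp: indicator_def)
  then show ?thesis by (simp add: square_integrable_zero)
qed

lemma integrable_interval_times:
  "square_integrable half_line f \<Longrightarrow> integrable half_line (\<lambda>x. indicator {0<..<b} x * f x)"
  by (intro square_integrable_mult square_integrable_interval)

lemma square_integrable_bounded_support:
  assumes "f \<in> borel_measurable half_line" "\<And>x. x \<notin> {a..b} \<Longrightarrow> f x = 0" "\<And>x. \<bar>f x\<bar> \<le> B"
  shows "square_integrable half_line f"
proof (cases "a \<le> b")
  case True
  show ?thesis
  proof (rule norm_abs_l2_mono(1)[OF _ assms(1)])
    show "square_integrable half_line (\<lambda>x. B * indicator {a..b} x)"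
      by (intro square_integrable_scale indicator_square_integrable[of _ a b]) (use True in auto)
    show "AE x in half_line. \<bar>f x\<bar> \<le> \<bar>B * indicator {a..b} x\<bar>"
      using assms(2,3) order_trans[OF assms(3) abs_ge_self] by (auto simp: indicator_def)
  qed
next
  case False
  then have "f = (\<lambda>x. 0)" using assms(2) by auto
  then show ?thesis by (simp add: square_integrable_zero)
qed

text \<open>Cauchy-Schwarz against the indicator of the interval. It gives continuity up to the
  boundary point and the growth bound for primitives.\<close>

lemma prim_Hoelder:
  assumes "0 \<le> x" "x \<le> y"
  shows "\<bar>prim (rep_l2 w) y - prim (rep_l2 w) x\<bar> \<le> sqrt (y - x) * norm w"
proof -
  let ?i = "indicator {x..<y} :: real \<Rightarrow> real"
  have sub: "{x..<y} \<subseteq> {x..y}" by auto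
  have "{x..<y} \<in> sets borel" by simp
  note i = indicator_square_integrable[OF this sub assms(2)]
  have "prim (rep_l2 w) y - prim (rep_l2 w) x
      = (\<integral>z. indicator {0<..<y} z * rep_l2 w z - indicator {0<..<x} z * rep_l2 w z \<partial>half_line)"
    unfolding prim_def
    by (intro Bochner_Integration.integral_diff[symmetric] integrable_interval_times square_integrable_rep)
  also have "\<dots> = (\<integral>z. rep_l2 (abs_l2 ?i) z * rep_l2 w z \<partial>half_line)"
  proof (rule integral_cong_AE)
    \<comment> \<open>The point 0 does not belong to the space; hence for x = 0 the intervals
      \<open>{x..<y}\<close> and \<open>{0<..<y}\<close> cannot be told apart.\<close>
    have "AE z in half_line. z \<in> space half_line" by (rule AE_space)
    then show "AE z in half_line. indicator {0<..<y} z * rep_l2 w z - indicator {0<..<x} z * rep_l2 w z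
        = rep_l2 (abs_l2 ?i) z * rep_l2 w z"
      using rep_abs[OF i(1)] by eventually_elim (use assms in \<open>auto simp: indicator_def\<close>)
  qed measurable
  also have "\<bar>\<dots>\<bar> \<le> (\<integral>z. \<bar>rep_l2 (abs_l2 ?i) z * rep_l2 w z\<bar> \<partial>half_line)"
    by (rule integral_abs_bound)
  also have "\<dots> \<le> norm (abs_l2 ?i) * norm w" by (rule integral_abs_mult_le_norm)
  also have "norm (abs_l2 ?i) \<le> sqrt (y - x)"
    by (rule real_le_rsqrt) (use i(2) in simp)
  finally show ?thesis by (simp add: mult_right_mono)
qed

lemma continuous_prim: "continuous_on {0..} (prim (rep_l2 w))"
  unfolding continuous_on_def
proof
  fix x :: real assume x: "x \<in> {0..}"
  have "((\<lambda>y. prim (rep_l2 w) y - prim (rep_l2 w) x) \<longlongrightarrow> 0) (at x within {0..})"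
  proof (rule Lim_null_comparison)
    have "norm (prim (rep_l2 w) y - prim (rep_l2 w) x) \<le> sqrt \<bar>y - x\<bar> * norm w" if "y \<in> {0..}" for y
      using prim_Hoelder[of x y w] prim_Hoelder[of y x w] x that
      by (cases "x \<le> y") (auto simp: abs_minus_commute)
    then show "\<forall>\<^sub>F y in at x within {0..}. norm (prim (rep_l2 w) y - prim (rep_l2 w) x)
        \<le> sqrt \<bar>y - x\<bar> * norm w"
      by (simp add: eventually_at_filter)
    have "((\<lambda>y. sqrt \<bar>y - x\<bar> * norm w) \<longlongrightarrow> sqrt \<bar>x - x\<bar> * norm w) (at x within {0..})"
      by (intro tendsto_intros)
    then show "((\<lambda>y. sqrt \<bar>y - x\<bar> * norm w) \<longlongrightarrow> 0) (at x within {0..})" by simp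
  qed
  then show "(prim (rep_l2 w) \<longlongrightarrow> prim (rep_l2 w) x) (at x within {0..})"
    by (rule LIM_zero_cancel)
qed

lemma measurable_prim [measurable]: "prim (rep_l2 w) \<in> borel_measurable half_line"
  by (rule continuous_imp_measurable_half_line[OF continuous_prim])

lemma prim_deriv:
  assumes f: "\<And>x. (f has_real_derivative f' x) (at x)" and f': "continuous_on UNIV f'" and "0 \<le> x"
  shows "prim f' x = f x - f 0"
proof -
  have "(\<lambda>y. indicator {0<..<x} y * f' y) \<in> borel_measurable borel"
    using borel_measurable_continuous_onI[OF f'] by simp
  then have "prim f' x = (\<integral>y. indicator {0<..<x} y * f' y \<partial>lborel)"
    unfolding prim_def
    by (subst integral_half_line_lborel)
      (auto intro!: Bochner_Integration.integral_cong simp: indicator_def)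
  also have "\<dots> = (LBINT y=0..ereal x. f' y)"
    using assms(3) unfolding interval_lebesgue_integral_def set_lebesgue_integral_def
    by (auto intro!: Bochner_Integration.integral_cong simp: einterval_def indicator_def zero_ereal_def)
  also have "\<dots> = f x - f 0"
    using interval_integral_FTC_finite[of 0 x f' f] f f' assms(3)
    by (auto simp: zero_ereal_def has_real_derivative_iff_has_vector_derivative
        intro: has_vector_derivative_at_within continuous_on_subset)
  finally show ?thesis .
qed

lemma test_functionE:
  assumes "test_function \<phi>"
  obtains a b where "0 < a" "a < b" "\<And>x. x \<notin> {a<..<b} \<Longrightarrow> \<phi> x = 0"
    "\<And>x. x \<notin> {a<..<b} \<Longrightarrow> deriv \<phi> x = 0"
    "\<And>x. (\<phi> has_real_derivative deriv \<phi> x) (at x)" "continuous_on UNIV (deriv \<phi>)"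
    "square_integrable half_line \<phi>" "square_integrable half_line (deriv \<phi>)"
proof -
  obtain K where K: "compact K" "K \<subseteq> {0<..}" "\<And>x. x \<notin> K \<Longrightarrow> \<phi> x = 0"
    using assms unfolding test_function_def by blast
  have D: "(deriv ^^ k) \<phi> field_differentiable at x" for k x
    using assms unfolding test_function_def by blast
  have d: "(\<phi> has_real_derivative deriv \<phi> x) (at x)" for x
    using D[of 0 x] by (simp add: field_differentiable_derivI)
  have c: "continuous_on UNIV \<phi>" "continuous_on UNIV (deriv \<phi>)"
    using D[of 0] D[of 1]
    by (auto intro!: continuous_at_imp_continuous_on field_differentiable_imp_continuous_at)
  obtain a b where ab: "0 < a" "a < b" "K \<subseteq> {a<..<b}"
  proof (cases "K = {}")
    case True
    then show thesis using that[of 1 2] by simp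
  next
    case False
    then obtain l u where "l \<in> K" "u \<in> K" "\<And>x. x \<in> K \<Longrightarrow> l \<le> x \<and> x \<le> u"
      using compact_attains_inf[OF K(1)] compact_attains_sup[OF K(1)] by metis
    then show thesis using that[of "l / 2" "u + 1"] K(2) by force
  qed
  have dz: "deriv \<phi> x = 0" if "x \<notin> {a<..<b}" for x
  proof -
    have "open (- K)" using K(1) by (simp add: compact_imp_closed open_Compl)
    moreover have "x \<in> - K" using that ab by auto
    ultimately have "(\<phi> has_real_derivative 0) (at x)"
      by (rule has_field_derivative_transform_within_open[OF DERIV_const[of 0]]) (simp add: K(3))
    then show ?thesis by (rule DERIV_imp_deriv)
  qed
  have sq: "square_integrable half_line f"
    if "continuous_on UNIV f" "\<And>x. x \<notin> {a<..<b} \<Longrightarrow> f x = 0" for f :: "real \<Rightarrow> real"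
  proof -
    have "bounded (f ` {a..b})"
      by (intro compact_imp_bounded compact_continuous_image continuous_on_subset[OF that(1)]) auto
    then obtain B where B: "\<And>x. x \<in> {a..b} \<Longrightarrow> \<bar>f x\<bar> \<le> B"
      by (metis bounded_iff imageI real_norm_def)
    have "\<bar>f x\<bar> \<le> max B 0" for x
      using B[of x] that(2)[of x] by (cases "x \<in> {a..b}") auto
    then show ?thesis
      by (intro square_integrable_bounded_support[of f a b] continuous_imp_measurable_half_line
          continuous_on_subset[OF that(1)]) (use that(2) in auto)
  qed
  have pz: "\<phi> x = 0" if "x \<notin> {a<..<b}" for x using K(3)[of x] ab(3) that by blast
  show thesis
    by (rule that[OF ab(1,2) pz dz d c(2) sq[OF c(1) pz] sq[OF c(2) dz]])
qed

section \<open>Weak derivatives through inner products\<close>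

lemma inner_l2_abs:
  "square_integrable half_line f \<Longrightarrow> inner u (abs_l2 f) = (\<integral>x. rep_l2 u x * f x \<partial>half_line)"
  using inner_abs_l2[OF square_integrable_rep, of f u] by (simp add: abs_rep)

text \<open>In this form linearity and stability under limits in norm are immediate.\<close>

lemma has_weak_derivative_iff_inner:
  "has_weak_derivative u w \<longleftrightarrow>
    (\<forall>\<phi>. test_function \<phi> \<longrightarrow> inner u (abs_l2 (deriv \<phi>)) = - inner w (abs_l2 \<phi>))"
proof -
  have "(\<integral>x. rep_l2 u x * deriv \<phi> x \<partial>half_line) = inner u (abs_l2 (deriv \<phi>))"
    "(\<integral>x. rep_l2 w x * \<phi> x \<partial>half_line) = inner w (abs_l2 \<phi>)" if \<phi>: "test_function \<phi>" for \<phi>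
    by (rule test_functionE[OF \<phi>], simp add: inner_l2_abs)+
  then show ?thesis unfolding has_weak_derivative_def by auto
qed

lemma has_weak_derivative_add:
  "has_weak_derivative u w \<Longrightarrow> has_weak_derivative u' w' \<Longrightarrow> has_weak_derivative (u + u') (w + w')"
  by (simp add: has_weak_derivative_iff_inner inner_add_left)

lemma has_weak_derivative_scaleR:
  "has_weak_derivative u w \<Longrightarrow> has_weak_derivative (r *\<^sub>R u) (r *\<^sub>R w)"
  by (simp add: has_weak_derivative_iff_inner)

lemma has_weak_derivative_LIMSEQ:
  assumes "\<And>n. has_weak_derivative (u n) (w n)" "u \<longlonglongrightarrow> u'" "w \<longlonglongrightarrow> w'"
  shows "has_weak_derivative u' w'"
  unfolding has_weak_derivative_iff_inner
proof (intro allI impI)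
  fix \<phi> assume "test_function \<phi>"
  then have "inner (u n) (abs_l2 (deriv \<phi>)) = - inner (w n) (abs_l2 \<phi>)" for n
    using assms(1) unfolding has_weak_derivative_iff_inner by blast
  moreover have "(\<lambda>n. inner (u n) (abs_l2 (deriv \<phi>))) \<longlonglongrightarrow> inner u' (abs_l2 (deriv \<phi>))"
    "(\<lambda>n. - inner (w n) (abs_l2 \<phi>)) \<longlonglongrightarrow> - inner w' (abs_l2 \<phi>)"
    by (intro tendsto_intros assms)+
  ultimately show "inner u' (abs_l2 (deriv \<phi>)) = - inner w' (abs_l2 \<phi>)"
    using LIMSEQ_unique by auto
qed

lemma prim_bound: "0 \<le> x \<Longrightarrow> \<bar>prim (rep_l2 w) x\<bar> \<le> sqrt x * norm w"
  using prim_Hoelder[of 0 x w] by simp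

lemma square_integrable_interval_prim:
  "square_integrable half_line (\<lambda>x. indicator {0<..<b} x * prim (rep_l2 w) x)"
proof (rule norm_abs_l2_mono(1))
  show "square_integrable half_line (\<lambda>x. (sqrt b * norm w) * indicator {0<..<b} x)"
    by (intro square_integrable_scale square_integrable_interval)
  have "\<bar>prim (rep_l2 w) x\<bar> \<le> sqrt b * norm w" if "0 < x" "x < b" for x
    using prim_bound[of x w] mult_right_mono[of "sqrt x" "sqrt b" "norm w"] that by simp
  then show "AE x in half_line. \<bar>indicator {0<..<b} x * prim (rep_l2 w) x\<bar>
      \<le> \<bar>(sqrt b * norm w) * indicator {0<..<b} x\<bar>"
    by (auto simp: indicator_def abs_mult)
qed measurable

lemma integrable_interval_prim: "integrable half_line (\<lambda>x. indicator {0<..<b} x * prim (rep_l2 w) x)"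
  using square_integrable_mult[OF square_integrable_interval[of b] square_integrable_interval_prim[of b w]]
  by (simp add: mult.assoc[symmetric] indicator_inter_arith[symmetric])

text \<open>\<open>prim_mult\<close> with \<phi> written as the primitive of its derivative; the
  boundary term vanishes since b lies beyond the support.\<close>

lemma prim_test_function:
  assumes \<phi>: "test_function \<phi>"
  shows "integrable half_line (\<lambda>x. prim (rep_l2 w) x * deriv \<phi> x)"
    and "(\<integral>x. prim (rep_l2 w) x * deriv \<phi> x \<partial>half_line) = - inner w (abs_l2 \<phi>)"
proof -
  obtain a b where ab: "0 < a" "a < b"
    and z: "\<And>x. x \<notin> {a<..<b} \<Longrightarrow> \<phi> x = 0" "\<And>x. x \<notin> {a<..<b} \<Longrightarrow> deriv \<phi> x = 0"
    and d: "\<And>x. (\<phi> has_real_derivative deriv \<phi> x) (at x)" and c: "continuous_on UNIV (deriv \<phi>)"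
    and sq: "square_integrable half_line \<phi>" "square_integrable half_line (deriv \<phi>)"
    using test_functionE[OF \<phi>] by blast
  have [measurable]: "deriv \<phi> \<in> borel_measurable half_line"
    using sq by (simp add: square_integrable_def)
  have p: "prim (deriv \<phi>) x = \<phi> x" if "0 \<le> x" for x
    using prim_deriv[OF d c that] z(1)[of 0] ab by simp
  have ind: "indicator {0<..<b} x * (y * deriv \<phi> x) = y * deriv \<phi> x"
    "indicator {0<..<b} x * (y * \<phi> x) = y * \<phi> x" for x y :: real
    using z[of x] ab by (cases "x \<in> {a<..<b}"; auto simp: indicator_def)+
  show "integrable half_line (\<lambda>x. prim (rep_l2 w) x * deriv \<phi> x)"
  proof -
    from square_integrable_mult[OF square_integrable_interval_prim[of b w] sq(2)] show ?thesis by (simp add: mult.assoc ind)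
  qed
  have "(\<integral>x. indicator {0<..<b} x * (rep_l2 w x * prim (deriv \<phi>) x) \<partial>half_line)
      + (\<integral>x. indicator {0<..<b} x * (prim (rep_l2 w) x * deriv \<phi> x) \<partial>half_line)
      = prim (rep_l2 w) b * prim (deriv \<phi>) b"
    by (rule prim_mult) (use sq in \<open>auto intro!: integrable_interval_times square_integrable_rep\<close>)
  also have "prim (deriv \<phi>) b = 0" using p[of b] z(1)[of b] ab by simp
  also have "(\<integral>x. indicator {0<..<b} x * (rep_l2 w x * prim (deriv \<phi>) x) \<partial>half_line)
      = (\<integral>x. rep_l2 w x * \<phi> x \<partial>half_line)"
    by (rule Bochner_Integration.integral_cong) (auto simp: p ind)
  finally show "(\<integral>x. prim (rep_l2 w) x * deriv \<phi> x \<partial>half_line) = - inner w (abs_l2 \<phi>)"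
    by (simp add: ind inner_l2_abs sq)
qed

lemma integral_deriv_test_function:
  assumes \<phi>: "test_function \<phi>"
  shows "(\<integral>x. deriv \<phi> x \<partial>half_line) = 0"
proof -
  obtain a b where ab: "0 < a" "a < b"
    and z: "\<And>x. x \<notin> {a<..<b} \<Longrightarrow> \<phi> x = 0" "\<And>x. x \<notin> {a<..<b} \<Longrightarrow> deriv \<phi> x = 0"
    and d: "\<And>x. (\<phi> has_real_derivative deriv \<phi> x) (at x)" and c: "continuous_on UNIV (deriv \<phi>)"
    by (rule test_functionE[OF \<phi>]) (rule that; assumption)
  have "(\<integral>x. deriv \<phi> x \<partial>half_line) = prim (deriv \<phi>) b"
    unfolding prim_def
    by (rule Bochner_Integration.integral_cong) (use z(2) ab in \<open>auto simp: indicator_def\<close>)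
  also have "\<dots> = 0" using prim_deriv[OF d c, of b] z(1)[of b] z(1)[of 0] ab by simp
  finally show ?thesis .
qed

lemma has_weak_derivative_prim:
  assumes u: "AE x in half_line. rep_l2 u x = \<alpha> + prim (rep_l2 w) x"
  shows "has_weak_derivative u w"
  unfolding has_weak_derivative_iff_inner
proof (intro allI impI)
  fix \<phi> assume \<phi>: "test_function \<phi>"
  then have sq: "square_integrable half_line (deriv \<phi>)" and int: "integrable half_line (deriv \<phi>)"
  proof -
    obtain a b where sq: "square_integrable half_line (deriv \<phi>)" and
      z: "0 < a" "\<And>x. x \<notin> {a<..<b} \<Longrightarrow> deriv \<phi> x = 0"
      by (rule test_functionE[OF \<phi>]) (rule that; assumption)
    show "square_integrable half_line (deriv \<phi>)" by (rule sq)
    have "(\<lambda>x. indicator {0<..<b} x * deriv \<phi> x) = deriv \<phi>"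
    proof
      show "indicator {0<..<b} x * deriv \<phi> x = deriv \<phi> x" for x
        using z(1) z(2)[of x] by (cases "x \<in> {a<..<b}"; auto simp: indicator_def)
    qed
    then show "integrable half_line (deriv \<phi>)" using integrable_interval_times[OF sq, of b] by simp
  qed
  have [measurable]: "deriv \<phi> \<in> borel_measurable half_line" using int by simp
  have "inner u (abs_l2 (deriv \<phi>)) = (\<integral>x. \<alpha> * deriv \<phi> x + prim (rep_l2 w) x * deriv \<phi> x \<partial>half_line)"
    unfolding inner_l2_abs[OF sq]
  proof (rule integral_cong_AE)
    show "AE x in half_line. rep_l2 u x * deriv \<phi> x = \<alpha> * deriv \<phi> x + prim (rep_l2 w) x * deriv \<phi> x"
      using u by eventually_elim (simp add: algebra_simps)
  qed measurable
  also have "\<dots> = - inner w (abs_l2 \<phi>)"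
    using prim_test_function[OF \<phi>, of w] int integral_deriv_test_function[OF \<phi>] by simp
  finally show "inner u (abs_l2 (deriv \<phi>)) = - inner w (abs_l2 \<phi>)" .
qed

section \<open>The fundamental lemma of the calculus of variations\<close>

lemma flat_alg_scale_bump: "flat_alg (\<lambda>x. c * bump a b n x)"
proof -
  \<comment> \<open>The factor is absorbed into the polynomial, so that \<open>flat_alg.flat\<close>
    applies.\<close>
  have "c * flat 1 x = flat [:c:] x" for x by (simp add: flat_def)
  then have "(\<lambda>x. c * bump a b n x) = (\<lambda>x. flat [:c:] (real n * x + (- real n * a)) * flat 1 (- real n * x + real n * b))"
    by (simp add: bump_def mult.assoc[symmetric] fun_eq_iff)
  then show ?thesis by (simp only:) (intro flat_alg.mult flat_alg.flat)
qed

lemma bump_measurable [measurable]: "bump a b n \<in> borel_measurable half_line"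
  by (intro borel_measurable_half_line borel_measurable_continuous_onI flat_alg_continuous flat_alg_bump)

lemma square_integrable_bump: "square_integrable half_line (bump a b n)"
  by (rule square_integrable_bounded_support[of _ a b 1])
    (use bump_bounds[of a b n] in \<open>auto simp: bump_outside abs_le_iff intro: order_trans[of _ 0]\<close>)

lemma integrable_times_bump:
  assumes k: "k \<in> borel_measurable half_line" "integrable half_line (\<lambda>x. indicator {0<..<b} x * k x)"
    and "0 \<le> a"
  shows "integrable half_line (\<lambda>x. k x * bump a b n x)"
proof (rule Bochner_Integration.integrable_bound[OF k(2)])
  show "AE x in half_line. norm (k x * bump a b n x) \<le> norm (indicator {0<..<b} x * k x)"
  proof (rule AE_I2)
    fix x
    show "norm (k x * bump a b n x) \<le> norm (indicator {0<..<b} x * k x)"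
    proof (cases "x \<in> {a<..<b}")
      case True
      then show ?thesis
        using bump_bounds[of a b n x] assms(3) mult_left_mono[of "bump a b n x" 1 "\<bar>k x\<bar>"]
        by (simp add: abs_mult)
    qed (simp add: bump_outside)
  qed
qed (use k(1) in measurable)

text \<open>Bumps converge to indicators of intervals under the dominating function |k|, so all
  integrals over intervals away from 0 vanish.\<close>

lemma AE_zero_if_bump_integrals_zero:
  fixes k :: "real \<Rightarrow> real"
  assumes k [measurable]: "k \<in> borel_measurable half_line"
    and loc: "\<And>b. integrable half_line (\<lambda>x. indicator {0<..<b} x * k x)"
    and zero: "\<And>a b n. 0 < a \<Longrightarrow> (\<integral>x. k x * bump a b n x \<partial>half_line) = 0"
  shows "AE x in half_line. k x = 0"
proof -
  have int0: "(\<integral>x. indicator {a<..<b} x * k x \<partial>half_line) = 0" if "0 < a" for a b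
  proof -
    have "(\<lambda>n. \<integral>x. k x * bump a b n x \<partial>half_line) \<longlonglongrightarrow> (\<integral>x. k x * indicator {a<..<b} x \<partial>half_line)"
    proof (rule integral_dominated_convergence)
      show "integrable half_line (\<lambda>x. norm (indicator {0<..<b} x * k x))"
        using loc by (rule integrable_norm)
      show "AE x in half_line. (\<lambda>n. k x * bump a b n x) \<longlonglongrightarrow> k x * indicator {a<..<b} x"
        by (intro AE_I2 tendsto_intros bump_tendsto)
      show "AE x in half_line. norm (k x * bump a b n x) \<le> norm (indicator {0<..<b} x * k x)" for n
      proof (rule AE_I2)
        fix x
        show "norm (k x * bump a b n x) \<le> norm (indicator {0<..<b} x * k x)"
        proof (cases "x \<in> {a<..<b}")
          case True
          then show ?thesis
            using bump_bounds[of a b n x] \<open>0 < a\<close> mult_left_mono[of "bump a b n x" 1 "\<bar>k x\<bar>"]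
            by (simp add: abs_mult)
        qed (simp add: bump_outside)
      qed
    qed measurable
    then show ?thesis by (simp add: zero[OF that] LIMSEQ_const_iff mult.commute)
  qed
  obtain k' where k': "k' \<in> borel_measurable borel" "AE x in half_line. k' x = k x"
    "\<And>x. x \<le> 0 \<Longrightarrow> k' x = 0"
    using half_line_borel_version[OF k] by blast
  have [measurable]: "k' \<in> borel_measurable half_line" using k'(1) by (rule borel_measurable_half_line)
  \<comment> \<open>\<open>k\<close> is integrable only over bounded intervals, and the intervals
    must stay away from 0. Cutting to the interval from 1 / (m + 1) to m repairs both, and these
    intervals exhaust the half line.\<close>
  have AE_m: "AE x in lborel. indicator {1 / real (Suc m)<..<real m} x * k' x = 0" for m
  proof (rule AE_lborel_zero_if_interval_integrals_zero)
    define e where "e = 1 / real (Suc m)"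
    have e: "0 < e" by (simp add: e_def)
    let ?K = "\<lambda>x. indicator {e<..<real m} x * k' x"
    have ind: "indicator {0<..} x * ?K x = ?K x" for x
      using k'(3)[of x] by (auto simp: indicator_def)
    have meas: "?K \<in> borel_measurable borel" using k'(1) by simp
    have "integrable half_line ?K"
    proof (rule Bochner_Integration.integrable_bound[OF loc[of "real m"]])
      show "AE x in half_line. norm (?K x) \<le> norm (indicator {0<..<real m} x * k x)"
        using k'(2) by eventually_elim (use e in \<open>auto simp: indicator_def\<close>)
    qed measurable
    then show "integrable lborel (\<lambda>x. indicator {1 / real (Suc m)<..<real m} x * k' x)"
      using meas unfolding e_def[symmetric] by (simp add: integrable_half_line_iff ind)
    fix a b :: real
    let ?a = "max a e" and ?b = "min b (real m)"
    have "(\<integral>x. indicator {a<..<b} x * ?K x \<partial>lborel) = (\<integral>x. indicator {0<..} x * (indicator {?a<..<?b} x * k' x) \<partial>lborel)"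
      using e by (intro Bochner_Integration.integral_cong) (auto simp: indicator_def)
    also have "\<dots> = (\<integral>x. indicator {?a<..<?b} x * k' x \<partial>half_line)"
      using k'(1) by (subst integral_half_line_lborel) simp_all
    also have "\<dots> = (\<integral>x. indicator {?a<..<?b} x * k x \<partial>half_line)"
    proof (rule integral_cong_AE)
      show "AE x in half_line. indicator {?a<..<?b} x * k' x = indicator {?a<..<?b} x * k x"
        using k'(2) by eventually_elim simp
    qed measurable
    also have "\<dots> = 0" by (rule int0) (use e in linarith)
    finally show "(\<integral>x. indicator {a<..<b} x * (indicator {1 / real (Suc m)<..<real m} x * k' x) \<partial>lborel) = 0"
      unfolding e_def .
  qed
  have "AE x in lborel. \<forall>m. indicator {1 / real (Suc m)<..<real m} x * k' x = 0"
    unfolding AE_all_countable using AE_m by blast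
  then have "AE x in lborel. k' x = 0"
  proof eventually_elim
    case (elim x)
    show "k' x = 0"
    proof (cases "x \<le> 0")
      case False
      obtain m where m: "max x (1 / x) < real m" using reals_Archimedean2 by blast
      have "1 / x < real (Suc m)" using m by simp
      then have "1 / real (Suc m) < x" using False by (simp add: field_simps)
      then show ?thesis using elim[rule_format, of m] m by (simp add: indicator_def)
    qed (rule k'(3))
  qed
  then have "AE x in lebesgue. k' x = 0" by (rule AE_completion)
  then have "AE x in half_line. k' x = 0"
    by (subst AE_restrict_space_iff[OF half_line_in_sets]) auto
  then show ?thesis using k'(2) by eventually_elim simp
qed

lemma test_function_bump: "0 < a \<Longrightarrow> test_function (bump a b n)"
  by (rule flat_alg_test_function[where a = a and b = b]) (auto simp: bump_outside flat_alg_bump)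

lemma weak_derivative_unique:
  assumes "has_weak_derivative u w" "has_weak_derivative u w'"
  shows "w = w'"
proof (rule l2_eqI)
  have "AE x in half_line. rep_l2 w x - rep_l2 w' x = 0"
  proof (rule AE_zero_if_bump_integrals_zero)
    show "integrable half_line (\<lambda>x. indicator {0<..<b} x * (rep_l2 w x - rep_l2 w' x))" for b
      unfolding right_diff_distrib
      by (intro Bochner_Integration.integrable_diff integrable_interval_times square_integrable_rep)
    fix a b :: real and n assume a: "0 < a"
    have "inner w (abs_l2 (bump a b n)) = inner w' (abs_l2 (bump a b n))"
      using assms test_function_bump[OF a] unfolding has_weak_derivative_iff_inner
      by (metis neg_equal_iff_equal)
    moreover have "integrable half_line (\<lambda>x. rep_l2 v x * bump a b n x)" for v
      by (intro square_integrable_mult square_integrable_rep square_integrable_bump)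
    ultimately show "(\<integral>x. (rep_l2 w x - rep_l2 w' x) * bump a b n x \<partial>half_line) = 0"
      by (simp add: left_diff_distrib inner_l2_abs[OF square_integrable_bump])
  qed measurable
  then show "AE x in half_line. rep_l2 w x = rep_l2 w' x" by eventually_elim simp
qed

lemma interval_integral_has_real_derivative:
  fixes f :: "real \<Rightarrow> real"
  assumes "continuous_on UNIV f"
  shows "((\<lambda>x. LBINT y=0..ereal x. f y) has_real_derivative f x) (at x)"
proof -
  have "((\<lambda>u. LBINT y=ereal 0..u. f y) has_vector_derivative f x) (at x within {- (\<bar>x\<bar> + 1)..\<bar>x\<bar> + 1})"
    by (rule interval_integral_FTC2) (use continuous_on_subset[OF assms] in auto)
  moreover have "at x within {- (\<bar>x\<bar> + 1)..\<bar>x\<bar> + 1} = at x"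
    by (rule at_within_Icc_at) auto
  ultimately show ?thesis
    by (simp add: has_real_derivative_iff_has_vector_derivative zero_ereal_def)
qed

text \<open>Mean zero makes the primitive vanish to the right of the support as well. It is smooth
  because its derivative lies in \<open>flat_alg\<close>.\<close>

lemma test_function_antiderivative:
  assumes \<psi>: "flat_alg \<psi>" "0 < a" "\<And>x. x \<notin> {a<..<b} \<Longrightarrow> \<psi> x = 0"
    and int: "(\<integral>x. \<psi> x \<partial>half_line) = 0"
  obtains \<phi> where "test_function \<phi>" "deriv \<phi> = \<psi>"
proof -
  define \<phi> where "\<phi> x = (LBINT y=0..ereal x. \<psi> y)" for x
  have c: "continuous_on S \<psi>" for S by (rule flat_alg_continuous[OF \<psi>(1)])
  have d: "(\<phi> has_real_derivative \<psi> x) (at x)" for x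
    unfolding \<phi>_def[abs_def] by (rule interval_integral_has_real_derivative[OF c])
  have \<phi>0: "\<phi> 0 = 0" by (simp add: \<phi>_def zero_ereal_def)
  have p: "\<phi> x = prim \<psi> x" if "0 \<le> x" for x
    using prim_deriv[OF d c that] \<phi>0 by simp
  have z: "\<phi> x = 0" if x: "x \<notin> {a..b}" for x
  proof -
    have "x < 0 \<or> 0 \<le> x \<and> x < a \<or> 0 \<le> x \<and> b < x" using x by auto
    then consider "x < 0" | "0 \<le> x" "x < a" | "0 \<le> x" "b < x" by blast
    then show ?thesis
    proof cases
      case 1
      have "\<exists>c. \<forall>x\<in>{..0}. \<phi> x = c"
      proof (rule has_field_derivative_zero_constant)
        show "(\<phi> has_real_derivative 0) (at y within {..0})" if "y \<in> {..0}" for y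
          using d[of y] \<psi>(2) \<psi>(3)[of y] that by (auto intro: has_field_derivative_at_within)
      qed simp
      then obtain c where "\<phi> x = c" "\<phi> 0 = c" using 1 by auto
      then show ?thesis using \<phi>0 by simp
    next
      case 2
      have "prim \<psi> x = (\<integral>y. 0 \<partial>half_line)"
        unfolding prim_def
      proof (rule Bochner_Integration.integral_cong)
        show "indicator {0<..<x} y * \<psi> y = 0" for y
          using \<psi>(3)[of y] 2 by (cases "y \<in> {a<..<b}") auto
      qed simp
      then show ?thesis using p 2 by simp
    next
      case 3
      have "prim \<psi> x = (\<integral>x. \<psi> x \<partial>half_line)"
        unfolding prim_def
      proof (rule Bochner_Integration.integral_cong)
        show "indicator {0<..<x} y * \<psi> y = \<psi> y" for y
          using \<psi>(2) \<psi>(3)[of y] 3 by (cases "y \<in> {a<..<b}") auto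
      qed simp
      then show ?thesis using p 3 int by simp
    qed
  qed
  show thesis
  proof
    show "deriv \<phi> = \<psi>" using d by (intro ext DERIV_imp_deriv)
    show "test_function \<phi>"
      unfolding test_function_def
    proof
      show "\<forall>k x. (deriv ^^ k) \<phi> field_differentiable at x"
      proof (intro allI iterated_deriv_differentiable)
        show "\<phi> \<in> insert \<phi> (Collect flat_alg)" by simp
        show "\<exists>f'\<in>insert \<phi> (Collect flat_alg). \<forall>x. (f has_field_derivative f' x) (at x)"
          if "f \<in> insert \<phi> (Collect flat_alg)" for f
          using that d \<psi>(1) by (metis flat_alg_derivative insertE insertI2 mem_Collect_eq)
      qed
      show "\<exists>K. compact K \<and> K \<subseteq> {0<..} \<and> (\<forall>x. x \<notin> K \<longrightarrow> \<phi> x = 0)"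
        using z \<psi>(2) by (intro exI[of _ "{a..b}"]) auto
    qed
  qed
qed

lemma integral_bump_pos: "0 < (\<integral>x. bump 1 2 1 x \<partial>half_line)"
proof -
  have int: "integrable half_line (bump 1 2 1)"
    using integrable_times_bump[of "\<lambda>_. 1" 2 1 1] square_integrable_interval[of 2]
      integrable_interval_times[OF square_integrable_interval[of 2], of 2]
    by (simp add: mult_ac indicator_inter_arith[symmetric])
  have "(\<integral>x. bump 1 2 1 x \<partial>half_line) \<noteq> 0"
  proof
    assume "(\<integral>x. bump 1 2 1 x \<partial>half_line) = 0"
    then have "AE x in half_line. bump 1 2 1 x = 0"
      using int bump_bounds(1) by (subst (asm) integral_nonneg_eq_0_iff_AE) auto
    from AE_half_line_Ex[OF this, of 1 2] obtain x where "x \<in> {1<..<2}" "bump 1 2 1 x = 0"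
      by auto
    then show False by (simp add: bump_inside)
  qed
  moreover have "0 \<le> (\<integral>x. bump 1 2 1 x \<partial>half_line)"
    using bump_bounds(1) by (intro integral_nonneg_AE) auto
  ultimately show ?thesis by simp
qed

text \<open>The difference \<open>h\<close> of \<open>u\<close> and the primitive of
  \<open>w\<close> is orthogonal to all derivatives of test functions, in particular to combinations
  of bumps with mean zero. After subtraction of a constant it is orthogonal to all bumps.\<close>

lemma du_Bois_Reymond:
  assumes "has_weak_derivative u w"
  obtains \<alpha> where "AE x in half_line. rep_l2 u x = \<alpha> + prim (rep_l2 w) x"
proof -
  define h where "h x = rep_l2 u x - prim (rep_l2 w) x" for x
  have hm [measurable]: "h \<in> borel_measurable half_line" unfolding h_def by measurable
  have loc: "integrable half_line (\<lambda>x. indicator {0<..<b} x * h x)" for b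
    unfolding h_def right_diff_distrib
    by (intro Bochner_Integration.integrable_diff integrable_interval_times square_integrable_rep
        integrable_interval_prim)
  have hd: "(\<integral>x. h x * deriv \<phi> x \<partial>half_line) = 0" if \<phi>: "test_function \<phi>" for \<phi>
  proof -
    have sq: "square_integrable half_line (deriv \<phi>)" by (rule test_functionE[OF \<phi>])
    have "(\<integral>x. h x * deriv \<phi> x \<partial>half_line) = inner u (abs_l2 (deriv \<phi>)) + inner w (abs_l2 \<phi>)"
      using prim_test_function[OF \<phi>, of w] square_integrable_mult[OF square_integrable_rep[of u] sq]
      by (simp add: h_def left_diff_distrib inner_l2_abs[OF sq])
    also have "\<dots> = 0"
      using assms \<phi> unfolding has_weak_derivative_iff_inner by simp
    finally show ?thesis .
  qed
  define I where "I = (\<integral>x. bump 1 2 1 x \<partial>half_line)"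
  have I: "I \<noteq> 0" using integral_bump_pos by (simp add: I_def)
  \<comment> \<open>If \<open>h\<close> is constant almost everywhere, this normalised mean is the
    constant.\<close>
  define \<alpha> where "\<alpha> = (\<integral>x. h x * bump 1 2 1 x \<partial>half_line) / I"
  have loc1: "integrable half_line (\<lambda>x. indicator {0<..<b} x * (1::real))" for b
    using integrable_interval_times[OF square_integrable_interval[of b], of b]
    by (simp add: indicator_inter_arith[symmetric])
  have int_bump: "integrable half_line (bump a b n)" if "0 < a" for a b n
    using integrable_times_bump[of "\<lambda>_. 1" b a n] loc1 that by simp
  have int_h: "integrable half_line (\<lambda>x. h x * bump a b n x)" if "0 < a" for a b n
    by (rule integrable_times_bump[OF hm loc]) (use that in simp)
  have "AE x in half_line. h x - \<alpha> = 0"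
  proof (rule AE_zero_if_bump_integrals_zero)
    show "integrable half_line (\<lambda>x. indicator {0<..<b} x * (h x - \<alpha>))" for b
    proof -
      have "integrable half_line (\<lambda>x. indicator {0<..<b} x * 1 * \<alpha>)"
        by (intro integrable_mult_left loc1)
      from Bochner_Integration.integrable_diff[OF loc this] show ?thesis
        by (simp add: right_diff_distrib)
    qed
    fix a b :: real and n :: nat assume a: "0 < a"
    define J where "J = (\<integral>x. bump a b n x \<partial>half_line)"
    \<comment> \<open>The multiple of the fixed bump is chosen to make the mean 0, so that an
      antiderivative is again a test function.\<close>
    let ?\<psi> = "\<lambda>x. 1 * bump a b n x + (- J / I) * bump 1 2 1 x"
    obtain \<phi> where \<phi>: "test_function \<phi>" "deriv \<phi> = ?\<psi>"
    proof (rule test_function_antiderivative)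
      show "flat_alg ?\<psi>" by (intro flat_alg.add flat_alg_scale_bump)
      show "0 < min a 1" using a by simp
      show "?\<psi> x = 0" if "x \<notin> {min a 1<..<max b 2}" for x
      proof -
        have "x \<notin> {a<..<b}" "x \<notin> {1<..<2}" using that by auto
        then show ?thesis by (simp add: bump_outside del: One_nat_def)
      qed
      show "(\<integral>x. ?\<psi> x \<partial>half_line) = 0"
        using int_bump[OF a, of b n] int_bump[of 1 2 1] I by (simp add: J_def I_def)
    qed
    have "0 = (\<integral>x. h x * ?\<psi> x \<partial>half_line)" using hd[OF \<phi>(1)] \<phi>(2) by simp
    also have "\<dots> = (\<integral>x. h x * bump a b n x + (- J / I) * (h x * bump 1 2 1 x) \<partial>half_line)"
      by (simp add: algebra_simps)
    also have "\<dots> = (\<integral>x. h x * bump a b n x \<partial>half_line) - J / I * (\<integral>x. h x * bump 1 2 1 x \<partial>half_line)"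
      using int_h[OF a, of b n] int_h[of 1 2 1] by simp
    also have "\<dots> = (\<integral>x. h x * bump a b n x \<partial>half_line) - \<alpha> * J"
      by (simp add: \<alpha>_def)
    also have "\<dots> = (\<integral>x. (h x - \<alpha>) * bump a b n x \<partial>half_line)"
      using int_h[OF a, of b n] int_bump[OF a, of b n] by (simp add: left_diff_distrib J_def)
    finally show "(\<integral>x. (h x - \<alpha>) * bump a b n x \<partial>half_line) = 0" by simp
  qed measurable
  then have "AE x in half_line. rep_l2 u x = \<alpha> + prim (rep_l2 w) x"
    by eventually_elim (simp add: h_def)
  then show thesis by (rule that)
qed

section \<open>Boundary values and decay at infinity\<close>

lemma continuous_AE_zero_imp_zero:
  fixes d :: "real \<Rightarrow> real"
  assumes d: "continuous_on {0..} d" "AE x in half_line. d x = 0" and "0 \<le> x"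
  shows "d x = 0"
proof -
  have "\<exists>y. y \<in> {x<..<x + 1 / real (Suc n)} \<and> d y = 0" for n
    using AE_half_line_Ex[OF d(2) assms(3), of "x + 1 / real (Suc n)"] by auto
  then obtain y where y: "\<And>n. y n \<in> {x<..<x + 1 / real (Suc n)}" "\<And>n. d (y n) = 0" by metis
  have lim: "y \<longlonglongrightarrow> x"
  proof (rule tendsto_sandwich)
    show "\<forall>\<^sub>F n in sequentially. x \<le> y n" "\<forall>\<^sub>F n in sequentially. y n \<le> x + 1 / real (Suc n)"
      using y(1) by (auto intro!: always_eventually less_imp_le)
    have "(\<lambda>n. x + 1 / real (Suc n)) \<longlonglongrightarrow> x + 0"
      by (intro tendsto_intros LIMSEQ_Suc[OF lim_1_over_n])
    then show "(\<lambda>n. x + 1 / real (Suc n)) \<longlonglongrightarrow> x" by simp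
  qed simp
  have "y n \<in> {0..}" for n using y(1)[of n] assms(3) by auto
  then have "(\<lambda>n. d (y n)) \<longlonglongrightarrow> d x"
    by (intro continuous_on_tendsto_compose[OF d(1) lim]) (use assms(3) in auto)
  then show ?thesis by (simp add: y(2) LIMSEQ_const_iff)
qed

text \<open>Two continuous representatives agree almost everywhere, hence at every point up to 0, so
  the description in \<open>trace0\<close> is unique.\<close>

lemma trace0_eq:
  assumes "AE x in half_line. rep_l2 u x = \<alpha> + prim (rep_l2 w) x"
  shows "trace0 u = \<alpha>"
  unfolding trace0_def
proof (rule the_equality)
  have c: "continuous_on {0..} (\<lambda>x. \<alpha> + prim (rep_l2 w) x)"
    by (intro continuous_intros continuous_prim)
  show "\<exists>g. continuous_on {0..} g \<and> (AE x in half_line. rep_l2 u x = g x) \<and> g 0 = \<alpha>"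
    by (rule exI[of _ "\<lambda>x. \<alpha> + prim (rep_l2 w) x"]) (use assms c in simp)
  fix a assume "\<exists>g. continuous_on {0..} g \<and> (AE x in half_line. rep_l2 u x = g x) \<and> g 0 = a"
  then obtain g where g: "continuous_on {0..} g" "AE x in half_line. rep_l2 u x = g x" "g 0 = a"
    by blast
  have "g 0 - (\<alpha> + prim (rep_l2 w) 0) = 0"
  proof (rule continuous_AE_zero_imp_zero[where d = "\<lambda>x. g x - (\<alpha> + prim (rep_l2 w) x)"])
    show "continuous_on {0..} (\<lambda>x. g x - (\<alpha> + prim (rep_l2 w) x))"
      by (intro continuous_intros g continuous_prim)
    show "AE x in half_line. g x - (\<alpha> + prim (rep_l2 w) x) = 0"
      using assms g(2) by eventually_elim simp
  qed simp
  then show "a = \<alpha>" using g(3) by simp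
qed

lemma has_weak_derivative_trace:
  assumes "has_weak_derivative u w"
  shows "AE x in half_line. rep_l2 u x = trace0 u + prim (rep_l2 w) x"
proof -
  obtain \<alpha> where \<alpha>: "AE x in half_line. rep_l2 u x = \<alpha> + prim (rep_l2 w) x"
    using du_Bois_Reymond[OF assms] by blast
  then show ?thesis using trace0_eq[OF \<alpha>] by simp
qed

lemma measurable_interval_times [measurable]:
  "f \<in> borel_measurable half_line \<Longrightarrow> (\<lambda>x. indicator {0<..<b} x * f x :: real) \<in> borel_measurable half_line"
  by measurable

lemma prim_add: "prim (rep_l2 (w + w')) x = prim (rep_l2 w) x + prim (rep_l2 w') x"
proof -
  have "prim (rep_l2 (w + w')) x = prim (\<lambda>x. rep_l2 w x + rep_l2 w' x) x"
    by (rule prim_cong_AE[OF rep_add]) auto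
  then show ?thesis
    unfolding prim_def distrib_left
    by (simp add: Bochner_Integration.integral_add integrable_interval_times square_integrable_rep)
qed

lemma prim_scaleR: "prim (rep_l2 (r *\<^sub>R w)) x = r * prim (rep_l2 w) x"
proof -
  have "prim (rep_l2 (r *\<^sub>R w)) x = prim (\<lambda>x. r * rep_l2 w x) x"
    by (rule prim_cong_AE[OF rep_scaleR]) auto
  then show ?thesis by (simp add: prim_def mult.left_commute[of _ r])
qed

lemma trace0_add:
  assumes "has_weak_derivative u w" "has_weak_derivative u' w'"
  shows "trace0 (u + u') = trace0 u + trace0 u'"
proof (rule trace0_eq)
  show "AE x in half_line. rep_l2 (u + u') x = trace0 u + trace0 u' + prim (rep_l2 (w + w')) x"
    using rep_add[of u u'] has_weak_derivative_trace[OF assms(1)] has_weak_derivative_trace[OF assms(2)]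
    by eventually_elim (simp add: prim_add)
qed

lemma trace0_scaleR:
  assumes "has_weak_derivative u w"
  shows "trace0 (r *\<^sub>R u) = r * trace0 u"
proof (rule trace0_eq)
  show "AE x in half_line. rep_l2 (r *\<^sub>R u) x = r * trace0 u + prim (rep_l2 (r *\<^sub>R w)) x"
    using rep_scaleR[of r u] has_weak_derivative_trace[OF assms]
    by eventually_elim (simp add: prim_scaleR algebra_simps)
qed

text \<open>Each function is its trace plus a primitive; \<open>prim_mult\<close> handles the
  primitives, and the constants are integrated separately.\<close>

lemma integral_interval_by_parts:
  assumes 1: "has_weak_derivative u1 w1" and 2: "has_weak_derivative u2 w2" and "0 \<le> b"
  shows "(\<integral>x. indicator {0<..<b} x * (rep_l2 w1 x * rep_l2 u2 x) \<partial>half_line)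
      + (\<integral>x. indicator {0<..<b} x * (rep_l2 u1 x * rep_l2 w2 x) \<partial>half_line)
    = (trace0 u1 + prim (rep_l2 w1) b) * (trace0 u2 + prim (rep_l2 w2) b) - trace0 u1 * trace0 u2"
proof -
  have half: "(\<integral>x. indicator {0<..<b} x * (rep_l2 w1 x * rep_l2 u2 x) \<partial>half_line)
      = trace0 u2 * prim (rep_l2 w1) b
        + (\<integral>x. indicator {0<..<b} x * (rep_l2 w1 x * prim (rep_l2 w2) x) \<partial>half_line)"
    if 2: "has_weak_derivative u2 w2" for u2 w2 w1
  proof -
    have "(\<integral>x. indicator {0<..<b} x * (rep_l2 w1 x * rep_l2 u2 x) \<partial>half_line)
        = (\<integral>x. trace0 u2 * (indicator {0<..<b} x * rep_l2 w1 x)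
            + indicator {0<..<b} x * (rep_l2 w1 x * prim (rep_l2 w2) x) \<partial>half_line)"
    proof (rule integral_cong_AE)
      show "AE x in half_line. indicator {0<..<b} x * (rep_l2 w1 x * rep_l2 u2 x)
          = trace0 u2 * (indicator {0<..<b} x * rep_l2 w1 x)
            + indicator {0<..<b} x * (rep_l2 w1 x * prim (rep_l2 w2) x)"
        using has_weak_derivative_trace[OF 2] by eventually_elim (simp add: algebra_simps)
    qed measurable
    also have "\<dots> = trace0 u2 * prim (rep_l2 w1) b
        + (\<integral>x. indicator {0<..<b} x * (rep_l2 w1 x * prim (rep_l2 w2) x) \<partial>half_line)"
    proof -
      have "integrable half_line (\<lambda>x. indicator {0<..<b} x * rep_l2 w1 x)"
        by (intro integrable_interval_times square_integrable_rep)
      moreover have "integrable half_line (\<lambda>x. indicator {0<..<b} x * (rep_l2 w1 x * prim (rep_l2 w2) x))"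
        using square_integrable_mult[OF square_integrable_rep[of w1] square_integrable_interval_prim[of b w2]]
        by (simp add: mult_ac)
      ultimately show ?thesis by (simp add: prim_def)
    qed
    finally show ?thesis .
  qed
  have "(\<integral>x. indicator {0<..<b} x * (rep_l2 w1 x * prim (rep_l2 w2) x) \<partial>half_line)
      + (\<integral>x. indicator {0<..<b} x * (prim (rep_l2 w1) x * rep_l2 w2 x) \<partial>half_line)
      = prim (rep_l2 w1) b * prim (rep_l2 w2) b"
    by (rule prim_mult) (auto intro!: integrable_interval_times square_integrable_rep)
  then show ?thesis
    using half[OF 2, of w1] half[OF 1, of w2] by (simp add: algebra_simps)
qed

lemma integral_interval_tendsto:
  fixes f :: "real \<Rightarrow> real"
  assumes "integrable half_line f"
  shows "((\<lambda>b. \<integral>x. indicator {0<..<b} x * f x \<partial>half_line) \<longlongrightarrow> (\<integral>x. f x \<partial>half_line)) at_top"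
proof (rule integral_dominated_convergence_at_top)
  show "integrable half_line (\<lambda>x. \<bar>f x\<bar>)" using assms by simp
  show "f \<in> borel_measurable half_line" using assms by simp
  then show "(\<lambda>x. indicator {0<..<b} x * f x) \<in> borel_measurable half_line" for b by simp
  show "\<forall>\<^sub>F b in at_top. AE x in half_line. norm (indicator {0<..<b} x * f x) \<le> \<bar>f x\<bar>"
    by (auto simp: indicator_def)
  show "AE x in half_line. ((\<lambda>b. indicator {0<..<b} x * f x) \<longlongrightarrow> f x) at_top"
  proof (rule AE_I2)
    fix x assume x: "x \<in> space half_line"
    have "\<forall>\<^sub>F b in at_top. f x = indicator {0<..<b} x * f x"
      using eventually_gt_at_top[of x] by eventually_elim (use x in auto)
    then show "((\<lambda>b. indicator {0<..<b} x * f x) \<longlongrightarrow> f x) at_top"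
      by (rule Lim_transform_eventually[OF tendsto_const])
  qed
qed

text \<open>The integrands are products of square integrable functions, so the integrals converge
  and force the boundary term at b to have a limit.\<close>

lemma product_tendsto:
  assumes 1: "has_weak_derivative u1 w1" and 2: "has_weak_derivative u2 w2"
  shows "((\<lambda>b. (trace0 u1 + prim (rep_l2 w1) b) * (trace0 u2 + prim (rep_l2 w2) b))
    \<longlongrightarrow> inner w1 u2 + inner u1 w2 + trace0 u1 * trace0 u2) at_top"
proof -
  have "((\<lambda>b. (\<integral>x. indicator {0<..<b} x * (rep_l2 w1 x * rep_l2 u2 x) \<partial>half_line)
      + (\<integral>x. indicator {0<..<b} x * (rep_l2 u1 x * rep_l2 w2 x) \<partial>half_line) + trace0 u1 * trace0 u2)
    \<longlongrightarrow> inner w1 u2 + inner u1 w2 + trace0 u1 * trace0 u2) at_top"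
    unfolding inner_l2_rep
    by (intro tendsto_intros integral_interval_tendsto integrable_rep_mult)
  moreover have "\<forall>\<^sub>F b in at_top. (\<integral>x. indicator {0<..<b} x * (rep_l2 w1 x * rep_l2 u2 x) \<partial>half_line)
      + (\<integral>x. indicator {0<..<b} x * (rep_l2 u1 x * rep_l2 w2 x) \<partial>half_line) + trace0 u1 * trace0 u2
    = (trace0 u1 + prim (rep_l2 w1) b) * (trace0 u2 + prim (rep_l2 w2) b)"
    using eventually_ge_at_top[of 0]
    by eventually_elim (simp add: integral_interval_by_parts[OF 1 2])
  ultimately show ?thesis by (rule Lim_transform_eventually)
qed

text \<open>By \<open>product_tendsto\<close> the square of the continuous representative has a
  limit l. If l were positive, an interval of length n far out would contribute at least n * l / 2
  to the squared norm.\<close>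

lemma H1_vanishes_at_infinity:
  assumes u: "has_weak_derivative u w"
  shows "((\<lambda>b. trace0 u + prim (rep_l2 w) b) \<longlongrightarrow> 0) at_top"
proof -
  let ?g = "\<lambda>b. trace0 u + prim (rep_l2 w) b"
  obtain l where l: "((\<lambda>b. (?g b)\<^sup>2) \<longlongrightarrow> l) at_top"
    using product_tendsto[OF u u] unfolding power2_eq_square by blast
  have "l \<ge> 0" by (rule tendsto_lowerbound[OF l]) auto
  have "l \<le> 0"
  proof (rule ccontr)
    assume "\<not> l \<le> 0"
    then have "l / 2 < l" "0 < l" by simp_all
    from order_tendstoD(1)[OF l this(1)] obtain B0 where B0: "\<And>b. b \<ge> B0 \<Longrightarrow> l / 2 < (?g b)\<^sup>2"
      unfolding eventually_at_top_linorder by blast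
    define B where "B = max B0 0"
    have bd: "real n * (l / 2) \<le> (norm u)\<^sup>2" for n
    proof -
      let ?I = "{B<..<B + real n}"
      have sub: "?I \<subseteq> {B..B + real n}" by auto
      have "real n = (\<integral>x. indicator {0<..} x * indicator ?I x \<partial>lborel)"
      proof -
        have "(\<lambda>x. indicator {0<..} x * indicator ?I x) = (indicator ?I :: real \<Rightarrow> real)"
          by (auto simp: indicator_def B_def fun_eq_iff)
        then show ?thesis by (simp only:) simp
      qed
      also have "\<dots> = (\<integral>x. indicator ?I x \<partial>half_line)"
        by (rule integral_half_line_lborel[symmetric]) simp
      finally have "real n * (l / 2) = (\<integral>x. indicator ?I x * (l / 2) \<partial>half_line)" by simp
      also have "\<dots> \<le> (\<integral>x. (rep_l2 u x)\<^sup>2 \<partial>half_line)"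
      proof (rule integral_mono_AE)
        have "(\<lambda>x. (indicator ?I x)\<^sup>2) = (indicator ?I :: real \<Rightarrow> real)"
          by (auto simp: indicator_def)
        then have "integrable half_line (indicator ?I :: real \<Rightarrow> real)"
          using indicator_square_integrable(1)[OF _ sub] unfolding square_integrable_def by auto
        then show "integrable half_line (\<lambda>x. indicator ?I x * (l / 2))" by simp
        show "integrable half_line (\<lambda>x. (rep_l2 u x)\<^sup>2)" by (rule integrable_rep_square)
        show "AE x in half_line. indicator ?I x * (l / 2) \<le> (rep_l2 u x)\<^sup>2"
          using has_weak_derivative_trace[OF u]
        proof eventually_elim
          case (elim x)
          then show ?case using B0[of x] \<open>0 < l\<close> by (auto simp: indicator_def B_def)
        qed
      qed
      finally show ?thesis by (simp add: norm_l2_rep)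
    qed
    obtain n where "(norm u)\<^sup>2 / (l / 2) < real n" using reals_Archimedean2 by blast
    then have "(norm u)\<^sup>2 < real n * (l / 2)" using \<open>0 < l\<close> by (simp add: field_simps)
    then show False using bd[of n] by simp
  qed
  then have "((\<lambda>b. sqrt ((?g b)\<^sup>2)) \<longlongrightarrow> sqrt 0) at_top"
    using l \<open>l \<ge> 0\<close> by (intro tendsto_real_sqrt) auto
  then show ?thesis by (simp add: tendsto_rabs_zero_iff)
qed

lemma weak_derivative_by_parts:
  assumes 1: "has_weak_derivative u1 w1" and 2: "has_weak_derivative u2 w2"
  shows "inner w1 u2 + inner u1 w2 = - (trace0 u1 * trace0 u2)"
proof -
  have "((\<lambda>b. (trace0 u1 + prim (rep_l2 w1) b) * (trace0 u2 + prim (rep_l2 w2) b)) \<longlongrightarrow> 0 * 0) at_top"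
    by (intro tendsto_mult H1_vanishes_at_infinity 1 2)
  with product_tendsto[OF 1 2] have "inner w1 u2 + inner u1 w2 + trace0 u1 * trace0 u2 = 0 * 0"
    by (intro tendsto_unique[of at_top]) auto
  then show ?thesis by simp
qed

text \<open>Formally u(x)^2 is minus the integral of 2 w u from x to infinity. This integral appears
  as the whole inner product, which determines the trace, minus the part up to x.\<close>

lemma H1_bounded:
  assumes u: "has_weak_derivative u w"
  shows "AE x in half_line. (rep_l2 u x)\<^sup>2 \<le> 2 * norm u * norm w"
proof -
  have g: "(trace0 u + prim (rep_l2 w) x)\<^sup>2 \<le> 2 * norm u * norm w" if x: "0 \<le> x" for x
  proof -
    have "(trace0 u)\<^sup>2 = - 2 * inner w u"
      using weak_derivative_by_parts[OF u u] by (simp add: power2_eq_square inner_commute)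
    moreover have "2 * (\<integral>y. indicator {0<..<x} y * (rep_l2 w y * rep_l2 u y) \<partial>half_line)
        = (trace0 u + prim (rep_l2 w) x)\<^sup>2 - (trace0 u)\<^sup>2"
      using integral_interval_by_parts[OF u u x] by (simp add: power2_eq_square mult.commute)
    ultimately have "(trace0 u + prim (rep_l2 w) x)\<^sup>2
        = 2 * ((\<integral>y. indicator {0<..<x} y * (rep_l2 w y * rep_l2 u y) \<partial>half_line) - inner w u)" by simp
    also have "(\<integral>y. indicator {0<..<x} y * (rep_l2 w y * rep_l2 u y) \<partial>half_line) - inner w u
        = (\<integral>y. indicator {0<..<x} y * (rep_l2 w y * rep_l2 u y) - rep_l2 w y * rep_l2 u y \<partial>half_line)"
    proof -
      have "integrable half_line (\<lambda>y. indicator {0<..<x} y * (rep_l2 w y * rep_l2 u y))"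
      proof (rule Bochner_Integration.integrable_bound[OF integrable_rep_mult[of w u]])
        show "AE y in half_line. norm (indicator {0<..<x} y * (rep_l2 w y * rep_l2 u y))
            \<le> norm (rep_l2 w y * rep_l2 u y)"
          by (auto simp: indicator_def)
      qed measurable
      then show ?thesis unfolding inner_l2_rep
        by (intro Bochner_Integration.integral_diff[symmetric] integrable_rep_mult)
    qed
    also have "\<dots> \<le> (\<integral>y. \<bar>rep_l2 w y * rep_l2 u y\<bar> \<partial>half_line)"
    proof (rule integral_mono')
      show "integrable half_line (\<lambda>y. \<bar>rep_l2 w y * rep_l2 u y\<bar>)"
        using integrable_rep_mult[of w u] by simp
    qed (auto simp: indicator_def)
    also have "\<dots> \<le> norm w * norm u" by (rule integral_abs_mult_le_norm)
    finally show ?thesis by (simp add: mult_ac)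
  qed
  have "AE x in half_line. x \<in> space half_line" by (rule AE_space)
  then show ?thesis
    using has_weak_derivative_trace[OF u] by eventually_elim (use g in auto)
qed

lemma weak_deriv_eq: "has_weak_derivative u w \<Longrightarrow> weak_deriv u = w"
  unfolding weak_deriv_def using weak_derivative_unique by blast

lemma H1_weak_deriv: "u \<in> H1 \<Longrightarrow> has_weak_derivative u (weak_deriv u)"
  unfolding H1_def using weak_deriv_eq by auto

lemma H1_add:
  assumes "u \<in> H1" "v \<in> H1"
  shows "u + v \<in> H1" "weak_deriv (u + v) = weak_deriv u + weak_deriv v"
    "trace0 (u + v) = trace0 u + trace0 v"
  using has_weak_derivative_add[OF H1_weak_deriv H1_weak_deriv, OF assms]
    trace0_add[OF H1_weak_deriv H1_weak_deriv, OF assms]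
  by (auto simp: H1_def weak_deriv_eq)

lemma H1_scaleR:
  assumes "u \<in> H1"
  shows "r *\<^sub>R u \<in> H1" "weak_deriv (r *\<^sub>R u) = r *\<^sub>R weak_deriv u" "trace0 (r *\<^sub>R u) = r * trace0 u"
  using has_weak_derivative_scaleR[OF H1_weak_deriv, OF assms] trace0_scaleR[OF H1_weak_deriv, OF assms]
  by (auto simp: H1_def weak_deriv_eq)

lemma trace0_sq_le:
  assumes "u \<in> H1"
  shows "(trace0 u)\<^sup>2 \<le> 2 * norm u * norm (weak_deriv u)"
proof -
  have "(trace0 u)\<^sup>2 = - 2 * inner (weak_deriv u) u"
    using weak_derivative_by_parts[OF H1_weak_deriv H1_weak_deriv, OF assms assms]
    by (simp add: power2_eq_square inner_commute)
  also have "\<dots> \<le> 2 * \<bar>inner (weak_deriv u) u\<bar>" by simp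
  also have "\<dots> \<le> 2 * (norm (weak_deriv u) * norm u)"
    by (intro mult_left_mono Cauchy_Schwarz_ineq2) simp
  finally show ?thesis by (simp add: mult_ac)
qed

lemma exp_l2_H1: "exp_l2 \<in> H1" "trace0 exp_l2 = 1"
proof -
  let ?w = "(-1) *\<^sub>R exp_l2"
  have "AE x in half_line. rep_l2 ?w x = - exp (- x)"
    using rep_scaleR[of "-1" exp_l2] rep_exp_l2 by eventually_elim simp
  then have p: "prim (rep_l2 ?w) x = prim (\<lambda>x. - exp (- x)) x" for x
    by (rule prim_cong_AE)
      (auto intro!: borel_measurable_half_line borel_measurable_continuous_onI continuous_intros)
  have "prim (\<lambda>x. - exp (- x)) x = exp (- x) - exp (- 0)" if "0 \<le> x" for x
    by (rule prim_deriv[OF _ _ that]) (auto intro!: derivative_eq_intros continuous_intros)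
  then have q: "1 + prim (rep_l2 ?w) x = exp (- x)" if "0 \<le> x" for x
    unfolding p using that by simp
  have "AE x in half_line. x \<in> space half_line" by (rule AE_space)
  then have *: "AE x in half_line. rep_l2 exp_l2 x = 1 + prim (rep_l2 ?w) x"
    using rep_exp_l2 by eventually_elim (subst q, auto)
  show "exp_l2 \<in> H1" using has_weak_derivative_prim[OF *] by (auto simp: H1_def)
  show "trace0 exp_l2 = 1" by (rule trace0_eq[OF *])
qed

lemma test_function_H1:
  assumes "test_function \<phi>"
  shows "abs_l2 \<phi> \<in> H1" "weak_deriv (abs_l2 \<phi>) = abs_l2 (deriv \<phi>)" "trace0 (abs_l2 \<phi>) = 0"
proof -
  obtain a b where ab: "0 < a" "a < b"
    and z: "\<And>x. x \<notin> {a<..<b} \<Longrightarrow> \<phi> x = 0" "\<And>x. x \<notin> {a<..<b} \<Longrightarrow> deriv \<phi> x = 0"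
    and d: "\<And>x. (\<phi> has_real_derivative deriv \<phi> x) (at x)" and c: "continuous_on UNIV (deriv \<phi>)"
    and sq: "square_integrable half_line \<phi>" "square_integrable half_line (deriv \<phi>)"
    by (rule test_functionE[OF assms]) (rule that; assumption)
  have p: "prim (rep_l2 (abs_l2 (deriv \<phi>))) x = prim (deriv \<phi>) x" for x
    by (rule prim_cong_AE[OF rep_abs[OF sq(2)]]) (use sq in \<open>auto simp: square_integrable_def\<close>)
  have "prim (deriv \<phi>) x = \<phi> x" if "0 \<le> x" for x
    using prim_deriv[OF d c that] z(1)[of 0] ab by simp
  moreover have "AE x in half_line. x \<in> space half_line" by (rule AE_space)
  ultimately have *: "AE x in half_line. rep_l2 (abs_l2 \<phi>) x = 0 + prim (rep_l2 (abs_l2 (deriv \<phi>))) x"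
    using rep_abs[OF sq(1)] by (elim AE_mp) (auto simp: p)
  show "abs_l2 \<phi> \<in> H1" "weak_deriv (abs_l2 \<phi>) = abs_l2 (deriv \<phi>)"
    using has_weak_derivative_prim[OF *] weak_deriv_eq by (auto simp: H1_def)
  show "trace0 (abs_l2 \<phi>) = 0" by (rule trace0_eq[OF *])
qed

section \<open>The operator on the star graph\<close>

text \<open>Riesz representation for a quadratic form, by Dirichlet's principle: \<open>u\<close>
  minimises \<open>J\<close>. As V is a mere subset with the norm of D v, completeness enters
  through closedness of \<open>D\<close> and coercivity.\<close>

lemma Riesz_minimizer:
  fixes V :: "'a::{real_inner, banach} set" and D :: "'a \<Rightarrow> 'b::{real_inner, banach}"
  assumes V: "0 \<in> V" "\<And>u v. u \<in> V \<Longrightarrow> v \<in> V \<Longrightarrow> u + v \<in> V" "\<And>r u. u \<in> V \<Longrightarrow> r *\<^sub>R u \<in> V"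
    and D: "\<And>u v. u \<in> V \<Longrightarrow> v \<in> V \<Longrightarrow> D (u + v) = D u + D v" "\<And>r u. u \<in> V \<Longrightarrow> D (r *\<^sub>R u) = r *\<^sub>R D u"
    and closed: "\<And>s u d. (\<And>n. s n \<in> V) \<Longrightarrow> s \<longlonglongrightarrow> u \<Longrightarrow> (\<lambda>n. D (s n)) \<longlonglongrightarrow> d \<Longrightarrow> u \<in> V \<and> D u = d"
    and coercive: "\<And>v. v \<in> V \<Longrightarrow> norm v \<le> K * norm (D v)"
  obtains u where "u \<in> V" "\<And>v. v \<in> V \<Longrightarrow> inner (D u) (D v) = inner f v"
proof -
  define J where "J v = (norm (D v))\<^sup>2 / 2 - inner f v" for v
  have bdd: "bdd_below (J ` V)"
  proof (rule bdd_belowI)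
    fix y assume "y \<in> J ` V"
    then obtain v where v: "v \<in> V" "y = J v" by blast
    have "inner f v \<le> norm f * norm v" by (rule norm_cauchy_schwarz)
    also have "\<dots> \<le> norm f * (K * norm (D v))" by (intro mult_left_mono coercive v) simp
    finally have "J v \<ge> (norm (D v))\<^sup>2 / 2 - (norm f * K) * norm (D v)" by (simp add: J_def)
    \<comment> \<open>Completing the square: d^2 / 2 - k d is at least - k^2 / 2.\<close>
    moreover have "0 \<le> (norm (D v) - norm f * K)\<^sup>2" by simp
    ultimately show "- (norm f * K)\<^sup>2 / 2 \<le> y"
      by (simp add: v power2_diff algebra_simps)
  qed
  define m where "m = Inf (J ` V)"
  have m: "m \<le> J v" if "v \<in> V" for v
    unfolding m_def by (rule cInf_lower[OF imageI[OF that] bdd])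
  have "\<exists>v. v \<in> V \<and> J v < m + 1 / real (Suc n)" for n
  proof -
    have "Inf (J ` V) < m + 1 / real (Suc n)" by (simp add: m_def)
    then show ?thesis using cInf_lessD[of "J ` V"] V(1) by blast
  qed
  then obtain s where s: "\<And>n. s n \<in> V" "\<And>n. J (s n) < m + 1 / real (Suc n)" by metis
  \<comment> \<open>The parallelogram identity at the midpoint, where \<open>J\<close> is at least
    \<open>m\<close>: near-minimisers have close images under \<open>D\<close>.\<close>
  have par: "(norm (D (u - v)))\<^sup>2 / 4 \<le> J u + J v - 2 * m" and diff: "u - v \<in> V"
    and D_diff: "D (u - v) = D u - D v" if "u \<in> V" "v \<in> V" for u v
  proof -
    have "u - v = u + (-1) *\<^sub>R v" by simp
    then show "u - v \<in> V" using V that by metis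
    have "- v \<in> V" using V(3)[OF that(2), of "-1"] by simp
    from D(1)[OF that(1) this] show Dd: "D (u - v) = D u - D v"
      using D(2)[OF that(2), of "-1"] by simp
    have mid: "(1/2) *\<^sub>R (u + v) \<in> V" using V that by blast
    have "D ((1/2) *\<^sub>R (u + v)) = (1/2) *\<^sub>R (D u + D v)" using D V that by simp
    then have "J ((1/2) *\<^sub>R (u + v)) = (norm (D u + D v))\<^sup>2 / 8 - inner f (u + v) / 2"
      by (simp add: J_def power_mult_distrib power_divide)
    with m[OF mid] show "(norm (D (u - v)))\<^sup>2 / 4 \<le> J u + J v - 2 * m"
      unfolding Dd J_def by (simp add: power2_norm_eq_inner inner_add inner_diff inner_commute field_simps)
  qed
  have "Cauchy (\<lambda>n. D (s n))"
  proof (rule metric_CauchyI)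
    fix e :: real assume e: "e > 0"
    obtain N where N: "8 / e\<^sup>2 < real N" using reals_Archimedean2 by blast
    have "dist (D (s i)) (D (s j)) < e" if "i \<ge> N" "j \<ge> N" for i j
    proof -
      have small: "1 / real (Suc i) < e\<^sup>2 / 8" if "i \<ge> N" for i
      proof -
        have "8 / e\<^sup>2 < real (Suc i)" using N that by simp
        then show ?thesis using e by (simp add: field_simps)
      qed
      have "(norm (D (s i) - D (s j)))\<^sup>2 / 4 \<le> J (s i) + J (s j) - 2 * m"
        using par[OF s(1) s(1)] D_diff[OF s(1) s(1)] by metis
      also have "\<dots> < e\<^sup>2 / 4"
        using s(2)[of i] s(2)[of j] small[OF that(1)] small[OF that(2)] by linarith
      finally show ?thesis
        unfolding dist_norm using e by (simp add: power_less_imp_less_base)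
    qed
    then show "\<exists>M. \<forall>i\<ge>M. \<forall>j\<ge>M. dist (D (s i)) (D (s j)) < e" by blast
  qed
  note CD = this
  have "Cauchy s"
  proof (rule metric_CauchyI)
    fix e :: real assume e: "e > 0"
    then have "e / (\<bar>K\<bar> + 1) > 0" by (simp add: add_nonneg_pos)
    then obtain M where M: "\<And>i j. i \<ge> M \<Longrightarrow> j \<ge> M \<Longrightarrow> dist (D (s i)) (D (s j)) < e / (\<bar>K\<bar> + 1)"
      using CD unfolding Cauchy_def by meson
    have "dist (s i) (s j) < e" if "i \<ge> M" "j \<ge> M" for i j
    proof -
      have "dist (s i) (s j) \<le> K * norm (D (s i) - D (s j))"
        using coercive[OF diff[OF s(1) s(1)], of i j] D_diff[OF s(1) s(1), of i j]
        by (simp add: dist_norm)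
      also have "\<dots> \<le> (\<bar>K\<bar> + 1) * norm (D (s i) - D (s j))" by (intro mult_right_mono) auto
      also have "\<dots> < e"
        using M[OF that] by (simp add: dist_norm pos_less_divide_eq add_nonneg_pos mult.commute)
      finally show ?thesis .
    qed
    then show "\<exists>M. \<forall>i\<ge>M. \<forall>j\<ge>M. dist (s i) (s j) < e" by blast
  qed
  then obtain u where u: "s \<longlonglongrightarrow> u" using Cauchy_convergent convergent_def by blast
  obtain d where d: "(\<lambda>n. D (s n)) \<longlonglongrightarrow> d" using CD Cauchy_convergent convergent_def by blast
  have uV: "u \<in> V" and Du: "D u = d" using closed[OF s(1) u d] by auto
  have Ju: "J u \<le> m"
  proof (rule LIMSEQ_le)
    show "(\<lambda>n. J (s n)) \<longlonglongrightarrow> J u"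
      unfolding J_def Du by (intro tendsto_intros u d) simp
    have "(\<lambda>n. m + 1 / real (Suc n)) \<longlonglongrightarrow> m + 0"
      by (intro tendsto_intros LIMSEQ_Suc[OF lim_1_over_n])
    then show "(\<lambda>n. m + 1 / real (Suc n)) \<longlonglongrightarrow> m" by simp
    show "\<exists>N. \<forall>n\<ge>N. J (s n) \<le> m + 1 / real (Suc n)" using s(2) less_imp_le by blast
  qed
  show thesis
  proof (rule that[OF uV])
    fix v assume v: "v \<in> V"
    define c where "c = inner (D u) (D v) - inner f v"
    define q where "q = (norm (D v))\<^sup>2"
    have q: "q \<ge> 0" by (simp add: q_def)
    have var: "0 \<le> t * c + t\<^sup>2 * q / 2" for t
    proof -
      have "u + t *\<^sub>R v \<in> V" using V uV v by blast
      then have "J u \<le> J (u + t *\<^sub>R v)" using m Ju order_trans by blast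
      moreover have "D (u + t *\<^sub>R v) = D u + t *\<^sub>R D v" using D V uV v by simp
      moreover have "(norm (D u + t *\<^sub>R D v))\<^sup>2
          = (norm (D u))\<^sup>2 + 2 * (t * inner (D u) (D v)) + t\<^sup>2 * (norm (D v))\<^sup>2"
        by (simp only: power2_norm_eq_inner)
          (simp add: inner_add inner_commute power2_eq_square algebra_simps)
      ultimately show ?thesis
        unfolding J_def c_def q_def by (simp add: inner_add field_simps)
    qed
    \<comment> \<open>At this t the linear term wins unless c = 0; with q + 1 instead of q the case
      q = 0 is covered.\<close>
    have "0 \<le> (- c / (q + 1)) * c + (- c / (q + 1))\<^sup>2 * q / 2" by (rule var)
    also have "\<dots> = - (c\<^sup>2 * (q + 2)) / (2 * (q + 1)\<^sup>2)"
      using q by (simp add: power2_eq_square divide_simps add_nonneg_eq_0_iff) (simp add: algebra_simps)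
    finally have "c\<^sup>2 * (q + 2) \<le> 0"
      using q by (simp add: divide_le_0_iff zero_le_divide_iff)
    then have "c = 0" using q by (simp add: mult_le_0_iff)
    then show "inner (D u) (D v) = inner f v" by (simp add: c_def)
  qed
qed

section \<open>The quadratic form and boundary conditions on the star graph\<close>

locale star_graph =
  fixes c a1 a2 :: real
  assumes c: "0 < c" and a1: "0 < a1" and a12: "a1 < a2"
begin

lemma a2: "0 < a2" using a1 a12 by simp

definition V :: "H set" where
  "V = {(v1, v2). v1 \<in> H1 \<and> v2 \<in> H1 \<and> trace0 v1 = trace0 v2}"

text \<open>The quadratic form of \<open>A\<close> is \<open>(norm (D v))\<^sup>2\<close>.\<close>

definition D :: "H \<Rightarrow> H \<times> H" where
  "D = (\<lambda>(v1, v2). ((c *\<^sub>R weak_deriv v1, c *\<^sub>R weak_deriv v2), (sqrt a1 *\<^sub>R v1, sqrt a2 *\<^sub>R v2)))"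

abbreviation A :: "H \<Rightarrow> H" where "A \<equiv> A_fun c a1 a2"

text \<open>Weak derivatives pass to limits, and so does the trace, since its square is bounded by
  the norms of the function and its derivative. The coupling at the vertex therefore
  survives.\<close>

lemma D_closed:
  assumes s: "\<And>n. s n \<in> V" and lim: "s \<longlonglongrightarrow> u" "(\<lambda>n. D (s n)) \<longlonglongrightarrow> d"
  shows "u \<in> V \<and> D u = d"
proof -
  define s1 s2 where "s1 n = fst (s n)" and "s2 n = snd (s n)" for n
  have sn: "s n = (s1 n, s2 n)" for n by (simp add: s1_def s2_def)
  have sV: "s1 n \<in> H1" "s2 n \<in> H1" "trace0 (s1 n) = trace0 (s2 n)" for n
    using s[of n] by (simp_all add: sn V_def)
  obtain u1 u2 where u: "u = (u1, u2)" by (cases u)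
  obtain d1 d2 d3 d4 where d: "d = ((d1, d2), (d3, d4))" by (cases d) auto
  have l: "s1 \<longlonglongrightarrow> u1" "s2 \<longlonglongrightarrow> u2"
    using tendsto_fst[OF lim(1)] tendsto_snd[OF lim(1)] by (simp_all add: u s1_def[abs_def] s2_def[abs_def])
  have ld: "(\<lambda>n. c *\<^sub>R weak_deriv (s1 n)) \<longlonglongrightarrow> d1" "(\<lambda>n. c *\<^sub>R weak_deriv (s2 n)) \<longlonglongrightarrow> d2"
    "(\<lambda>n. sqrt a1 *\<^sub>R s1 n) \<longlonglongrightarrow> d3" "(\<lambda>n. sqrt a2 *\<^sub>R s2 n) \<longlonglongrightarrow> d4"
    using tendsto_fst[OF tendsto_fst[OF lim(2)]] tendsto_snd[OF tendsto_fst[OF lim(2)]]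
      tendsto_fst[OF tendsto_snd[OF lim(2)]] tendsto_snd[OF tendsto_snd[OF lim(2)]]
    by (simp_all add: sn D_def d)
  have comp: "u' \<in> H1 \<and> c *\<^sub>R weak_deriv u' = d' \<and> (\<lambda>n. trace0 (s' n)) \<longlonglongrightarrow> trace0 u'"
    if s': "\<And>n. s' n \<in> H1" and l: "s' \<longlonglongrightarrow> u'" and ld: "(\<lambda>n. c *\<^sub>R weak_deriv (s' n)) \<longlonglongrightarrow> d'" for s' u' d'
  proof -
    have "(\<lambda>n. (1 / c) *\<^sub>R c *\<^sub>R weak_deriv (s' n)) \<longlonglongrightarrow> (1 / c) *\<^sub>R d'"
      by (intro tendsto_intros ld)
    then have lw: "(\<lambda>n. weak_deriv (s' n)) \<longlonglongrightarrow> (1 / c) *\<^sub>R d'" using c by simp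
    have wd: "has_weak_derivative u' ((1 / c) *\<^sub>R d')"
      by (rule has_weak_derivative_LIMSEQ[OF H1_weak_deriv[OF s'] l lw])
    then have u': "u' \<in> H1" "weak_deriv u' = (1 / c) *\<^sub>R d'" by (auto simp: H1_def weak_deriv_eq)
    have "(\<lambda>n. trace0 (s' n) - trace0 u') \<longlonglongrightarrow> 0"
    proof (rule Lim_null_comparison)
      have "\<bar>trace0 (s' n) - trace0 u'\<bar> \<le> sqrt (2 * norm (s' n - u') * norm (weak_deriv (s' n) - weak_deriv u'))" for n
      proof -
        have "s' n - u' = s' n + (-1) *\<^sub>R u'" by simp
        then have "s' n - u' \<in> H1" "trace0 (s' n - u') = trace0 (s' n) - trace0 u'"
          "weak_deriv (s' n - u') = weak_deriv (s' n) - weak_deriv u'"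
          using H1_add[OF s' H1_scaleR(1)[OF u'(1)], of n "-1"] H1_scaleR[OF u'(1), of "-1"] by simp_all
        then show ?thesis
          using trace0_sq_le[of "s' n - u'"] real_sqrt_le_mono by fastforce
      qed
      then show "\<forall>\<^sub>F n in sequentially. norm (trace0 (s' n) - trace0 u')
          \<le> sqrt (2 * norm (s' n - u') * norm (weak_deriv (s' n) - weak_deriv u'))"
        by (simp add: always_eventually)
      have "(\<lambda>n. sqrt (2 * norm (s' n - u') * norm (weak_deriv (s' n) - weak_deriv u')))
          \<longlonglongrightarrow> sqrt (2 * norm (u' - u') * norm (weak_deriv u' - weak_deriv u'))"
        using lw by (intro tendsto_intros l) (simp add: u'(2))
      then show "(\<lambda>n. sqrt (2 * norm (s' n - u') * norm (weak_deriv (s' n) - weak_deriv u'))) \<longlonglongrightarrow> 0"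
        by simp
    qed
    then show ?thesis using u' c by (simp add: LIM_zero_iff)
  qed
  note 1 = comp[OF sV(1) l(1) ld(1)] and 2 = comp[OF sV(2) l(2) ld(2)]
  have "trace0 u1 = trace0 u2"
    using 1 2 sV(3) LIMSEQ_unique[of "\<lambda>n. trace0 (s1 n)" "trace0 u1" "trace0 u2"] by simp
  moreover have "sqrt a1 *\<^sub>R u1 = d3" "sqrt a2 *\<^sub>R u2 = d4"
    using LIMSEQ_unique[OF tendsto_scaleR[OF tendsto_const l(1)] ld(3)]
      LIMSEQ_unique[OF tendsto_scaleR[OF tendsto_const l(2)] ld(4)] by auto
  ultimately show ?thesis using 1 2 by (simp add: u d V_def D_def)
qed

lemma V_zero: "0 \<in> V"
proof -
  have "0 = 0 *\<^sub>R exp_l2" by simp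
  then have "0 \<in> H1" using H1_scaleR(1)[OF exp_l2_H1(1)] by metis
  then show ?thesis by (simp add: V_def zero_prod_def)
qed

lemma V_add: "u \<in> V \<Longrightarrow> v \<in> V \<Longrightarrow> u + v \<in> V"
  and V_scaleR: "u \<in> V \<Longrightarrow> r *\<^sub>R u \<in> V"
  and D_add: "u \<in> V \<Longrightarrow> v \<in> V \<Longrightarrow> D (u + v) = D u + D v"
  and D_scaleR: "u \<in> V \<Longrightarrow> D (r *\<^sub>R u) = r *\<^sub>R D u"
  by (auto simp: V_def D_def H1_add H1_scaleR algebra_simps split: prod.splits)

lemma norm_D: "(norm (D (v1, v2)))\<^sup>2 = c\<^sup>2 * ((norm (weak_deriv v1))\<^sup>2 + (norm (weak_deriv v2))\<^sup>2)
    + a1 * (norm v1)\<^sup>2 + a2 * (norm v2)\<^sup>2"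
  using a1 a2 by (simp add: D_def norm_Pair power_mult_distrib algebra_simps)

lemma norm_le_D: "norm v \<le> 1 / sqrt a1 * norm (D v)"
proof -
  obtain v1 v2 where v: "v = (v1, v2)" by (cases v)
  have "a1 * (norm v2)\<^sup>2 \<le> a2 * (norm v2)\<^sup>2" using a12 by (intro mult_right_mono) auto
  moreover have "0 \<le> c\<^sup>2 * ((norm (weak_deriv v1))\<^sup>2 + (norm (weak_deriv v2))\<^sup>2)" by simp
  moreover have "(sqrt a1 * norm v)\<^sup>2 = a1 * (norm v1)\<^sup>2 + a1 * (norm v2)\<^sup>2"
    using a1 by (simp add: v norm_Pair power_mult_distrib algebra_simps)
  ultimately have "(sqrt a1 * norm v)\<^sup>2 \<le> (norm (D v))\<^sup>2"
    unfolding v norm_D by linarith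
  then have "sqrt a1 * norm v \<le> norm (D v)" by (rule power2_le_imp_le) simp
  then show ?thesis using a1 by (simp add: field_simps)
qed

text \<open>\<open>H1_bounded\<close> with norm w <= N / sqrt a1 and norm of the derivative <= N /
  c, where N is the norm of D; a1 < a2 makes the first bound valid on both edges.\<close>

lemma AE_bounded_V:
  assumes "(v1, v2) \<in> V"
  shows "AE x in half_line. \<bar>rep_l2 v1 x\<bar> \<le> sqrt (2 / (c * sqrt a1)) * norm (D (v1, v2))"
    and "AE x in half_line. \<bar>rep_l2 v2 x\<bar> \<le> sqrt (2 / (c * sqrt a1)) * norm (D (v1, v2))"
proof -
  let ?N = "norm (D (v1, v2))"
  have b: "AE x in half_line. \<bar>rep_l2 w x\<bar> \<le> sqrt (2 / (c * sqrt a1)) * ?N"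
    if w: "w \<in> H1" and le: "a1 * (norm w)\<^sup>2 \<le> ?N\<^sup>2" "c\<^sup>2 * (norm (weak_deriv w))\<^sup>2 \<le> ?N\<^sup>2" for w
  proof -
    have "(sqrt a1 * norm w)\<^sup>2 \<le> ?N\<^sup>2" "(c * norm (weak_deriv w))\<^sup>2 \<le> ?N\<^sup>2"
      using le a1 by (simp_all add: power_mult_distrib)
    then have "sqrt a1 * norm w \<le> ?N" "c * norm (weak_deriv w) \<le> ?N"
      by (auto elim: power2_le_imp_le)
    then have "norm w \<le> ?N / sqrt a1" "norm (weak_deriv w) \<le> ?N / c"
      using a1 c by (simp_all add: field_simps)
    then have "2 * norm w * norm (weak_deriv w) \<le> 2 * (?N / sqrt a1) * (?N / c)"
      using a1 by (intro mult_mono) auto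
    also have "\<dots> = (sqrt (2 / (c * sqrt a1)) * ?N)\<^sup>2"
    proof -
      have "(sqrt (2 / (c * sqrt a1)) * ?N)\<^sup>2 = 2 / (c * sqrt a1) * ?N\<^sup>2"
        unfolding power_mult_distrib by (subst real_sqrt_pow2) (use a1 c in auto)
      then show ?thesis by (simp only:) (simp add: power2_eq_square mult_ac)
    qed
    finally have le: "2 * norm w * norm (weak_deriv w) \<le> (sqrt (2 / (c * sqrt a1)) * ?N)\<^sup>2" .
    show ?thesis
      using H1_bounded[OF H1_weak_deriv[OF w]]
    proof eventually_elim
      case (elim x)
      then have "(rep_l2 w x)\<^sup>2 \<le> (sqrt (2 / (c * sqrt a1)) * ?N)\<^sup>2" using le by linarith
      moreover have "0 \<le> sqrt (2 / (c * sqrt a1)) * ?N" using a1 c by simp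
      ultimately show ?case by (metis abs_le_square_iff abs_of_nonneg)
    qed
  qed
  have nn: "0 \<le> c\<^sup>2 * (norm (weak_deriv v))\<^sup>2" "0 \<le> a1 * (norm v)\<^sup>2" "a1 * (norm v)\<^sup>2 \<le> a2 * (norm v)\<^sup>2" for v
    using a1 a12 by (auto intro: mult_right_mono)
  have v: "v1 \<in> H1" "v2 \<in> H1" using assms by (auto simp: V_def)
  note N = norm_D[of v1 v2, unfolded distrib_left]
  show "AE x in half_line. \<bar>rep_l2 v1 x\<bar> \<le> sqrt (2 / (c * sqrt a1)) * ?N"
    by (rule b[OF v(1)]) (use N nn[of v1] nn[of v2] in linarith)+
  show "AE x in half_line. \<bar>rep_l2 v2 x\<bar> \<le> sqrt (2 / (c * sqrt a1)) * ?N"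
    by (rule b[OF v(2)]) (use N nn[of v1] nn[of v2] in linarith)+
qed

lemma dom_A_subset_V: "dom_A \<subseteq> V"
  by (auto simp: dom_A_def V_def H2_def)

lemma inner_D: "inner (D (u1, u2)) (D (v1, v2)) = c\<^sup>2 * (inner (weak_deriv u1) (weak_deriv v1)
    + inner (weak_deriv u2) (weak_deriv v2)) + a1 * inner u1 v1 + a2 * inner u2 v2"
  using a1 a2 by (simp add: D_def power2_eq_square algebra_simps) (simp add: mult.assoc[symmetric])

text \<open>The boundary terms of both edges share the factor \<open>trace0 v1\<close>. The identity
  is used in both directions: the derivative condition at the vertex makes the right-hand side
  vanish, and its vanishing for one non-zero trace implies the condition.\<close>

lemma inner_A_minus_inner_D:
  assumes "(v1, v2) \<in> V" "u1 \<in> H2" "u2 \<in> H2"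
  shows "inner (D (u1, u2)) (D (v1, v2)) - inner (A (u1, u2)) (v1, v2)
    = - c\<^sup>2 * (trace0 (weak_deriv u1) + trace0 (weak_deriv u2)) * trace0 v1"
proof -
  have "inner (weak_deriv (weak_deriv u)) v + inner (weak_deriv u) (weak_deriv v)
      = - (trace0 (weak_deriv u) * trace0 v)" if "u \<in> H2" "v \<in> H1" for u v
    using that by (intro weak_derivative_by_parts H1_weak_deriv) (auto simp: H2_def)
  from this[of u1 v1] this[of u2 v2] have e:
    "inner (weak_deriv (weak_deriv u1)) v1 + inner (weak_deriv u1) (weak_deriv v1) = - (trace0 (weak_deriv u1) * trace0 v1)"
    "inner (weak_deriv (weak_deriv u2)) v2 + inner (weak_deriv u2) (weak_deriv v2) = - (trace0 (weak_deriv u2) * trace0 v1)"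
    using assms by (auto simp: V_def)
  have "inner (D (u1, u2)) (D (v1, v2)) - inner (A (u1, u2)) (v1, v2)
      = c\<^sup>2 * ((inner (weak_deriv (weak_deriv u1)) v1 + inner (weak_deriv u1) (weak_deriv v1))
        + (inner (weak_deriv (weak_deriv u2)) v2 + inner (weak_deriv u2) (weak_deriv v2)))"
    unfolding inner_D A_fun_def by (simp add: inner_add_left algebra_simps)
  then show ?thesis unfolding e by (simp add: algebra_simps)
qed

lemma inner_A:
  assumes "u \<in> dom_A" "v \<in> V"
  shows "inner (A u) v = inner (D u) (D v)"
  using inner_A_minus_inner_D[of "fst v" "snd v" "fst u" "snd u"] assms
  by (auto simp: dom_A_def)

text \<open>The Riesz minimiser is a weak solution. A test function on one edge paired with 0 on the
  other yields the second weak derivative there, hence \<open>H2\<close> regularity and the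
  equation.\<close>

lemma A_surjective: obtains u where "u \<in> dom_A" "A u = f"
proof -
  obtain u where u: "u \<in> V" "\<And>v. v \<in> V \<Longrightarrow> inner (D u) (D v) = inner f v"
    by (rule Riesz_minimizer[OF V_zero V_add V_scaleR D_add D_scaleR D_closed norm_le_D]) (assumption | rule that)+
  obtain u1 u2 where u12: "u = (u1, u2)" by (cases u)
  obtain f1 f2 where f12: "f = (f1, f2)" by (cases f)
  have zero: "0 \<in> H1" "weak_deriv 0 = 0" "trace0 0 = 0"
    using H1_scaleR[OF exp_l2_H1(1), of 0] by simp_all
  have "has_weak_derivative (weak_deriv u1) ((1 / c\<^sup>2) *\<^sub>R (a1 *\<^sub>R u1 - f1))"
    unfolding has_weak_derivative_iff_inner
  proof (intro allI impI)
    fix \<phi> assume \<phi>: "test_function \<phi>"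
    have "(abs_l2 \<phi>, 0) \<in> V" using test_function_H1[OF \<phi>] zero by (simp add: V_def)
    from u(2)[OF this] have "c\<^sup>2 * inner (weak_deriv u1) (abs_l2 (deriv \<phi>)) = inner f1 (abs_l2 \<phi>) - a1 * inner u1 (abs_l2 \<phi>)"
      by (simp add: u12 f12 inner_D test_function_H1[OF \<phi>] zero)
    then show "inner (weak_deriv u1) (abs_l2 (deriv \<phi>)) = - inner ((1 / c\<^sup>2) *\<^sub>R (a1 *\<^sub>R u1 - f1)) (abs_l2 \<phi>)"
      using c by (simp add: inner_diff_left field_simps)
  qed
  then have 1: "u1 \<in> H2" "weak_deriv (weak_deriv u1) = (1 / c\<^sup>2) *\<^sub>R (a1 *\<^sub>R u1 - f1)"
    using u(1) u12 weak_deriv_eq by (auto simp: V_def H2_def H1_def)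
  have "has_weak_derivative (weak_deriv u2) ((1 / c\<^sup>2) *\<^sub>R (a2 *\<^sub>R u2 - f2))"
    unfolding has_weak_derivative_iff_inner
  proof (intro allI impI)
    fix \<phi> assume \<phi>: "test_function \<phi>"
    have "(0, abs_l2 \<phi>) \<in> V" using test_function_H1[OF \<phi>] zero by (simp add: V_def)
    from u(2)[OF this] have "c\<^sup>2 * inner (weak_deriv u2) (abs_l2 (deriv \<phi>)) = inner f2 (abs_l2 \<phi>) - a2 * inner u2 (abs_l2 \<phi>)"
      by (simp add: u12 f12 inner_D test_function_H1[OF \<phi>] zero)
    then show "inner (weak_deriv u2) (abs_l2 (deriv \<phi>)) = - inner ((1 / c\<^sup>2) *\<^sub>R (a2 *\<^sub>R u2 - f2)) (abs_l2 \<phi>)"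
      using c by (simp add: inner_diff_left field_simps)
  qed
  then have 2: "u2 \<in> H2" "weak_deriv (weak_deriv u2) = (1 / c\<^sup>2) *\<^sub>R (a2 *\<^sub>R u2 - f2)"
    using u(1) u12 weak_deriv_eq by (auto simp: V_def H2_def H1_def)
  have Au: "A u = f" using c by (simp add: u12 f12 A_fun_def 1 2)
  \<comment> \<open>Test functions see only the interior of the edges; an element of V with trace 1
    detects the sum of the derivatives at the vertex.\<close>
  have e: "(exp_l2, exp_l2) \<in> V" using exp_l2_H1 by (simp add: V_def)
  have "- c\<^sup>2 * (trace0 (weak_deriv u1) + trace0 (weak_deriv u2)) * trace0 exp_l2 = 0"
    using inner_A_minus_inner_D[OF e 1(1) 2(1)] u(2)[OF e] Au by (simp add: u12)
  then have "trace0 (weak_deriv u1) + trace0 (weak_deriv u2) = 0"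
    using c exp_l2_H1 by simp
  then have "u \<in> dom_A" using 1 2 u(1) by (simp add: u12 dom_A_def V_def)
  then show thesis using that Au by blast
qed

lemma dom_A_add: "u \<in> dom_A \<Longrightarrow> v \<in> dom_A \<Longrightarrow> u + v \<in> dom_A"
  and dom_A_scaleR: "u \<in> dom_A \<Longrightarrow> r *\<^sub>R u \<in> dom_A"
  and A_add: "u \<in> dom_A \<Longrightarrow> v \<in> dom_A \<Longrightarrow> A (u + v) = A u + A v"
  and A_scaleR: "u \<in> dom_A \<Longrightarrow> A (r *\<^sub>R u) = r *\<^sub>R A u"
  by (auto simp: dom_A_def H2_def H1_add H1_scaleR A_fun_def algebra_simps
      simp flip: distrib_left split: prod.splits)

end

section \<open>Truncated nonlinearities\<close>

text \<open>A form suited to induction on k. The potential is truncated at class C3, so that its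
  derivative is of class C2.\<close>

primrec Ck :: "nat \<Rightarrow> (real \<Rightarrow> real) \<Rightarrow> bool" where
  "Ck 0 f \<longleftrightarrow> continuous_on UNIV f"
| "Ck (Suc k) f \<longleftrightarrow> (\<exists>f'. (\<forall>x. (f has_real_derivative f' x) (at x)) \<and> Ck k f')"

lemma Ck_Suc_imp: "Ck (Suc k) f \<Longrightarrow> Ck k f"
proof (induction k arbitrary: f)
  case 0
  then show ?case by (auto intro: DERIV_continuous_on has_field_derivative_at_within)
next
  case (Suc k)
  then show ?case by (metis Ck.simps(2))
qed

lemma Ck_add: "Ck k f \<Longrightarrow> Ck k g \<Longrightarrow> Ck k (\<lambda>x. f x + g x)"
proof (induction k arbitrary: f g)
  case (Suc k)
  then obtain f' g' where "\<And>x. (f has_real_derivative f' x) (at x)" "Ck k f'"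
    "\<And>x. (g has_real_derivative g' x) (at x)" "Ck k g'" by auto
  then show ?case
    using Suc.IH[of f' g'] by (auto intro!: exI[of _ "\<lambda>x. f' x + g' x"] derivative_intros)
qed (auto intro: continuous_intros)

lemma Ck_mult: "Ck k f \<Longrightarrow> Ck k g \<Longrightarrow> Ck k (\<lambda>x. f x * g x)"
proof (induction k arbitrary: f g)
  case (Suc k)
  then obtain f' g' where f': "\<And>x. (f has_real_derivative f' x) (at x)" "Ck k f'"
    and g': "\<And>x. (g has_real_derivative g' x) (at x)" "Ck k g'" by auto
  have "Ck k (\<lambda>x. f' x * g x + g' x * f x)"
    by (rule Ck_add[OF Suc.IH[OF f'(2) Ck_Suc_imp[OF Suc.prems(2)]] Suc.IH[OF g'(2) Ck_Suc_imp[OF Suc.prems(1)]]])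
  moreover have "((\<lambda>x. f x * g x) has_real_derivative f' x * g x + g' x * f x) (at x)" for x
    by (rule DERIV_mult[OF f'(1) g'(1)])
  ultimately show ?case
    unfolding Ck.simps(2) by (intro exI[of _ "\<lambda>x. f' x * g x + g' x * f x"] conjI allI)
qed (auto intro: continuous_intros)

lemma Ck_compose: "Ck k f \<Longrightarrow> Ck k g \<Longrightarrow> Ck k (\<lambda>x. f (g x))"
proof (induction k arbitrary: f g)
  case 0
  then show ?case by (auto intro: continuous_on_compose2)
next
  case (Suc k)
  then obtain f' g' where f': "\<And>x. (f has_real_derivative f' x) (at x)" "Ck k f'"
    and g': "\<And>x. (g has_real_derivative g' x) (at x)" "Ck k g'" by auto
  have "Ck k (\<lambda>x. f' (g x) * g' x)"
    by (rule Ck_mult[OF Suc.IH[OF f'(2) Ck_Suc_imp[OF Suc.prems(2)]] g'(2)])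
  moreover have "((\<lambda>x. f (g x)) has_real_derivative f' (g x) * g' x) (at x)" for x
    by (rule DERIV_chain2[OF f'(1) g'(1)])
  ultimately show ?case
    unfolding Ck.simps(2) by (intro exI[of _ "\<lambda>x. f' (g x) * g' x"] conjI allI)
qed

lemma Ck_const: "Ck k (\<lambda>x. a)"
proof (induction k arbitrary: a)
  case (Suc k)
  then show ?case unfolding Ck.simps(2) by (intro exI[of _ "\<lambda>x. 0"]) simp
qed simp

lemma Ck_ident: "Ck k (\<lambda>x. x)"
proof (cases k)
  case (Suc j)
  have "((\<lambda>x. x) has_real_derivative 1) (at x)" for x :: real by simp
  then show ?thesis unfolding Suc Ck.simps(2) using Ck_const[of j 1] by (intro exI[of _ "\<lambda>x. 1"]) simp
qed simp

section \<open>A cutoff function of class C3\<close>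

definition ppow :: "nat \<Rightarrow> real \<Rightarrow> real" where "ppow n x = (max 0 x) ^ n"

lemma ppow_has_derivative: "(ppow (Suc (Suc n)) has_real_derivative real (Suc (Suc n)) * ppow (Suc n) x) (at x)"
proof -
  consider "x > 0" | "x < 0" | "x = 0" by linarith
  then show ?thesis
  proof cases
    case 1
    have "((\<lambda>x. x ^ Suc (Suc n)) has_real_derivative real (Suc (Suc n)) * x ^ Suc n) (at x)"
      using DERIV_pow[of "Suc (Suc n)" x UNIV] by simp
    then have "(ppow (Suc (Suc n)) has_real_derivative real (Suc (Suc n)) * x ^ Suc n) (at x)"
      by (rule has_field_derivative_transform_within_open[of _ _ _ "{0<..}"])
        (use 1 in \<open>auto simp: ppow_def\<close>)
    then show ?thesis using 1 by (simp add: ppow_def max_def)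
  next
    case 2
    have "((\<lambda>x. 0) has_real_derivative 0) (at x)" by simp
    then have "(ppow (Suc (Suc n)) has_real_derivative 0) (at x)"
      by (rule has_field_derivative_transform_within_open[of _ _ _ "{..<0}"])
        (use 2 in \<open>auto simp: ppow_def\<close>)
    then show ?thesis using 2 by (simp add: ppow_def)
  next
    case 3
    have "((\<lambda>h. ppow (Suc (Suc n)) h / h) \<longlongrightarrow> 0) (at 0)"
    proof (rule Lim_null_comparison)
      show "\<forall>\<^sub>F h in at 0. norm (ppow (Suc (Suc n)) h / h) \<le> \<bar>h\<bar> ^ Suc n"
      proof (rule always_eventually, rule allI)
        fix h :: real
        show "norm (ppow (Suc (Suc n)) h / h) \<le> \<bar>h\<bar> ^ Suc n"
        proof (cases "h > 0")
          case False
          then have "ppow (Suc (Suc n)) h = 0" by (simp add: ppow_def max_def)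
          then show ?thesis by (simp del: power_Suc)
        qed (simp add: ppow_def max_def)
      qed
      have "((\<lambda>h. \<bar>h\<bar> ^ Suc n) \<longlongrightarrow> \<bar>0\<bar> ^ Suc n) (at (0::real))" by (intro tendsto_intros)
      then show "((\<lambda>h::real. \<bar>h\<bar> ^ Suc n) \<longlongrightarrow> 0) (at 0)" by simp
    qed
    then show ?thesis using 3 by (simp add: DERIV_def ppow_def)
  qed
qed

lemma Ck_ppow: "Ck k (ppow (Suc k))"
proof (induction k)
  case 0
  show ?case by (simp add: ppow_def[abs_def] continuous_intros)
next
  case (Suc k)
  have "Ck k (\<lambda>x. real (Suc (Suc k)) * ppow (Suc k) x)" by (intro Ck_mult Ck_const Suc)
  then show ?case unfolding Ck.simps(2) using ppow_has_derivative
    by (intro exI[of _ "\<lambda>x. real (Suc (Suc k)) * ppow (Suc k) x"]) simp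
qed

text \<open>For M >= 0 the argument of the inner power reaches 1 before radius M + 1, as (M + 1)^2
  >= M^2 + 1. The exponent 4 is the one for which \<open>Ck_ppow\<close> gives class C3.\<close>

definition cutoff :: "real \<Rightarrow> real \<Rightarrow> real" where
  "cutoff M x = ppow 4 (1 - ppow 4 (x * x - M\<^sup>2))"

lemma cutoff_bounds: "0 \<le> cutoff M x" "cutoff M x \<le> 1"
  by (auto simp: cutoff_def ppow_def intro!: power_le_one)

lemma cutoff_eq_1: "\<bar>x\<bar> \<le> M \<Longrightarrow> cutoff M x = 1"
proof -
  assume "\<bar>x\<bar> \<le> M"
  then have "x\<^sup>2 \<le> M\<^sup>2" by (metis abs_ge_zero power2_abs power_mono)
  then show ?thesis by (simp add: cutoff_def ppow_def power2_eq_square)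
qed

lemma cutoff_eq_0: "0 \<le> M \<Longrightarrow> M + 1 \<le> \<bar>x\<bar> \<Longrightarrow> cutoff M x = 0"
proof -
  assume M: "0 \<le> M" "M + 1 \<le> \<bar>x\<bar>"
  then have "(M + 1)\<^sup>2 \<le> \<bar>x\<bar>\<^sup>2" by (intro power_mono) auto
  then have "M\<^sup>2 + 1 \<le> x\<^sup>2" using M by (simp add: power2_sum)
  then have "1 \<le> (max 0 (x * x - M\<^sup>2)) ^ 4" by (intro one_le_power) (simp add: power2_eq_square)
  then show ?thesis by (simp add: cutoff_def ppow_def)
qed

lemma Ck_cutoff: "Ck 3 (cutoff M)"
proof -
  have p: "Ck 3 (ppow 4)" using Ck_ppow[of 3] by simp
  have "Ck 3 (\<lambda>x. 1 + (- 1) * ppow 4 (x * x + (- (M\<^sup>2))))"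
    by (intro Ck_add Ck_mult Ck_const Ck_compose[OF p] Ck_ident)
  from Ck_compose[OF p this] show ?thesis by (simp add: cutoff_def[abs_def])
qed

text \<open>The truncation is applied to the potential, so that it keeps its sign.\<close>

locale truncated_nonlinearity =
  fixes F G f f' g :: "real \<Rightarrow> real" and M K :: real
  assumes G': "\<And>x. (g has_real_derivative f x) (at x)"
    and f': "\<And>x. (f has_real_derivative f' x) (at x)"
    and f'_bound: "\<And>x. \<bar>f' x\<bar> \<le> K"
    and f'_Lipschitz: "\<And>x y. \<bar>f' x - f' y\<bar> \<le> K * \<bar>x - y\<bar>"
    and f'_cont: "continuous_on UNIV f'"
    and f_0: "f 0 = 0" and g_0: "g 0 = 0" and g_le: "\<And>x. g x \<le> 0" and G_le: "\<And>x. G x \<le> g x"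
    and f_eq: "\<And>x. \<bar>x\<bar> \<le> M \<Longrightarrow> f x = F x"

lemma C2_function_continuous: "C2_function F \<Longrightarrow> continuous_on UNIV F"
  unfolding C2_function_def by (meson DERIV_continuous_on has_field_derivative_at_within)

text \<open>The truncated potential has compact support, so its second and third derivatives are
  bounded; these give the two constants. A cutoff between 0 and 1 applied to a non-positive
  \<open>G\<close> yields \<open>g x \<le> 0\<close> and \<open>G x \<le> g x\<close>.\<close>

lemma exists_truncated_nonlinearity:
  assumes F: "C2_function F" "F 0 = 0" and G: "\<And>x. (G has_real_derivative F x) (at x)" "G 0 = 0" "\<And>x. G x \<le> 0"
    and M: "0 \<le> M"
  obtains f f' g K where "truncated_nonlinearity F G f f' g M K"
proof -
  have "Ck 2 F"
    using F(1) unfolding C2_function_def numeral_2_eq_2 Ck.simps by blast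
  then have CG: "Ck 3 G" using G(1) unfolding numeral_3_eq_3 numeral_2_eq_2 Ck.simps by blast
  \<comment> \<open>Radius M + 1, so that \<open>g\<close> and \<open>G\<close> agree near every x
    with |x| <= M and their derivatives agree there as well.\<close>
  define g where "g x = G x * cutoff (M + 1) x" for x
  have "Ck 3 g" unfolding g_def[abs_def] by (intro Ck_mult CG Ck_cutoff)
  then obtain f f' f'' where f: "\<And>x. (g has_real_derivative f x) (at x)"
    "\<And>x. (f has_real_derivative f' x) (at x)" "\<And>x. (f' has_real_derivative f'' x) (at x)"
    "continuous_on UNIV f''"
    unfolding numeral_3_eq_3 Ck.simps by blast
  let ?O = "{x::real. M + 2 < \<bar>x\<bar>}"
  have O: "open ?O" by (intro open_Collect_less continuous_intros)
  have dzero: "h' x = 0" if "\<And>x. x \<in> ?O \<Longrightarrow> h x = 0" "\<And>x. (h has_real_derivative h' x) (at x)" "x \<in> ?O"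
    for h h' :: "real \<Rightarrow> real" and x
  proof -
    have "(h has_real_derivative 0) (at x)"
      by (rule has_field_derivative_transform_within_open[OF DERIV_const[of 0] O that(3)])
        (simp add: that(1))
    then show ?thesis using that(2) DERIV_unique by blast
  qed
  have gz: "g x = 0" if "x \<in> ?O" for x
    using that M by (simp add: g_def cutoff_eq_0)
  have fz: "f x = 0" if "x \<in> ?O" for x by (rule dzero[OF gz f(1) that])
  have f'z: "f' x = 0" if "x \<in> ?O" for x by (rule dzero[OF fz f(2) that])
  have f''z: "f'' x = 0" if "x \<in> ?O" for x by (rule dzero[OF f'z f(3) that])
  have f'c: "continuous_on UNIV f'"
    by (rule DERIV_continuous_on[OF f(3)[THEN has_field_derivative_at_within]])
  have bnd: "\<exists>B. \<forall>x. \<bar>h x\<bar> \<le> B" if h: "continuous_on UNIV h" "\<And>x. x \<in> ?O \<Longrightarrow> h x = 0" for h :: "real \<Rightarrow> real"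
  proof -
    have "bounded (h ` {- (M + 2)..M + 2})"
      by (intro compact_imp_bounded compact_continuous_image continuous_on_subset[OF h(1)]) auto
    then obtain B where B: "\<And>x. x \<in> {- (M + 2)..M + 2} \<Longrightarrow> \<bar>h x\<bar> \<le> B"
      by (metis bounded_iff imageI real_norm_def)
    have "\<bar>h x\<bar> \<le> max B 0" for x
    proof (cases "x \<in> ?O")
      case False
      then have "x \<in> {- (M + 2)..M + 2}" by auto
      then show ?thesis using B[of x] by simp
    qed (simp add: h(2))
    then show ?thesis by blast
  qed
  obtain K1 where K1: "\<And>x. \<bar>f' x\<bar> \<le> K1" using bnd[OF f'c f'z] by blast
  obtain K2 where K2: "\<And>x. \<bar>f'' x\<bar> \<le> K2" using bnd[OF f(4) f''z] by blast
  have eq: "f x = F x" if "\<bar>x\<bar> \<le> M" for x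
  proof -
    have "open {x::real. \<bar>x\<bar> < M + 1}" by (intro open_Collect_less continuous_intros)
    then have "(g has_real_derivative F x) (at x)"
      by (rule has_field_derivative_transform_within_open[OF G(1)])
        (use that in \<open>auto simp: g_def cutoff_eq_1\<close>)
    then show ?thesis using f(1) DERIV_unique by blast
  qed
  have "truncated_nonlinearity F G f f' g M (max K1 K2)"
  proof
    show "\<bar>f' x\<bar> \<le> max K1 K2" for x using K1[of x] by simp
    show "\<bar>f' x - f' y\<bar> \<le> max K1 K2 * \<bar>x - y\<bar>" for x y
    proof -
      have "norm (f' x - f' y) \<le> K2 * norm (x - y)"
        by (rule field_differentiable_bound[of UNIV f' f'']) (use f(3) K2 in auto)
      then show ?thesis using mult_right_mono[of K2 "max K1 K2" "\<bar>x - y\<bar>"] by simp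
    qed
    show "g x \<le> 0" for x
      using G(3)[of x] cutoff_bounds[of "M + 1" x] by (simp add: g_def mult_nonpos_nonneg)
    show "G x \<le> g x" for x
      using mult_left_mono_neg[OF cutoff_bounds(2)[of "M + 1" x] G(3)[of x]] by (simp add: g_def)
    show "f 0 = 0" using eq[of 0] F(2) M by simp
    show "g 0 = 0" by (simp add: g_def G(2))
  qed (fact f f'c eq)+
  then show thesis by (rule that)
qed

context truncated_nonlinearity
begin

lemma K_nonneg: "0 \<le> K" using f'_bound[of 0] abs_ge_zero order_trans by blast

lemma f_Lipschitz: "\<bar>f x - f y\<bar> \<le> K * \<bar>x - y\<bar>"
  using field_differentiable_bound[of UNIV f f' K x y] f' f'_bound by auto

lemma f_bound: "\<bar>f x\<bar> \<le> K * \<bar>x\<bar>"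
  using f_Lipschitz[of x 0] by (simp add: f_0)

text \<open>Mean value inequality for \<open>f\<close> minus its tangent, whose derivative on the
  segment is at most \<open>K * \<bar>h\<bar>\<close>.\<close>

lemma f_remainder: "\<bar>f (x + h) - f x - f' x * h\<bar> \<le> K * \<bar>h\<bar> * \<bar>h\<bar>"
proof -
  have "norm ((f (x + h) - f' x * (x + h)) - (f x - f' x * x)) \<le> K * \<bar>h\<bar> * norm (x + h - x)"
  proof (rule field_differentiable_bound[of "closed_segment x (x + h)" _ "\<lambda>y. f' y - f' x"])
    show "((\<lambda>y. f y - f' x * y) has_field_derivative f' y - f' x) (at y within closed_segment x (x + h))" for y
      by (auto intro!: derivative_eq_intros has_field_derivative_at_within[OF f'])
    fix y assume "y \<in> closed_segment x (x + h)"
    then have "\<bar>y - x\<bar> \<le> \<bar>h\<bar>" by (auto simp: closed_segment_eq_real_ivl split: if_splits)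
    then show "norm (f' y - f' x) \<le> K * \<bar>h\<bar>"
      using f'_Lipschitz[of y x] mult_left_mono[OF _ K_nonneg] order_trans by fastforce
  qed auto
  then show ?thesis by (simp add: algebra_simps)
qed

lemma g_remainder: "\<bar>g (x + h) - g x - f x * h\<bar> \<le> K * h\<^sup>2"
proof -
  have "norm ((g (x + h) - f x * (x + h)) - (g x - f x * x)) \<le> K * \<bar>h\<bar> * norm (x + h - x)"
  proof (rule field_differentiable_bound[of "closed_segment x (x + h)" _ "\<lambda>y. f y - f x"])
    show "((\<lambda>y. g y - f x * y) has_field_derivative f y - f x) (at y within closed_segment x (x + h))" for y
      by (auto intro!: derivative_eq_intros has_field_derivative_at_within[OF G'])
    fix y assume "y \<in> closed_segment x (x + h)"
    then have "\<bar>y - x\<bar> \<le> \<bar>h\<bar>" by (auto simp: closed_segment_eq_real_ivl split: if_splits)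
    then show "norm (f y - f x) \<le> K * \<bar>h\<bar>"
      using f_Lipschitz[of y x] mult_left_mono[OF _ K_nonneg] order_trans by fastforce
  qed auto
  then show ?thesis by (simp add: algebra_simps power2_eq_square)
qed

end

section \<open>Superposition operators on square integrable functions\<close>

lemma nem_square_integrable:
  assumes "continuous_on UNIV h" "\<And>x. \<bar>h x\<bar> \<le> B * \<bar>x\<bar>"
  shows "square_integrable half_line (h \<circ> rep_l2 u)"
proof (rule norm_abs_l2_mono(1))
  show "square_integrable half_line (\<lambda>x. B * rep_l2 u x)"
    by (intro square_integrable_scale square_integrable_rep)
  show "h \<circ> rep_l2 u \<in> borel_measurable half_line"
    by (rule measurable_comp[OF measurable_rep borel_measurable_continuous_onI[OF assms(1)]])
  show "AE x in half_line. \<bar>(h \<circ> rep_l2 u) x\<bar> \<le> \<bar>B * rep_l2 u x\<bar>"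
  proof (rule AE_I2)
    fix x
    have "\<bar>h (rep_l2 u x)\<bar> \<le> B * \<bar>rep_l2 u x\<bar>" by (rule assms(2))
    also have "\<dots> \<le> \<bar>B * rep_l2 u x\<bar>" by (simp add: abs_mult mult_right_mono)
    finally show "\<bar>(h \<circ> rep_l2 u) x\<bar> \<le> \<bar>B * rep_l2 u x\<bar>" by simp
  qed
qed

lemma norm_scaled_le:
  assumes "square_integrable half_line k" "AE x in half_line. \<bar>k x\<bar> \<le> B * \<bar>rep_l2 h x\<bar>" "0 \<le> B"
  shows "norm (abs_l2 k) \<le> B * norm h"
proof -
  have s: "square_integrable half_line (\<lambda>x. B * rep_l2 h x)"
    by (intro square_integrable_scale square_integrable_rep)
  have "norm (abs_l2 k) \<le> norm (abs_l2 (\<lambda>x. B * rep_l2 h x))"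
    by (rule norm_abs_l2_mono(2)[OF s])
      (use assms in \<open>auto simp: square_integrable_def abs_mult\<close>)
  also have "abs_l2 (\<lambda>x. B * rep_l2 h x) = B *\<^sub>R h"
    by (simp add: scaleR_l2_def)
  finally show ?thesis using assms(3) by simp
qed

lemma nem_Lipschitz:
  assumes "continuous_on UNIV k" "\<And>x y. \<bar>k x - k y\<bar> \<le> B * \<bar>x - y\<bar>" "k 0 = 0"
  shows "norm (abs_l2 (k \<circ> rep_l2 u) - abs_l2 (k \<circ> rep_l2 v)) \<le> B * norm (u - v)"
proof -
  have B: "0 \<le> B" using assms(2)[of 1 0] by simp
  have "\<bar>k x\<bar> \<le> B * \<bar>x\<bar>" for x using assms(2)[of x 0] by (simp add: assms(3))
  note s = nem_square_integrable[OF assms(1) this]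
  have sd: "square_integrable half_line (\<lambda>x. (k \<circ> rep_l2 u) x - (k \<circ> rep_l2 v) x)"
    using square_integrable_add[OF s[of u] square_integrable_scale[OF s[of v], of "-1"]] by simp
  show ?thesis
    unfolding abs_l2_diff[OF s s]
  proof (rule norm_scaled_le[OF sd _ B])
    show "AE x in half_line. \<bar>(k \<circ> rep_l2 u) x - (k \<circ> rep_l2 v) x\<bar> \<le> B * \<bar>rep_l2 (u - v) x\<bar>"
      using rep_diff[of u v] by eventually_elim (simp add: assms(2))
  qed
qed

definition l2_bounded :: "real \<Rightarrow> l2 \<Rightarrow> bool" where
  "l2_bounded B u \<longleftrightarrow> (AE x in half_line. \<bar>rep_l2 u x\<bar> \<le> B)"

text \<open>Composition with \<open>k\<close>, the distance from the interval {-B..B}, is Lipschitz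
  in norm and annihilates exactly the functions bounded by B.\<close>

lemma l2_bounded_LIMSEQ:
  assumes "\<And>n. l2_bounded B (u n)" "u \<longlonglongrightarrow> v" "0 \<le> B"
  shows "l2_bounded B v"
proof -
  define k where "k x = max 0 (\<bar>x\<bar> - B)" for x :: real
  have k: "continuous_on UNIV k" "\<bar>k x - k y\<bar> \<le> 1 * \<bar>x - y\<bar>" "k 0 = 0" for x y
    unfolding k_def using assms(3) by (auto intro!: continuous_intros)
  have kb: "\<bar>k x\<bar> \<le> 1 * \<bar>x\<bar>" for x using k(2)[of x 0] by (simp add: k(3))
  note s = nem_square_integrable[OF k(1) kb]
  have zero: "abs_l2 (k \<circ> rep_l2 (u n)) = 0" for n
  proof -
    have "AE x in half_line. (k \<circ> rep_l2 (u n)) x = 0"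
      using assms(1)[of n] unfolding l2_bounded_def by eventually_elim (simp add: k_def)
    then show ?thesis
      by (subst zero_l2_def, subst abs_l2_eq_iff) (use s square_integrable_zero in auto)
  qed
  have "(\<lambda>n. norm (u n - v)) \<longlonglongrightarrow> 0"
    using assms(2) by (simp add: LIM_zero tendsto_norm_zero)
  moreover have "norm (abs_l2 (k \<circ> rep_l2 v)) \<le> norm (u n - v)" for n
    using nem_Lipschitz[OF k, of "u n" v] by (simp add: zero)
  ultimately have "norm (abs_l2 (k \<circ> rep_l2 v)) \<le> 0"
    by (intro LIMSEQ_le_const) auto
  then have "abs_l2 (k \<circ> rep_l2 v) = abs_l2 (\<lambda>x. 0)" by (simp add: zero_l2_def)
  then have "AE x in half_line. (k \<circ> rep_l2 v) x = 0"
    by (subst (asm) abs_l2_eq_iff) (use s square_integrable_zero in auto)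
  then show ?thesis unfolding l2_bounded_def by eventually_elim (simp add: k_def max_def split: if_splits)
qed

context truncated_nonlinearity
begin

lemma f_continuous: "continuous_on UNIV f"
  by (rule DERIV_continuous_on[OF f'[THEN has_field_derivative_at_within]])

lemma g_continuous: "continuous_on UNIV g"
  by (rule DERIV_continuous_on[OF G'[THEN has_field_derivative_at_within]])

lemmas nem_f_square_integrable = nem_square_integrable[OF f_continuous f_bound]
lemmas nem_f_Lipschitz = nem_Lipschitz[OF f_continuous f_Lipschitz f_0]

definition dnem :: "l2 \<Rightarrow> l2 \<Rightarrow> l2" where
  "dnem u h = abs_l2 (\<lambda>x. f' (rep_l2 u x) * rep_l2 h x)"

lemma f'_rep_measurable [measurable]: "(\<lambda>x. f' (rep_l2 u x)) \<in> borel_measurable half_line"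
  by (rule measurable_compose[OF measurable_rep borel_measurable_continuous_onI[OF f'_cont]])

lemma dnem_square_integrable: "square_integrable half_line (\<lambda>x. f' (rep_l2 u x) * rep_l2 h x)"
proof (rule norm_abs_l2_mono(1))
  show "square_integrable half_line (\<lambda>x. K * rep_l2 h x)"
    by (intro square_integrable_scale square_integrable_rep)
  show "AE x in half_line. \<bar>f' (rep_l2 u x) * rep_l2 h x\<bar> \<le> \<bar>K * rep_l2 h x\<bar>"
    using f'_bound K_nonneg by (auto simp: abs_mult intro!: mult_right_mono)
qed measurable

lemma norm_dnem_le: "norm (dnem u h) \<le> K * norm h"
  unfolding dnem_def
  by (rule norm_scaled_le[OF dnem_square_integrable _ K_nonneg])
    (use f'_bound in \<open>auto simp: abs_mult intro!: mult_right_mono\<close>)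

lemma dnem_add: "dnem u (h + k) = dnem u h + dnem u k"
proof (rule l2_eqI)
  show "AE x in half_line. rep_l2 (dnem u (h + k)) x = rep_l2 (dnem u h + dnem u k) x"
    unfolding dnem_def
    using rep_add[of h k] rep_add[of "dnem u h" "dnem u k", unfolded dnem_def]
      rep_abs[OF dnem_square_integrable[of u h]] rep_abs[OF dnem_square_integrable[of u k]]
      rep_abs[OF dnem_square_integrable[of u "h + k"]]
    by eventually_elim (simp add: algebra_simps)
qed

lemma dnem_scaleR: "dnem u (r *\<^sub>R h) = r *\<^sub>R dnem u h"
proof (rule l2_eqI)
  show "AE x in half_line. rep_l2 (dnem u (r *\<^sub>R h)) x = rep_l2 (r *\<^sub>R dnem u h) x"
    unfolding dnem_def
    using rep_scaleR[of r h] rep_scaleR[of r "dnem u h", unfolded dnem_def]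
      rep_abs[OF dnem_square_integrable[of u h]] rep_abs[OF dnem_square_integrable[of u "r *\<^sub>R h"]]
    by eventually_elim simp
qed

text \<open>A product of two square integrable functions need not be square integrable, so the
  factor \<open>u - v\<close> is measured in the supremum norm.\<close>

lemma dnem_Lipschitz:
  assumes "l2_bounded B (u - v)" "0 \<le> B"
  shows "norm (dnem u h - dnem v h) \<le> K * B * norm h"
proof -
  have "square_integrable half_line (\<lambda>x. f' (rep_l2 u x) * rep_l2 h x - f' (rep_l2 v x) * rep_l2 h x)"
    using square_integrable_add[OF dnem_square_integrable[of u h]
        square_integrable_scale[OF dnem_square_integrable[of v h], of "-1"]] by simp
  then show ?thesis
    unfolding dnem_def abs_l2_diff[OF dnem_square_integrable dnem_square_integrable]
  proof (rule norm_scaled_le)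
    show "AE x in half_line. \<bar>f' (rep_l2 u x) * rep_l2 h x - f' (rep_l2 v x) * rep_l2 h x\<bar>
        \<le> K * B * \<bar>rep_l2 h x\<bar>"
      using rep_diff[of u v] assms(1)[unfolded l2_bounded_def]
    proof eventually_elim
      case (elim x)
      have "\<bar>f' (rep_l2 u x) - f' (rep_l2 v x)\<bar> \<le> K * \<bar>rep_l2 u x - rep_l2 v x\<bar>"
        by (rule f'_Lipschitz)
      also have "\<dots> \<le> K * B" using elim K_nonneg by (intro mult_left_mono) auto
      finally show ?case
        by (simp add: left_diff_distrib[symmetric] abs_mult mult_right_mono)
    qed
  qed (use K_nonneg assms(2) in simp)
qed

lemma nem_remainder:
  assumes "l2_bounded B h" "0 \<le> B"
  shows "norm (abs_l2 (f \<circ> rep_l2 (u + h)) - abs_l2 (f \<circ> rep_l2 u) - dnem u h) \<le> K * B * norm h"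
proof -
  let ?k = "\<lambda>x. ((f \<circ> rep_l2 (u + h)) x - (f \<circ> rep_l2 u) x) - f' (rep_l2 u x) * rep_l2 h x"
  have s1: "square_integrable half_line (\<lambda>x. (f \<circ> rep_l2 (u + h)) x - (f \<circ> rep_l2 u) x)"
    using square_integrable_add[OF nem_f_square_integrable[of "u + h"]
        square_integrable_scale[OF nem_f_square_integrable[of u], of "-1"]] by simp
  have s2: "square_integrable half_line ?k"
    using square_integrable_add[OF s1 square_integrable_scale[OF dnem_square_integrable[of u h], of "-1"]]
    by simp
  have "abs_l2 (f \<circ> rep_l2 (u + h)) - abs_l2 (f \<circ> rep_l2 u) - dnem u h = abs_l2 ?k"
    unfolding dnem_def abs_l2_diff[OF nem_f_square_integrable nem_f_square_integrable]
      abs_l2_diff[OF s1 dnem_square_integrable] ..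
  also have "norm \<dots> \<le> K * B * norm h"
  proof (rule norm_scaled_le[OF s2])
    show "AE x in half_line. \<bar>?k x\<bar> \<le> K * B * \<bar>rep_l2 h x\<bar>"
      using rep_add[of u h] assms(1)[unfolded l2_bounded_def]
    proof eventually_elim
      case (elim x)
      have "\<bar>?k x\<bar> \<le> K * \<bar>rep_l2 h x\<bar> * \<bar>rep_l2 h x\<bar>"
        using f_remainder[of "rep_l2 u x" "rep_l2 h x"] elim by simp
      also have "\<dots> \<le> K * B * \<bar>rep_l2 h x\<bar>"
        using elim K_nonneg by (intro mult_right_mono mult_left_mono) auto
      finally show ?case .
    qed
  qed (use K_nonneg assms(2) in simp)
  finally show ?thesis .
qed

definition pot :: "l2 \<Rightarrow> real" where "pot u = (\<integral>x. g (rep_l2 u x) \<partial>half_line)"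

lemma g_bound: "\<bar>g x\<bar> \<le> K * x\<^sup>2"
  using g_remainder[of 0 x] by (simp add: g_0 f_0)

lemma integrable_g: "integrable half_line (\<lambda>x. g (rep_l2 u x))"
proof (rule Bochner_Integration.integrable_bound)
  show "integrable half_line (\<lambda>x. K * (rep_l2 u x)\<^sup>2)" using integrable_rep_square by simp
  show "(\<lambda>x. g (rep_l2 u x)) \<in> borel_measurable half_line"
    by (rule measurable_compose[OF measurable_rep borel_measurable_continuous_onI[OF g_continuous]])
  show "AE x in half_line. norm (g (rep_l2 u x)) \<le> norm (K * (rep_l2 u x)\<^sup>2)"
    using g_bound K_nonneg by (auto simp: abs_mult)
qed

lemma pot_nonpos: "pot u \<le> 0"
proof -
  have "0 \<le> (\<integral>x. - g (rep_l2 u x) \<partial>half_line)"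
    using g_le by (intro integral_nonneg_AE) auto
  then show ?thesis by (simp add: pot_def)
qed

text \<open>Unlike in \<open>nem_remainder\<close> no supremum bound enters: the quadratic remainder
  is only integrated, and the integral of h^2 is the squared norm.\<close>

lemma pot_remainder: "\<bar>pot (u + h) - pot u - inner (abs_l2 (f \<circ> rep_l2 u)) h\<bar> \<le> K * (norm h)\<^sup>2"
proof -
  have i: "inner (abs_l2 (f \<circ> rep_l2 u)) h = (\<integral>x. f (rep_l2 u x) * rep_l2 h x \<partial>half_line)"
    using inner_l2_abs[OF nem_f_square_integrable, of h u] by (simp add: inner_commute mult.commute)
  have int: "integrable half_line (\<lambda>x. f (rep_l2 u x) * rep_l2 h x)"
    using square_integrable_mult[OF nem_f_square_integrable square_integrable_rep, of u h] by simp
  have "pot (u + h) - pot u - inner (abs_l2 (f \<circ> rep_l2 u)) h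
      = (\<integral>x. g (rep_l2 (u + h) x) - g (rep_l2 u x) - f (rep_l2 u x) * rep_l2 h x \<partial>half_line)"
    unfolding pot_def i using int integrable_g by simp
  also have "\<bar>\<dots>\<bar> \<le> (\<integral>x. \<bar>g (rep_l2 (u + h) x) - g (rep_l2 u x) - f (rep_l2 u x) * rep_l2 h x\<bar> \<partial>half_line)"
    by (rule integral_abs_bound)
  also have "\<dots> \<le> (\<integral>x. K * (rep_l2 h x)\<^sup>2 \<partial>half_line)"
  proof (rule integral_mono_AE)
    show "integrable half_line (\<lambda>x. \<bar>g (rep_l2 (u + h) x) - g (rep_l2 u x) - f (rep_l2 u x) * rep_l2 h x\<bar>)"
      by (intro Bochner_Integration.integrable_abs Bochner_Integration.integrable_diff integrable_g int)
    show "integrable half_line (\<lambda>x. K * (rep_l2 h x)\<^sup>2)" using integrable_rep_square by simp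
    show "AE x in half_line. \<bar>g (rep_l2 (u + h) x) - g (rep_l2 u x) - f (rep_l2 u x) * rep_l2 h x\<bar>
        \<le> K * (rep_l2 h x)\<^sup>2"
      using rep_add[of u h] by eventually_elim (simp add: g_remainder)
  qed
  also have "\<dots> = K * (norm h)\<^sup>2" by (simp add: norm_l2_rep)
  finally show ?thesis .
qed

lemma nem_eq_truncated:
  assumes "l2_bounded M u" "continuous_on UNIV F"
  shows "abs_l2 (F \<circ> rep_l2 u) = abs_l2 (f \<circ> rep_l2 u)"
proof (rule abs_l2_cong(2)[OF nem_f_square_integrable])
  show "AE x in half_line. (f \<circ> rep_l2 u) x = (F \<circ> rep_l2 u) x"
    using assms(1) unfolding l2_bounded_def by eventually_elim (simp add: f_eq)
  show "F \<circ> rep_l2 u \<in> borel_measurable half_line"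
    by (rule measurable_comp[OF measurable_rep borel_measurable_continuous_onI[OF assms(2)]])
qed

end

section \<open>The square root of a coercive operator\<close>

lemma has_derivative_quadratic_remainder:
  assumes L: "bounded_linear L" and rem: "\<And>h. norm (N (x + h) - N x - L h) \<le> B * (norm h)\<^sup>2"
  shows "(N has_derivative L) (at x)"
  unfolding has_derivative_iff_norm
proof
  show "((\<lambda>y. norm (N y - N x - L (y - x)) / norm (y - x)) \<longlongrightarrow> 0) (at x)"
  proof (rule Lim_null_comparison)
    have "norm (norm (N y - N x - L (y - x)) / norm (y - x)) \<le> B * norm (y - x)" for y
      using rem[of "y - x"] by (cases "y = x") (simp_all add: divide_le_eq power2_eq_square mult.assoc)
    then show "\<forall>\<^sub>F y in at x. norm (norm (N y - N x - L (y - x)) / norm (y - x)) \<le> B * norm (y - x)"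
      by (simp add: always_eventually)
    have "((\<lambda>y. B * norm (y - x)) \<longlongrightarrow> B * norm (x - x)) (at x)" by (intro tendsto_intros)
    then show "((\<lambda>y. B * norm (y - x)) \<longlongrightarrow> 0) (at x)" by simp
  qed
qed (rule L)

locale coercive_operator =
  fixes dom :: "'a::{real_inner, banach, perfect_space} set" and A :: "'a \<Rightarrow> 'a" and a :: real
  assumes a: "0 < a"
    and dom_add: "u \<in> dom \<Longrightarrow> v \<in> dom \<Longrightarrow> u + v \<in> dom"
    and dom_scaleR: "u \<in> dom \<Longrightarrow> r *\<^sub>R u \<in> dom"
    and A_add: "u \<in> dom \<Longrightarrow> v \<in> dom \<Longrightarrow> A (u + v) = A u + A v"
    and A_scaleR: "u \<in> dom \<Longrightarrow> A (r *\<^sub>R u) = r *\<^sub>R A u"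
    and A_symmetric: "u \<in> dom \<Longrightarrow> v \<in> dom \<Longrightarrow> inner (A u) v = inner u (A v)"
    and A_coercive: "u \<in> dom \<Longrightarrow> a * (norm u)\<^sup>2 \<le> inner (A u) u"
    and A_surj: "\<exists>u\<in>dom. A u = f"
begin

definition opA :: "('a \<times> 'a) set" where "opA = {(v, A v) | v. v \<in> dom}"

lemma dom_diff: "u \<in> dom \<Longrightarrow> v \<in> dom \<Longrightarrow> u - v \<in> dom"
  using dom_add[of u "- v"] dom_scaleR[of v "-1"] by simp

lemma A_diff: "u \<in> dom \<Longrightarrow> v \<in> dom \<Longrightarrow> A (u - v) = A u - A v"
  using A_add[of u "- v"] dom_scaleR[of v "-1"] A_scaleR[of v "-1"] by simp

lemma A_inj: "u \<in> dom \<Longrightarrow> v \<in> dom \<Longrightarrow> A u = A v \<Longrightarrow> u = v"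
proof -
  assume u: "u \<in> dom" and v: "v \<in> dom" and eq: "A u = A v"
  have "a * (norm (u - v))\<^sup>2 \<le> inner (A (u - v)) (u - v)"
    by (rule A_coercive[OF dom_diff[OF u v]])
  then have "a * (norm (u - v))\<^sup>2 \<le> 0" by (simp add: A_diff[OF u v] eq)
  then show "u = v" using a by (simp add: mult_le_0_iff)
qed

definition B :: "'a \<Rightarrow> 'a" where "B f = (THE u. u \<in> dom \<and> A u = f)"

lemma B: "B f \<in> dom" "A (B f) = f"
proof -
  obtain u where "u \<in> dom" "A u = f" using A_surj by blast
  then have "\<exists>!u. u \<in> dom \<and> A u = f" using A_inj by metis
  from theI'[OF this] show "B f \<in> dom" "A (B f) = f" by (simp_all add: B_def)
qed

lemma B_A: "u \<in> dom \<Longrightarrow> B (A u) = u"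
  using A_inj B by metis

lemma inner_B: "inner (B f) g = inner f (B g)"
  using A_symmetric[OF B(1) B(1), of f g] by (simp add: B)

lemma B_coercive: "a * (norm (B f))\<^sup>2 \<le> inner (B f) f"
  using A_coercive[OF B(1), of f] by (simp add: B inner_commute)

lemma norm_B: "norm (B f) \<le> norm f / a"
proof -
  have "a * (norm (B f))\<^sup>2 \<le> norm (B f) * norm f"
    using B_coercive norm_cauchy_schwarz order_trans by blast
  then have "norm (B f) * (a * norm (B f)) \<le> norm (B f) * norm f"
    by (simp add: power2_eq_square mult_ac)
  then have "a * norm (B f) \<le> norm f" by (cases "norm (B f) = 0") auto
  then show ?thesis using a by (simp add: field_simps)
qed

lemma B_bounded_linear: "bounded_linear B"
proof
  show "B (f + g) = B f + B g" for f g
    using B_A[OF dom_add[OF B(1) B(1)]] A_add[OF B(1) B(1)] by (simp add: B)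
  show "B (r *\<^sub>R f) = r *\<^sub>R B f" for r f
    using B_A[OF dom_scaleR[OF B(1)]] A_scaleR[OF B(1)] by (simp add: B)
  show "\<exists>K. \<forall>f. norm (B f) \<le> norm f * K"
    using norm_B by (intro exI[of _ "1 / a"]) simp
qed

text \<open>Chosen so that 1 - C is a times the inverse of A, whose square root the binomial series
  provides.\<close>

definition C :: "'a endo" where "C = 1 - a *\<^sub>R Endo B"

lemma app_C: "app C f = f - a *\<^sub>R B f"
  by (simp add: C_def app_simps app_Endo[OF B_bounded_linear])

sublocale C: positive_contraction C
proof
  show "symmetric_op C"
    by (simp add: symmetric_op_def app_C inner_diff inner_B)
  show "0 \<le> inner (app C f) f" for f
  proof -
    have "inner (B f) f \<le> norm (B f) * norm f" by (rule norm_cauchy_schwarz)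
    also have "\<dots> \<le> norm f / a * norm f" by (intro mult_right_mono norm_B) simp
    finally have "a * inner (B f) f \<le> norm f * norm f" using a by (simp add: field_simps)
    then show ?thesis by (simp add: app_C inner_diff power2_norm_eq_inner[symmetric] power2_eq_square)
  qed
  show "inner (app C f) f \<le> inner f f" for f
  proof -
    have "0 \<le> inner (B f) f" using a by (intro order_trans[OF _ B_coercive[of f]]) simp
    then show ?thesis using a by (simp add: app_C inner_diff)
  qed
qed

lemma C_power_tendsto_0: "(\<lambda>n. app (C ^ n) f) \<longlonglongrightarrow> 0"
proof (rule C.power_tendsto_zero)
  fix f assume "app C f = f"
  then have "B f = 0" using a by (simp add: app_C)
  then have "f = A 0" using B(2)[of f] by simp
  also have "A 0 = 0" using A_scaleR[of "B 0" 0] B(1)[of 0] by simp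
  finally show "f = 0" .
qed

text \<open>1 - C^n is divisible by 1 - C. Together with \<open>C_power_tendsto_0\<close> this
  approximates every vector by elements of the range of \<open>B\<close>.\<close>

lemma minus_C_power: "\<exists>q. f - app (C ^ n) f = B q"
proof (induction n)
  case 0
  show ?case by (rule exI[of _ 0]) (simp add: app_one linear_0[OF bounded_linear.linear[OF B_bounded_linear]])
next
  case (Suc n)
  then obtain q where q: "f - app (C ^ n) f = B q" by blast
  have "f - app (C ^ Suc n) f = B q + a *\<^sub>R B (app (C ^ n) f)"
    using q by (simp add: app_times app_C algebra_simps)
  also have "\<dots> = B (q + a *\<^sub>R app (C ^ n) f)"
    by (simp add: linear_add[OF bounded_linear.linear[OF B_bounded_linear]]
        linear_scale[OF bounded_linear.linear[OF B_bounded_linear]])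
  finally show ?case by blast
qed

text \<open>\<open>R1\<close> is a bounded square root of \<open>B\<close>, and its inverse, taken
  as a graph, is a square root of \<open>opA\<close>. Its domain is dense because the range of
  \<open>R1\<close> contains that of \<open>B\<close>.\<close>

lemma sqrt_op_spec: "self_adjoint (sqrt_op opA) \<and> positive_op (sqrt_op opA) \<and> sqrt_op opA O sqrt_op opA = opA"
proof -
  obtain R0 where R0: "symmetric_op R0" "\<And>x. 0 \<le> inner (app R0 x) x" "R0 * R0 = 1 - C"
    using C.sqrt_one_minus by blast
  define R1 where "R1 x = app R0 x /\<^sub>R sqrt a" for x
  have R1_B: "R1 (R1 x) = B x" for x
  proof -
    have "app R0 (app R0 x) = a *\<^sub>R B x"
      using arg_cong[OF R0(3), of "\<lambda>T. app T x"] by (simp add: app_simps app_C)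
    moreover have "inverse (sqrt a) * (inverse (sqrt a) * a) = 1"
      using a by (simp add: mult.assoc[symmetric] field_simps)
    ultimately show ?thesis by (simp add: R1_def app_scaleR)
  qed
  have R1_sym: "inner (R1 x) y = inner x (R1 y)" for x y
    by (simp add: R1_def symmetric_opD[OF R0(1)])
  define S where "S = {(R1 x, x) | x. True}"
  have "self_adjoint S"
    unfolding self_adjoint_def
  proof
    have dom_S: "Domain S = range R1" by (auto simp: S_def)
    show "closure (Domain S) = UNIV"
    proof -
      have "f \<in> closure (range R1)" for f
      proof -
        have "\<forall>n. f - app (C ^ n) f \<in> range R1"
          using minus_C_power R1_B by (metis rangeI)
        moreover have "(\<lambda>n. f - app (C ^ n) f) \<longlonglongrightarrow> f"
          using tendsto_diff[OF tendsto_const C_power_tendsto_0, of f f] by simp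
        ultimately show ?thesis unfolding closure_sequential
          by (intro exI[of _ "\<lambda>n. f - app (C ^ n) f"] conjI)
      qed
      then show ?thesis unfolding dom_S by blast
    qed
    show "adjoint_graph S = S"
    proof
      show "adjoint_graph S \<subseteq> S"
      proof
        fix p assume p: "p \<in> adjoint_graph S"
        obtain y z where yz: "p = (y, z)" by (cases p)
        \<comment> \<open>The second components of the pairs in \<open>S\<close> are arbitrary, so
          membership in the adjoint is tested against every vector.\<close>
        have "inner x y = inner x (R1 z)" for x
          using p by (auto simp: yz adjoint_graph_def S_def R1_sym)
        then have "y = R1 z" using vector_eq_ldot by blast
        then show "p \<in> S" by (auto simp: yz S_def)
      qed
      show "S \<subseteq> adjoint_graph S" by (auto simp: adjoint_graph_def S_def R1_sym)
    qed
  qed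
  moreover have "positive_op S"
    using R0(2) a by (auto simp: positive_op_def S_def R1_def inner_commute)
  moreover have "S O S = opA"
  proof -
    have "S O S = {(B x, x) | x. True}" by (auto simp: S_def relcomp_unfold R1_B[symmetric])
    also have "\<dots> = opA"
      using B B_A by (auto simp: opA_def)
    finally show ?thesis .
  qed
  ultimately have "\<exists>S. self_adjoint S \<and> positive_op S \<and> S O S = opA" by blast
  then show ?thesis
    unfolding sqrt_op_def by (rule someI_ex)
qed

section \<open>The chosen square root and its bounded inverse\<close>

abbreviation S :: "('a \<times> 'a) set" where "S \<equiv> sqrt_op opA"

text \<open>\<open>sqrt_op\<close> is a choice; the facts on \<open>S\<close> that follow are drawn
  from its specification and hold for every square root of this kind.\<close>

lemma S_adjoint: "adjoint_graph S = S" and S_dense: "closure (Domain S) = UNIV" and S_S: "S O S = opA"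
  using sqrt_op_spec by (auto simp: self_adjoint_def)

text \<open>\<open>S\<close> is its own adjoint graph, and an adjoint graph is a linear
  subspace.\<close>

lemma S_diff: "(x, y) \<in> S \<Longrightarrow> (x', y') \<in> S \<Longrightarrow> (x - x', y - y') \<in> S"
  by (subst S_adjoint[symmetric], subst (asm) (1 2) S_adjoint[symmetric])
    (fastforce simp: adjoint_graph_def inner_diff_right)

lemma S_add: "(x, y) \<in> S \<Longrightarrow> (x', y') \<in> S \<Longrightarrow> (x + x', y + y') \<in> S"
  by (subst S_adjoint[symmetric], subst (asm) (1 2) S_adjoint[symmetric])
    (fastforce simp: adjoint_graph_def inner_add_right)

lemma S_scaleR: "(x, y) \<in> S \<Longrightarrow> (r *\<^sub>R x, r *\<^sub>R y) \<in> S"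
  by (subst S_adjoint[symmetric], subst (asm) S_adjoint[symmetric])
    (fastforce simp: adjoint_graph_def)

text \<open>If (0, z) lies in the adjoint graph, then z is orthogonal to the dense domain.\<close>

lemma S_functional: "(x, y) \<in> S \<Longrightarrow> (x, y') \<in> S \<Longrightarrow> y = y'"
proof -
  assume "(x, y) \<in> S" "(x, y') \<in> S"
  then have "(0, y - y') \<in> adjoint_graph S" unfolding S_adjoint using S_diff by fastforce
  then have orth: "inner a (y - y') = 0" if "a \<in> Domain S" for a
    using that by (fastforce simp: adjoint_graph_def)
  have "y - y' \<in> closure (Domain S)" by (simp add: S_dense)
  then obtain s where s: "\<And>n. s n \<in> Domain S" "s \<longlonglongrightarrow> y - y'"
    by (auto simp: closure_sequential)
  have "(\<lambda>n. inner (s n) (y - y')) \<longlonglongrightarrow> inner (y - y') (y - y')"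
    by (intro tendsto_intros s)
  then have "inner (y - y') (y - y') = 0" by (simp add: orth[OF s(1)] LIMSEQ_const_iff)
  then show "y = y'" by simp
qed

text \<open>A vector that \<open>S\<close> sends to 0 is sent to 0 by \<open>S O S\<close>, and
  \<open>A\<close> is injective.\<close>

lemma S_inj: "(x, y) \<in> S \<Longrightarrow> (x', y) \<in> S \<Longrightarrow> x = x'"
proof -
  assume *: "(x, y) \<in> S" "(x', y) \<in> S"
  have "(x - x', 0) \<in> S" using S_diff[OF *] by simp
  moreover have "(0, 0) \<in> S" using S_diff[OF *(1) *(1)] by simp
  ultimately have "(x - x', 0) \<in> opA" using S_S by blast
  then have "x - x' \<in> dom" "A (x - x') = 0" by (auto simp: opA_def)
  then have "B 0 = x - x'" using B_A by metis
  then show "x = x'" using linear_0[OF bounded_linear.linear[OF B_bounded_linear]] by simp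
qed

lemma S_surj: "\<exists>x. (x, y) \<in> S"
proof -
  have "(B y, y) \<in> opA" unfolding opA_def by (rule CollectI, rule exI[of _ "B y"]) (simp add: B)
  then show ?thesis using S_S by blast
qed

definition R :: "'a \<Rightarrow> 'a" where "R y = (THE x. (x, y) \<in> S)"

lemma R_S: "(R y, y) \<in> S"
  unfolding R_def using S_surj S_inj by (metis theI)

lemma S_iff: "(x, y) \<in> S \<longleftrightarrow> x = R y"
  using R_S S_inj by metis

lemma op_app_S: "op_app S (R y) = y"
  unfolding op_app_def using R_S S_functional by blast

lemma Domain_S: "Domain S = range R"
  by (auto simp: S_iff)

lemma R_R: "R (R y) = B y"
proof -
  have "(R (R y), y) \<in> opA" using R_S S_S by blast
  then have "R (R y) \<in> dom" "A (R (R y)) = y" by (auto simp: opA_def)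
  then show ?thesis using B_A by metis
qed

lemma inner_R: "inner (R x) y = inner x (R y)"
proof -
  have "(R y, y) \<in> adjoint_graph S" unfolding S_adjoint by (rule R_S)
  then show ?thesis using R_S[of x] by (fastforce simp: adjoint_graph_def)
qed

lemma norm_R: "norm (R x) \<le> 1 / sqrt a * norm x"
proof -
  have "(norm (R x))\<^sup>2 = inner x (B x)"
    by (simp add: power2_norm_eq_inner inner_R R_R)
  also have "\<dots> \<le> norm x * (norm x / a)"
    using norm_cauchy_schwarz[of x "B x"] mult_left_mono[OF norm_B[of x], of "norm x"] by simp
  also have "\<dots> = (1 / sqrt a * norm x)\<^sup>2"
    using a by (simp add: power_mult_distrib power_divide power2_eq_square)
  finally show ?thesis by (rule power2_le_imp_le) (use a in simp)
qed

lemma R_bounded_linear: "bounded_linear R"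
proof
  show "R (x + y) = R x + R y" for x y using S_add[OF R_S R_S] S_iff by metis
  show "R (r *\<^sub>R x) = r *\<^sub>R R x" for r x using S_scaleR[OF R_S] S_iff by metis
  show "\<exists>K. \<forall>x. norm (R x) \<le> norm x * K"
    using norm_R by (intro exI[of _ "1 / sqrt a"]) (simp add: mult.commute)
qed

lemmas R_linear = bounded_linear.linear[OF R_bounded_linear]
lemmas R_simps = linear_add[OF R_linear] linear_diff[OF R_linear] linear_scale[OF R_linear] linear_0[OF R_linear]

lemma R_eq_0: "R x = 0 \<Longrightarrow> x = 0"
  using R_S[of x] R_S[of 0] S_functional by (simp add: R_simps)

lemma Gen_bounded_linear: "bounded_linear (\<lambda>(p, v). (- R v, R p))"
proof -
  have "bounded_linear (\<lambda>x. (- R (snd x), R (fst x)))"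
    by (intro bounded_linear_Pair bounded_linear_minus bounded_linear_compose[OF R_bounded_linear]
        bounded_linear_fst bounded_linear_snd)
  then show ?thesis by (simp add: case_prod_unfold)
qed

definition Gen :: "('a \<times> 'a) endo" where "Gen = Endo (\<lambda>(p, v). (- R v, R p))"

lemma app_Gen: "app Gen (p, v) = (- R v, R p)"
  by (simp add: Gen_def app_Endo[OF Gen_bounded_linear])

sublocale Gen: skew_generator Gen
proof
  show "skew_op Gen" by (auto simp: skew_op_def app_Gen inner_R)
  show "x = 0" if "app Gen x = 0" for x
    using that by (cases x) (auto simp: app_Gen zero_prod_def dest: R_eq_0)
qed

end

section \<open>Supremum bounds on the range of \<open>R\<close>\<close>

context star_graph
begin

sublocale coercive_operator dom_A A a1
proof
  show "inner (A u) v = inner u (A v)" if "u \<in> dom_A" "v \<in> dom_A" for u v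
    using inner_A[OF that(1) subsetD[OF dom_A_subset_V that(2)]]
      inner_A[OF that(2) subsetD[OF dom_A_subset_V that(1)]] by (simp add: inner_commute)
  show "\<exists>u\<in>dom_A. A u = f" for f using A_surjective by blast
  show "a1 * (norm u)\<^sup>2 \<le> inner (A u) u" if u: "u \<in> dom_A" for u
  proof -
    have "sqrt a1 * norm u \<le> norm (D u)" using norm_le_D[of u] a1 by (simp add: field_simps)
    then have "(sqrt a1 * norm u)\<^sup>2 \<le> (norm (D u))\<^sup>2" by (intro power_mono) (use a1 in auto)
    then show ?thesis
      using inner_A[OF u subsetD[OF dom_A_subset_V u]] a1
      by (simp add: power_mult_distrib power2_norm_eq_inner)
  qed
qed (use a1 in \<open>auto intro: dom_A_add dom_A_scaleR simp: A_add A_scaleR\<close>)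

lemma sqrt_A_eq: "sqrt_A c a1 a2 = S"
  by (simp add: sqrt_A_def opA_def)

definition bounded2 :: "real \<Rightarrow> H \<Rightarrow> bool" where
  "bounded2 b u \<longleftrightarrow> l2_bounded b (fst u) \<and> l2_bounded b (snd u)"

text \<open>The constant of \<open>AE_bounded_V\<close>, doubled because the approximants of
  \<open>p\<close> in \<open>R_bounded2\<close> have norm up to \<open>2 * norm p\<close>.\<close>

definition Cs :: real where "Cs = sqrt (2 / (c * sqrt a1)) * 2"

lemma Cs_nonneg: "0 \<le> Cs" using c a1 by (simp add: Cs_def)

text \<open>\<open>AE_bounded_V\<close> concerns V, while the domain of \<open>S\<close> is known as
  the range of \<open>R\<close>. The vectors \<open>R (p - app (C ^ n) p)\<close> lie in
  \<open>dom_A\<close>, their images under \<open>D\<close> have the norm of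
  \<open>p - app (C ^ n) p\<close>, and the bound passes to their limit \<open>R p\<close>.\<close>

lemma R_bounded2: "bounded2 (Cs * norm p) (R p)"
proof -
  define u where "u n = R (p - app (C ^ n) p)" for n
  have "(\<lambda>n. p - app (C ^ n) p) \<longlonglongrightarrow> p"
    using tendsto_diff[OF tendsto_const C_power_tendsto_0, of p p] by simp
  then have lim: "u \<longlonglongrightarrow> R p"
    unfolding u_def by (rule bounded_linear.tendsto[OF R_bounded_linear])
  have "bounded2 (Cs * norm p) (u n)" for n
  proof -
    define pn where "pn = p - app (C ^ n) p"
    obtain q where q: "pn = B q" using minus_C_power[of p n] by (auto simp: pn_def)
    have u: "u n = B (R q)" by (simp add: u_def pn_def[symmetric] q R_R[symmetric])
    then have udom: "u n \<in> dom_A" "A (u n) = R q" by (simp_all add: B)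
    have "(norm (D (u n)))\<^sup>2 = inner (R q) (u n)"
      using inner_A[OF udom(1) subsetD[OF dom_A_subset_V udom(1)]] udom(2)
      by (simp add: power2_norm_eq_inner)
    also have "\<dots> = inner (R (R q)) pn" by (simp add: u_def pn_def[symmetric] inner_R)
    also have "\<dots> = (norm pn)\<^sup>2" by (simp add: R_R q power2_norm_eq_inner)
    finally have D_eq: "norm (D (u n)) = norm pn" by simp
    have "norm (app (C ^ n) p) \<le> norm p"
      using norm_app[of "C ^ n" p] mult_right_mono[OF C.norm_power_le_one[of n] norm_ge_zero[of p]] by simp
    then have "norm pn \<le> 2 * norm p"
      using norm_triangle_ineq4[of p "app (C ^ n) p"] by (simp add: pn_def)
    then have b: "sqrt (2 / (c * sqrt a1)) * norm (D (u n)) \<le> Cs * norm p"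
      using c a1 by (simp add: D_eq Cs_def mult.assoc mult_left_mono)
    have V: "(fst (u n), snd (u n)) \<in> V" using subsetD[OF dom_A_subset_V udom(1)] by simp
    have "l2_bounded (Cs * norm p) (fst (u n))"
      using AE_bounded_V(1)[OF V] unfolding l2_bounded_def
      by eventually_elim (use b in simp)
    moreover have "l2_bounded (Cs * norm p) (snd (u n))"
      using AE_bounded_V(2)[OF V] unfolding l2_bounded_def
      by eventually_elim (use b in simp)
    ultimately show ?thesis by (simp add: bounded2_def)
  qed
  then show ?thesis
    unfolding bounded2_def using Cs_nonneg
    by (auto intro: l2_bounded_LIMSEQ[OF _ tendsto_fst[OF lim]] l2_bounded_LIMSEQ[OF _ tendsto_snd[OF lim]])
qed

end

section \<open>Global solutions\<close>

lemma norm_prod_mono: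
  assumes "norm (fst x) \<le> B * norm (fst y)" "norm (snd x) \<le> B * norm (snd y)" "0 \<le> B"
  shows "norm x \<le> B * norm y"
proof -
  have "(norm (fst x))\<^sup>2 \<le> (B * norm (fst y))\<^sup>2" "(norm (snd x))\<^sup>2 \<le> (B * norm (snd y))\<^sup>2"
    using assms by (auto intro!: power_mono)
  then have "(norm x)\<^sup>2 \<le> (B * norm y)\<^sup>2"
    by (simp add: norm_prod_def power_mult_distrib distrib_left)
  then show ?thesis by (rule power2_le_imp_le) (use assms in simp)
qed

lemma superpos_eq: "superpos F u = (abs_l2 (F \<circ> rep_l2 (fst u)), abs_l2 (F \<circ> rep_l2 (snd u)))"
  by (simp add: superpos_def split_beta)

context truncated_nonlinearity
begin

lemma superpos_Lipschitz: "norm (superpos f u - superpos f v) \<le> K * norm (u - v)"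
  by (rule norm_prod_mono) (simp_all add: superpos_eq nem_f_Lipschitz K_nonneg)

definition dsuperpos :: "H \<Rightarrow> H \<Rightarrow> H" where
  "dsuperpos u h = (dnem (fst u) (fst h), dnem (snd u) (snd h))"

lemma norm_dsuperpos_le: "norm (dsuperpos u h) \<le> K * norm h"
  by (rule norm_prod_mono) (simp_all add: dsuperpos_def norm_dnem_le K_nonneg)

lemma dsuperpos_add: "dsuperpos u (h + k) = dsuperpos u h + dsuperpos u k"
  by (simp add: dsuperpos_def dnem_add)

lemma dsuperpos_scaleR: "dsuperpos u (r *\<^sub>R h) = r *\<^sub>R dsuperpos u h"
  by (simp add: dsuperpos_def dnem_scaleR)

definition pot2 :: "H \<Rightarrow> real" where "pot2 u = pot (fst u) + pot (snd u)"

text \<open>The superposition operator is the gradient of the potential, which is the reason why the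
  energy is conserved.\<close>

lemma pot2_has_derivative: "(pot2 has_derivative (\<lambda>h. inner (superpos f u) h)) (at u)"
proof (rule has_derivative_quadratic_remainder)
  show "bounded_linear (inner (superpos f u))" by (rule bounded_linear_inner_right)
  fix h
  have "norm (pot2 (u + h) - pot2 u - inner (superpos f u) h)
      \<le> K * (norm (fst h))\<^sup>2 + K * (norm (snd h))\<^sup>2"
    using pot_remainder[of "fst u" "fst h"] pot_remainder[of "snd u" "snd h"]
    by (simp add: pot2_def superpos_eq inner_prod_def)
  also have "\<dots> = K * (norm h)\<^sup>2" by (simp add: norm_prod_def distrib_left)
  finally show "norm (pot2 (u + h) - pot2 u - inner (superpos f u) h) \<le> K * (norm h)\<^sup>2" .
qed

lemma pot2_nonpos: "pot2 u \<le> 0"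
  using pot_nonpos[of "fst u"] pot_nonpos[of "snd u"] by (simp add: pot2_def)

end

section \<open>The truncated problem in the variables p and v\<close>

locale truncated_problem =
  star_graph c a1 a2 + truncated_nonlinearity F G f f' g M K
  for c a1 a2 :: real and F G f f' g :: "real \<Rightarrow> real" and M K :: real
begin

lemma dsuperpos_Lipschitz:
  assumes "bounded2 b (u - v)" "0 \<le> b"
  shows "norm (dsuperpos u h - dsuperpos v h) \<le> K * b * norm h"
  by (rule norm_prod_mono)
    (use assms K_nonneg in \<open>simp_all add: dsuperpos_def bounded2_def dnem_Lipschitz\<close>)

lemma superpos_remainder:
  assumes "bounded2 b h" "0 \<le> b"
  shows "norm (superpos f (u + h) - superpos f u - dsuperpos u h) \<le> K * b * norm h"
  by (rule norm_prod_mono)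
    (use assms K_nonneg in \<open>simp_all add: dsuperpos_def superpos_eq bounded2_def nem_remainder\<close>)

lemma superpos_eq_truncated:
  assumes "bounded2 M u" "continuous_on UNIV F"
  shows "superpos F u = superpos f u"
  using assms by (simp add: superpos_eq bounded2_def nem_eq_truncated)

definition \<rho> :: real where "\<rho> = 1 / sqrt a1"

lemma \<rho>: "0 \<le> \<rho>" "norm (R x) \<le> \<rho> * norm x"
  using a1 norm_R by (simp_all add: \<rho>_def)

text \<open>The displacement is u = R p, so the nonlinearity meets bounded functions only.\<close>

definition N :: "H \<times> H \<Rightarrow> H \<times> H" where "N x = (0, superpos f (R (fst x)))"

definition N' :: "H \<times> H \<Rightarrow> H \<times> H \<Rightarrow> H \<times> H" where "N' x h = (0, dsuperpos (R (fst x)) (R (fst h)))"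

lemma N'_le: "norm (N' x h) \<le> K * \<rho> * norm h"
proof -
  have "norm (N' x h) \<le> K * norm (R (fst h))" using norm_dsuperpos_le by (simp add: N'_def norm_Pair)
  also have "\<dots> \<le> K * (\<rho> * norm (fst h))" by (intro mult_left_mono \<rho> K_nonneg)
  also have "\<dots> \<le> K * (\<rho> * norm h)"
    using norm_fst_le[of "fst h" "snd h"] by (intro mult_left_mono \<rho> K_nonneg) simp
  finally show ?thesis by (simp add: mult.assoc)
qed

text \<open>\<open>R\<close> bounds its image both in supremum norm, by \<open>Cs\<close>, and in
  norm, by \<open>\<rho>\<close>; the two factors of the remainder of \<open>superpos f\<close> take
  one bound each.\<close>

lemma N_has_derivative: "(N has_derivative N' x) (at x)"
proof (rule has_derivative_quadratic_remainder)
  show "bounded_linear (N' x)"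
  proof
    show "\<exists>B. \<forall>h. norm (N' x h) \<le> norm h * B"
      using N'_le by (intro exI[of _ "K * \<rho>"]) (simp add: mult.commute)
  qed (simp_all add: N'_def R_simps dsuperpos_add dsuperpos_scaleR)
  fix h :: "H \<times> H"
  have h: "norm (fst h) \<le> norm h" using norm_fst_le[of "fst h" "snd h"] by simp
  have "norm (N (x + h) - N x - N' x h) \<le> K * (Cs * norm (fst h)) * norm (R (fst h))"
    using superpos_remainder[OF R_bounded2[of "fst h"], of "R (fst x)"] Cs_nonneg
    by (simp add: N_def N'_def norm_Pair R_simps)
  also have "\<dots> \<le> K * (Cs * norm h) * (\<rho> * norm h)"
    using \<rho>(2)[of "fst h"] mult_left_mono[OF h \<rho>(1)] h K_nonneg Cs_nonneg
    by (intro mult_mono mult_left_mono) auto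
  finally show "norm (N (x + h) - N x - N' x h) \<le> (K * Cs * \<rho>) * (norm h)\<^sup>2"
    by (simp add: power2_eq_square mult_ac)
qed

lemma N'_Lipschitz: "norm (N' x h - N' y h) \<le> (K * Cs * \<rho>) * norm (x - y) * norm h"
proof -
  have h: "norm (fst h) \<le> norm h" "norm (fst (x - y)) \<le> norm (x - y)"
    by (cases h, simp add: norm_fst_le) (cases "x - y", simp add: norm_fst_le)
  have "bounded2 (Cs * norm (fst (x - y))) (R (fst x) - R (fst y))"
    using R_bounded2[of "fst (x - y)"] by (simp add: R_simps)
  then have "norm (N' x h - N' y h) \<le> K * (Cs * norm (fst (x - y))) * norm (R (fst h))"
    using dsuperpos_Lipschitz Cs_nonneg by (simp add: N'_def norm_Pair)
  also have "\<dots> \<le> K * (Cs * norm (x - y)) * (\<rho> * norm h)"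
    using \<rho>(2)[of "fst h"] mult_left_mono[OF h(1) \<rho>(1)] h K_nonneg Cs_nonneg
    by (intro mult_mono mult_left_mono) auto
  finally show ?thesis by (simp add: mult_ac)
qed

sublocale ev: semilinear_evolution Gen N N' "K * \<rho>" "K * Cs * \<rho>"
  by unfold_locales (rule N_has_derivative N'_le N'_Lipschitz)+

text \<open>The components of \<open>app Gen \<psi> = \<phi> + app Gen (N \<phi>)\<close>. Both
  equations carry \<open>R\<close>, so the unbounded operator \<open>S\<close> does not
  occur.\<close>

lemma truncated_solution:
  assumes \<Phi>: "\<Phi> \<in> dom_A"
  obtains p v p' v' where "p 0 = R (A \<Phi>)" "v 0 = 0"
    "\<And>t. 0 \<le> t \<Longrightarrow> (p has_vector_derivative p' t) (at t within {0..})"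
    "\<And>t. 0 \<le> t \<Longrightarrow> (v has_vector_derivative v' t) (at t within {0..})"
    "continuous_on {0..} p'" "continuous_on {0..} v'"
    "\<And>t. 0 \<le> t \<Longrightarrow> R (p' t) = v t"
    "\<And>t. 0 \<le> t \<Longrightarrow> R (superpos f (R (p t)) - v' t) = p t"
proof -
  define \<phi>0 :: "H \<times> H" where "\<phi>0 = (R (A \<Phi>), 0)"
  \<comment> \<open>The time derivative at 0: L sends (R (A \<Phi>), 0) to (0, - S (R (A \<Phi>))),
    which is (0, - A \<Phi>), and the nonlinear term is added.\<close>
  define \<psi>0 where "\<psi>0 = (0, - A \<Phi>) + N \<phi>0"
  have "app Gen \<psi>0 = \<phi>0 + app Gen (N \<phi>0)"
    by (simp add: \<psi>0_def app_add app_Gen \<phi>0_def R_simps linear_neg[OF R_linear])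
  then obtain \<phi> \<psi> where sol: "\<phi> 0 = \<phi>0"
    "\<And>t. 0 \<le> t \<Longrightarrow> (\<phi> has_vector_derivative \<psi> t) (at t within {0..})"
    "continuous_on {0..} \<psi>"
    "\<And>t. 0 \<le> t \<Longrightarrow> app Gen (\<psi> t) = \<phi> t + app Gen (N (\<phi> t))"
    using ev.classical_solution[of \<psi>0 \<phi>0] by metis
  define p v p' v' where "p t = fst (\<phi> t)" and "v t = snd (\<phi> t)"
    and "p' t = fst (\<psi> t)" and "v' t = snd (\<psi> t)" for t
  have G: "(- R (v' t), R (p' t)) = (p t, v t) + (- R (superpos f (R (p t))), R 0)" if "0 \<le> t" for t
    using sol(4)[OF that]
    by (simp add: p_def v_def p'_def v'_def N_def app_Gen[of "fst x" "snd x" for x, simplified] app_Gen)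
  show thesis
  proof (rule that[of p v p' v'])
    show "p 0 = R (A \<Phi>)" "v 0 = 0" by (simp_all add: p_def v_def sol(1) \<phi>0_def)
    show "(p has_vector_derivative p' t) (at t within {0..})" if "0 \<le> t" for t
      unfolding p_def p'_def by (rule bounded_linear.has_vector_derivative[OF bounded_linear_fst sol(2)[OF that]])
    show "(v has_vector_derivative v' t) (at t within {0..})" if "0 \<le> t" for t
      unfolding v_def v'_def by (rule bounded_linear.has_vector_derivative[OF bounded_linear_snd sol(2)[OF that]])
    show "continuous_on {0..} p'" "continuous_on {0..} v'"
      unfolding p'_def v'_def by (intro continuous_intros sol(3))+
    show "R (p' t) = v t" "R (superpos f (R (p t)) - v' t) = p t" if "0 \<le> t" for t
      using G[OF that] by (simp_all add: R_simps algebra_simps)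
  qed
qed

text \<open>The quantity \<open>e\<close> is conserved. At time t the velocity and potential terms
  are non-negative and are dropped; at time 0 the velocity is 0.\<close>

lemma energy_bound:
  assumes p: "\<And>t. 0 \<le> t \<Longrightarrow> (p has_vector_derivative p' t) (at t within {0..})"
    and v: "\<And>t. 0 \<le> t \<Longrightarrow> (v has_vector_derivative v' t) (at t within {0..})" "v 0 = 0"
    and eq: "\<And>t. 0 \<le> t \<Longrightarrow> R (p' t) = v t" "\<And>t. 0 \<le> t \<Longrightarrow> R (superpos f (R (p t)) - v' t) = p t"
    and t: "0 \<le> t"
  shows "(norm (p t))\<^sup>2 \<le> (norm (p 0))\<^sup>2 - 2 * pot2 (R (p 0))"
proof -
  define e where "e t = inner (p t) (p t) + inner (v t) (v t) - 2 * pot2 (R (p t))" for t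
  have "(e has_vector_derivative 0) (at t within {0..})" if "t \<in> {0..}" for t
  proof -
    have t: "0 \<le> t" using that by simp
    have "((\<lambda>t. R (p t)) has_vector_derivative v t) (at t within {0..})"
      using bounded_linear.has_vector_derivative[OF R_bounded_linear p[OF t]] eq(1)[OF t] by simp
    from has_derivative_compose[OF this[unfolded has_vector_derivative_def] pot2_has_derivative]
    have pot: "((\<lambda>t. pot2 (R (p t))) has_vector_derivative inner (superpos f (R (p t))) (v t)) (at t within {0..})"
      by (simp add: has_vector_derivative_def)
    have "(e has_vector_derivative
        (inner (p t) (p' t) + inner (p' t) (p t)) + (inner (v t) (v' t) + inner (v' t) (v t))
          - 2 * inner (superpos f (R (p t))) (v t)) (at t within {0..})"
      unfolding e_def
      by (intro has_vector_derivative_diff has_vector_derivative_add has_vector_derivative_mult_right pot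
          bounded_bilinear.has_vector_derivative[OF bounded_bilinear_inner] p v t)
    \<comment> \<open>Symmetry moves \<open>R\<close> onto \<open>p'\<close>, where it gives
      \<open>v\<close>; then the terms with \<open>v'\<close> and with the nonlinearity
      cancel.\<close>
    moreover have "inner (p t) (p' t) = inner (superpos f (R (p t)) - v' t) (v t)"
      using inner_R[of "superpos f (R (p t)) - v' t" "p' t"] eq[OF t] by simp
    ultimately show ?thesis by (simp add: inner_commute inner_diff_right inner_diff_left)
  qed
  then obtain d where d: "\<And>t. t \<in> {0..} \<Longrightarrow> e t = d"
    using has_vector_derivative_zero_constant[of "{0..}" e] by auto
  have "e t = e 0" using d[of t] d[of 0] t by simp
  then have "(norm (p t))\<^sup>2 + (norm (v t))\<^sup>2 - 2 * pot2 (R (p t)) = (norm (p 0))\<^sup>2 - 2 * pot2 (R (p 0))"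
    by (simp add: e_def v(2) power2_norm_eq_inner)
  then show ?thesis using pot2_nonpos[of "R (p t)"] zero_le_power2[of "norm (v t)"] by linarith
qed

end

section \<open>Return to the problems (P) and (Q)\<close>

context star_graph
begin

text \<open>The map from (p, v) to (R p, v) is isometric into the energy norm, so derivatives and
  continuity in that norm become ordinary ones.\<close>

lemma energy_norm_R: "energy_norm c a1 a2 (R p, v) = norm (p, v)"
  by (simp add: energy_norm_def sqrt_A_eq op_app_S norm_Pair)

lemma R_R_A: "u \<in> dom_A \<Longrightarrow> R (R (A u)) = u"
  by (simp add: R_R B_A)

lemma dom_A_R_R: "R (R x) \<in> dom_A" "A (R (R x)) = x"
  by (simp_all add: R_R B)

text \<open>The second equation puts \<open>p t\<close> into the range of \<open>R\<close>, so
  \<open>R (p t)\<close> lies in the range of \<open>R\<close> applied twice, which is the domain of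
  \<open>A\<close>; applying \<open>A\<close> recovers the wave equation.\<close>

lemma solves_QI:
  assumes \<Phi>: "\<Phi> \<in> dom_A" and init: "p 0 = R (A \<Phi>)" "v 0 = 0"
    and p: "\<And>t. 0 \<le> t \<Longrightarrow> (p has_vector_derivative p' t) (at t within {0..})" "continuous_on {0..} p'"
    and v: "\<And>t. 0 \<le> t \<Longrightarrow> (v has_vector_derivative v' t) (at t within {0..})" "continuous_on {0..} v'"
    and eq: "\<And>t. 0 \<le> t \<Longrightarrow> R (p' t) = v t" "\<And>t. 0 \<le> t \<Longrightarrow> R (superpos F (R (p t)) - v' t) = p t"
  defines "\<phi> \<equiv> \<lambda>t. (R (p t), v t)"
  shows "solves_Q c a1 a2 F (\<Phi>, 0) {0..} \<phi>"
    and "solves_P c a1 a2 F \<Phi> {0..} (\<lambda>t. fst (\<phi> t))"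
    and "0 \<le> t \<Longrightarrow> ((\<lambda>s. fst (\<phi> s)) has_vector_derivative snd (\<phi> t)) (at t within {0..})"
proof -
  have u: "R (p t) \<in> dom_A" "- A (R (p t)) + superpos F (R (p t)) = v' t" if "0 \<le> t" for t
    using dom_A_R_R[of "superpos F (R (p t)) - v' t"] eq(2)[OF that] by simp_all
  have rhs: "rhs_Q c a1 a2 F (\<phi> t) = (R (p' t), v' t)" if "0 \<le> t" for t
    using u(2)[OF that] eq(1)[OF that] by (simp add: rhs_Q_def \<phi>_def)
  have \<phi>0: "\<phi> 0 = (\<Phi>, 0)" by (simp add: \<phi>_def init R_R_A[OF \<Phi>])
  show u': "((\<lambda>s. fst (\<phi> s)) has_vector_derivative snd (\<phi> t)) (at t within {0..})" if "0 \<le> t" for t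
    using bounded_linear.has_vector_derivative[OF R_bounded_linear p(1)[OF that]] eq(1)[OF that]
    by (simp add: \<phi>_def)
  show "solves_Q c a1 a2 F (\<Phi>, 0) {0..} \<phi>"
    unfolding solves_Q_def
  proof (intro conjI ballI)
    fix t :: real assume "t \<in> {0..}"
    then have t: "0 \<le> t" by simp
    have "v t \<in> range R" using eq(1)[OF t] by (metis rangeI)
    then show "\<phi> t \<in> dom_calA c a1 a2"
      using u(1)[OF t] by (simp add: dom_calA_def \<phi>_def sqrt_A_eq Domain_S)
    show "energy_has_derivative c a1 a2 \<phi> (rhs_Q c a1 a2 F (\<phi> t)) t {0..}"
      unfolding energy_has_derivative_def rhs[OF t]
    proof -
      have "(1 / (s - t)) *\<^sub>R (\<phi> s - \<phi> t) - (R (p' t), v' t)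
          = (R ((1 / (s - t)) *\<^sub>R (p s - p t) - p' t), (1 / (s - t)) *\<^sub>R (v s - v t) - v' t)" for s
        by (simp add: \<phi>_def R_simps)
      moreover have "((\<lambda>s. norm ((1 / (s - t)) *\<^sub>R (p s - p t) - p' t, (1 / (s - t)) *\<^sub>R (v s - v t) - v' t))
          \<longlongrightarrow> norm (p' t - p' t, v' t - v' t)) (at t within {0..})"
        using p(1)[OF t] v(1)[OF t] unfolding has_vector_derivative_iff_tendsto
        by (intro tendsto_norm tendsto_Pair tendsto_diff tendsto_const)
      ultimately show "((\<lambda>s. energy_norm c a1 a2 ((1 / (s - t)) *\<^sub>R (\<phi> s - \<phi> t) - (R (p' t), v' t))) \<longlongrightarrow> 0)
          (at t within {0..})"
        by (simp add: energy_norm_R)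
    qed
  next
    show "energy_continuous_on c a1 a2 {0..} (\<lambda>t. rhs_Q c a1 a2 F (\<phi> t))"
      unfolding energy_continuous_on_def
    proof
      fix t :: real assume t: "t \<in> {0..}"
      have "((\<lambda>s. norm (p' s - p' t, v' s - v' t)) \<longlongrightarrow> norm (p' t - p' t, v' t - v' t)) (at t within {0..})"
        using p(2) v(2) t unfolding continuous_on_def
        by (intro tendsto_norm tendsto_Pair tendsto_diff tendsto_const) auto
      then have l: "((\<lambda>s. norm (p' s - p' t, v' s - v' t)) \<longlongrightarrow> 0) (at t within {0..})" by simp
      have "energy_norm c a1 a2 (rhs_Q c a1 a2 F (\<phi> s) - rhs_Q c a1 a2 F (\<phi> t)) = norm (p' s - p' t, v' s - v' t)"
        if "s \<in> {0..}" for s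
        using that t rhs[of s] rhs[of t] energy_norm_R[of "p' s - p' t"] by (simp add: R_simps)
      then show "((\<lambda>s. energy_norm c a1 a2 (rhs_Q c a1 a2 F (\<phi> s) - rhs_Q c a1 a2 F (\<phi> t))) \<longlongrightarrow> 0) (at t within {0..})"
        by (intro Lim_transform_eventually[OF l]) (auto simp: eventually_at_filter)
    qed
  qed (rule \<phi>0)
  show "solves_P c a1 a2 F \<Phi> {0..} (\<lambda>t. fst (\<phi> t))"
    unfolding solves_P_def
  proof (intro conjI ballI exI)
    show "fst (\<phi> t) \<in> dom_A" if "t \<in> {0..}" for t using u(1) that by (simp add: \<phi>_def)
    show "fst (\<phi> 0) = \<Phi>" by (simp add: \<phi>0)
    show "((\<lambda>t. fst (\<phi> t)) has_vector_derivative v t) (at t within {0..})" if "t \<in> {0..}" for t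
      using u'[of t] that by (simp add: \<phi>_def)
    show "(v has_vector_derivative v' t) (at t within {0..})" if "t \<in> {0..}" for t
      using v(1) that by simp
    show "v' t + A (fst (\<phi> t)) = superpos F (fst (\<phi> t))" if "t \<in> {0..}" for t
      using u(2)[of t, symmetric] that by (simp add: \<phi>_def)
  qed (use v init in auto)
qed

text \<open>On functions bounded by M the nonlinearity agrees with a truncated one, which is
  globally Lipschitz.\<close>

lemma superpos_locally_Lipschitz:
  assumes F: "C2_function F" "F 0 = 0" and G: "\<And>x. (G has_real_derivative F x) (at x)" "G 0 = 0" "\<And>x. G x \<le> 0"
    and M: "0 \<le> M"
  obtains K where "0 \<le> K"
    "\<And>u v. bounded2 M u \<Longrightarrow> bounded2 M v \<Longrightarrow> norm (superpos F u - superpos F v) \<le> K * norm (u - v)"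
proof -
  obtain f f' g K where "truncated_nonlinearity F G f f' g M K"
    by (rule exists_truncated_nonlinearity[OF F G M])
  then interpret truncated_nonlinearity F G f f' g M K .
  interpret truncated_problem c a1 a2 F G f f' g M K ..
  note cont = C2_function_continuous[OF F(1)]
  show thesis
    by (rule that[OF K_nonneg]) (simp add: superpos_eq_truncated[OF _ cont] superpos_Lipschitz)
qed

end

lemma Pair_eq_0_iff: "(x, y) = 0 \<longleftrightarrow> x = 0 \<and> y = 0"
  by (simp add: zero_prod_def)

section \<open>Uniqueness and the global solution\<close>

context star_graph
begin

lemma bounded2_mono:
  assumes "bounded2 b u" "b \<le> b'"
  shows "bounded2 b' u"
proof -
  have "l2_bounded b w \<Longrightarrow> l2_bounded b' w" for w
    unfolding l2_bounded_def by (erule eventually_mono) (use assms(2) in simp)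
  then show ?thesis using assms(1) by (simp add: bounded2_def)
qed

text \<open>The reverse change of variables: u in the domain of \<open>A\<close> equals R (R (A u)),
  so its image under \<open>S\<close> is R (A u). The energy derivative then splits into ordinary
  derivatives of p and v.\<close>

lemma solves_QD:
  assumes Q: "solves_Q c a1 a2 F \<phi>0 I \<psi>"
  defines "p \<equiv> \<lambda>t. R (A (fst (\<psi> t)))" and "v \<equiv> \<lambda>t. snd (\<psi> t)" and "q \<equiv> \<lambda>t. op_app S (snd (\<psi> t))"
    and "w \<equiv> \<lambda>t. - A (fst (\<psi> t)) + superpos F (fst (\<psi> t))"
  assumes t: "t \<in> I"
  shows "R (p t) = fst (\<psi> t)" "R (q t) = v t"
    "(p has_vector_derivative q t) (at t within I)" "(v has_vector_derivative w t) (at t within I)"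
proof -
  have dom: "fst (\<psi> s) \<in> dom_A" "snd (\<psi> s) \<in> range R" if "s \<in> I" for s
  proof -
    have "\<psi> s \<in> dom_calA c a1 a2" using Q that unfolding solves_Q_def by blast
    then show "fst (\<psi> s) \<in> dom_A" "snd (\<psi> s) \<in> range R"
      by (auto simp: dom_calA_def sqrt_A_eq Domain_S)
  qed
  have Rp: "R (p s) = fst (\<psi> s)" and Rq: "R (q s) = v s" if "s \<in> I" for s
    using dom[OF that] by (auto simp: p_def q_def v_def R_R_A op_app_S)
  show "R (p t) = fst (\<psi> t)" "R (q t) = v t" using Rp Rq t by simp_all
  let ?d = "\<lambda>s. ((1 / (s - t)) *\<^sub>R (p s - p t) - q t, (1 / (s - t)) *\<^sub>R (v s - v t) - w t)"
  have eq: "energy_norm c a1 a2 ((1 / (s - t)) *\<^sub>R (\<psi> s - \<psi> t) - rhs_Q c a1 a2 F (\<psi> t)) = norm (?d s)"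
    if s: "s \<in> I" for s
  proof -
    have "(1 / (s - t)) *\<^sub>R (\<psi> s - \<psi> t) - rhs_Q c a1 a2 F (\<psi> t)
        = ((1 / (s - t)) *\<^sub>R (fst (\<psi> s) - fst (\<psi> t)) - v t, (1 / (s - t)) *\<^sub>R (v s - v t) - w t)"
      by (simp add: rhs_Q_def split_beta v_def w_def prod_eq_iff)
    also have "(1 / (s - t)) *\<^sub>R (fst (\<psi> s) - fst (\<psi> t)) - v t = R ((1 / (s - t)) *\<^sub>R (p s - p t) - q t)"
      by (simp add: R_simps Rp[OF s] Rp[OF t] Rq[OF t])
    finally show ?thesis by (simp only: energy_norm_R)
  qed
  have "energy_has_derivative c a1 a2 \<psi> (rhs_Q c a1 a2 F (\<psi> t)) t I"
    using Q t unfolding solves_Q_def by blast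
  then have "((\<lambda>s. norm (?d s)) \<longlongrightarrow> 0) (at t within I)"
    unfolding energy_has_derivative_def
    by (rule Lim_transform_eventually) (use eq in \<open>auto simp: eventually_at_filter\<close>)
  then have d: "(?d \<longlongrightarrow> 0) (at t within I)" by (rule tendsto_norm_zero_cancel)
  from tendsto_fst[OF d] tendsto_snd[OF d]
  have "((\<lambda>s. (1 / (s - t)) *\<^sub>R (p s - p t) - q t) \<longlongrightarrow> 0) (at t within I)"
    "((\<lambda>s. (1 / (s - t)) *\<^sub>R (v s - v t) - w t) \<longlongrightarrow> 0) (at t within I)"
    by simp_all
  then show "(p has_vector_derivative q t) (at t within I)" "(v has_vector_derivative w t) (at t within I)"
    unfolding has_vector_derivative_iff_tendsto by (simp_all add: LIM_zero_iff)
qed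

text \<open>Gronwall's argument for the difference of the solutions in the variables (p, v), where
  the skew linear part contributes nothing.\<close>

lemma solves_Q_unique:
  assumes F: "C2_function F" "F 0 = 0" and G: "\<And>x. (G has_real_derivative F x) (at x)" "G 0 = 0" "\<And>x. G x \<le> 0"
    and 1: "solves_Q c a1 a2 F \<phi>0 {0..} \<phi>" and 2: "solves_Q c a1 a2 F \<phi>0 {0..<T} \<psi>" and t: "t \<in> {0..<T}"
  shows "\<psi> t = \<phi> t"
proof -
  define p1 v1 q1 w1 where "p1 s = R (A (fst (\<phi> s)))" and "v1 s = snd (\<phi> s)" and "q1 s = op_app S (snd (\<phi> s))"
    and "w1 s = - A (fst (\<phi> s)) + superpos F (fst (\<phi> s))" for s
  define p2 v2 q2 w2 where "p2 s = R (A (fst (\<psi> s)))" and "v2 s = snd (\<psi> s)" and "q2 s = op_app S (snd (\<psi> s))"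
    and "w2 s = - A (fst (\<psi> s)) + superpos F (fst (\<psi> s))" for s
  have R1: "R (p1 s) = fst (\<phi> s)" "R (q1 s) = v1 s"
    and R2: "R (p2 s) = fst (\<psi> s)" "R (q2 s) = v2 s"
    and d1: "(p1 has_vector_derivative q1 s) (at s within {0..t})" "(v1 has_vector_derivative w1 s) (at s within {0..t})"
    and d2: "(p2 has_vector_derivative q2 s) (at s within {0..t})" "(v2 has_vector_derivative w2 s) (at s within {0..t})"
    if s: "s \<in> {0..t}" for s
  proof -
    have s1: "s \<in> {0..}" "{0..t} \<subseteq> {0..}" and s2: "s \<in> {0..<T}" "{0..t} \<subseteq> {0..<T}" using s t by auto
    note r1 = solves_QD[OF 1 s1(1), folded p1_def v1_def q1_def w1_def]
      and r2 = solves_QD[OF 2 s2(1), folded p2_def v2_def q2_def w2_def]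
    show "R (p1 s) = fst (\<phi> s)" "R (q1 s) = v1 s" "R (p2 s) = fst (\<psi> s)" "R (q2 s) = v2 s"
      using r1 r2 by simp_all
    show "(p1 has_vector_derivative q1 s) (at s within {0..t})" "(v1 has_vector_derivative w1 s) (at s within {0..t})"
      using has_vector_derivative_within_subset[OF _ s1(2)] r1(3,4) by blast+
    show "(p2 has_vector_derivative q2 s) (at s within {0..t})" "(v2 has_vector_derivative w2 s) (at s within {0..t})"
      using has_vector_derivative_within_subset[OF _ s2(2)] r2(3,4) by blast+
  qed
  \<comment> \<open>On the compact interval both solutions have bounded p, so
    \<open>R_bounded2\<close> gives one supremum bound for both displacements and thereby one
    Lipschitz constant.\<close>
  have "bounded (p1 ` {0..t})" "bounded (p2 ` {0..t})"
    by (intro compact_imp_bounded compact_continuous_image compact_Icc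
        continuous_on_vector_derivative[OF d1(1)] continuous_on_vector_derivative[OF d2(1)]; assumption)+
  then obtain b1 b2 where b: "\<And>s. s \<in> {0..t} \<Longrightarrow> norm (p1 s) \<le> b1" "\<And>s. s \<in> {0..t} \<Longrightarrow> norm (p2 s) \<le> b2"
    unfolding bounded_iff by (metis imageI)
  define b where "b = max b1 (max b2 0)"
  have b_nonneg: "0 \<le> Cs * b" using Cs_nonneg by (simp add: b_def)
  obtain K where K: "0 \<le> K" "\<And>u v. bounded2 (Cs * b) u \<Longrightarrow> bounded2 (Cs * b) v \<Longrightarrow>
      norm (superpos F u - superpos F v) \<le> K * norm (u - v)"
    by (rule superpos_locally_Lipschitz[OF F G b_nonneg]) (rule that; assumption)
  have bd: "bounded2 (Cs * b) (R p)" if "norm p \<le> b" for p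
  proof -
    have "Cs * norm p \<le> Cs * b" using that Cs_nonneg by (rule mult_left_mono)
    then show ?thesis using R_bounded2[of p] by (rule bounded2_mono[rotated])
  qed
  let ?y = "\<lambda>s. (p2 s - p1 s, v2 s - v1 s)"
  have "norm (?y t) \<le> norm (?y 0) * exp ((K * (1 / sqrt a1)) * t)"
  proof (rule norm_le_exp_if_inner_deriv_le)
    fix s assume s: "s \<in> {0..t}"
    show "(?y has_vector_derivative (q2 s - q1 s, w2 s - w1 s)) (at s within {0..t})"
      by (intro has_vector_derivative_Pair has_vector_derivative_diff d1 d2 s)
    \<comment> \<open>Symmetry of \<open>R\<close> turns this product into the one of the velocity
      difference with the difference of the terms \<open>A u\<close>, which cancels against the
      linear part of \<open>w2 s - w1 s\<close>.\<close>
    have "inner (q2 s - q1 s) (p2 s - p1 s) = inner (v2 s - v1 s) (A (fst (\<psi> s)) - A (fst (\<phi> s)))"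
      using inner_R[of "q2 s - q1 s" "A (fst (\<psi> s)) - A (fst (\<phi> s))"] R1(2)[OF s] R2(2)[OF s]
      by (simp add: p1_def p2_def R_simps)
    then have "inner (q2 s - q1 s, w2 s - w1 s) (?y s)
        = inner (superpos F (fst (\<psi> s)) - superpos F (fst (\<phi> s))) (v2 s - v1 s)"
      by (simp add: w1_def w2_def inner_diff_left inner_diff_right inner_add_left inner_commute)
    also have "\<dots> \<le> norm (superpos F (fst (\<psi> s)) - superpos F (fst (\<phi> s))) * norm (v2 s - v1 s)"
      by (rule norm_cauchy_schwarz)
    also have "\<dots> \<le> (K * norm (R (p2 s - p1 s))) * norm (v2 s - v1 s)"
    proof (rule mult_right_mono)
      have "bounded2 (Cs * b) (fst (\<psi> s))" "bounded2 (Cs * b) (fst (\<phi> s))"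
        using bd[of "p2 s"] bd[of "p1 s"] b[OF s] R1(1)[OF s] R2(1)[OF s] by (simp_all add: b_def)
      then show "norm (superpos F (fst (\<psi> s)) - superpos F (fst (\<phi> s))) \<le> K * norm (R (p2 s - p1 s))"
        using K(2) by (simp add: R_simps R1(1)[OF s] R2(1)[OF s])
    qed simp
    also have "\<dots> \<le> (K * (1 / sqrt a1 * norm (?y s))) * norm (?y s)"
    proof (intro mult_mono mult_left_mono K(1))
      show "norm (R (p2 s - p1 s)) \<le> 1 / sqrt a1 * norm (?y s)"
        using norm_R[of "p2 s - p1 s"] mult_left_mono[OF norm_fst_le[of "p2 s - p1 s" "v2 s - v1 s"], of "1 / sqrt a1"] a1
        by simp
      show "norm (v2 s - v1 s) \<le> norm (?y s)" by (rule norm_snd_le)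
    qed (use K(1) a1 in auto)
    finally show "inner (q2 s - q1 s, w2 s - w1 s) (?y s) \<le> (K * (1 / sqrt a1)) * (norm (?y s))\<^sup>2"
      by (simp add: power2_eq_square mult_ac)
  qed (use t in auto)
  moreover have "\<phi> 0 = \<psi> 0" using 1 2 by (simp add: solves_Q_def)
  then have "?y 0 = 0" by (simp add: p1_def p2_def v1_def v2_def zero_prod_def)
  ultimately have "norm (?y t) \<le> 0" by simp
  then have "?y t = 0" by simp
  then have "p2 t = p1 t" "v2 t = v1 t" by (simp_all add: Pair_eq_0_iff)
  moreover have "t \<in> {0..t}" using t by simp
  ultimately have "fst (\<psi> t) = fst (\<phi> t)" "snd (\<psi> t) = snd (\<phi> t)"
    using R1(1) R2(1) by (metis, simp add: v1_def v2_def)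
  then show ?thesis by (simp add: prod_eq_iff)
qed

theorem global_solution:
  assumes F: "C2_function F" "F 0 = 0" and G: "\<And>x. (G has_real_derivative F x) (at x)" "G 0 = 0" "\<And>x. G x \<le> 0"
    and int: "\<And>u. integrable half_line (\<lambda>x. G (rep_l2 u x))"
    and \<Phi>: "\<Phi> \<in> dom_A"
  shows "\<exists>\<phi>. solves_Q c a1 a2 F (\<Phi>, 0) {0..} \<phi> \<and>
             solves_P c a1 a2 F \<Phi> {0..} (\<lambda>t. fst (\<phi> t)) \<and>
             (\<forall>t\<ge>0. ((\<lambda>s. fst (\<phi> s)) has_vector_derivative snd (\<phi> t)) (at t within {0..})) \<and>
             (\<forall>T>0. \<forall>\<psi>. solves_Q c a1 a2 F (\<Phi>, 0) {0..<T} \<psi> \<longrightarrow> (\<forall>t\<in>{0..<T}. \<psi> t = \<phi> t))"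
proof -
  \<comment> \<open>Twice the initial energy, computed with the original potential; so the radius
    \<open>M\<close> below can depend on it before a cutoff is chosen.\<close>
  define E where "E = (norm (R (A \<Phi>)))\<^sup>2
      - 2 * ((\<integral>x. G (rep_l2 (fst \<Phi>) x) \<partial>half_line) + (\<integral>x. G (rep_l2 (snd \<Phi>) x) \<partial>half_line))"
  have "(\<integral>x. G (rep_l2 u x) \<partial>half_line) \<le> 0" for u
  proof -
    have "(\<integral>x. - G (rep_l2 u x) \<partial>half_line) \<ge> 0" using G(3) by (intro integral_nonneg_AE) auto
    then show ?thesis by simp
  qed
  then have "(\<integral>x. G (rep_l2 (fst \<Phi>) x) \<partial>half_line) + (\<integral>x. G (rep_l2 (snd \<Phi>) x) \<partial>half_line) \<le> 0"
    by (intro add_nonpos_nonpos)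
  moreover have "0 \<le> x\<^sup>2 - 2 * y" if "y \<le> 0" for x y :: real
    using that zero_le_power2[of x] by linarith
  ultimately have E: "0 \<le> E" unfolding E_def by blast
  define M where "M = Cs * sqrt E"
  have M: "0 \<le> M" using Cs_nonneg E by (simp add: M_def)
  obtain f f' g K where "truncated_nonlinearity F G f f' g M K"
    by (rule exists_truncated_nonlinearity[OF F G M])
  then interpret truncated_nonlinearity F G f f' g M K .
  interpret truncated_problem c a1 a2 F G f f' g M K ..
  obtain p v p' v' where sol: "p 0 = R (A \<Phi>)" "v 0 = 0"
    "\<And>t. 0 \<le> t \<Longrightarrow> (p has_vector_derivative p' t) (at t within {0..})"
    "\<And>t. 0 \<le> t \<Longrightarrow> (v has_vector_derivative v' t) (at t within {0..})"
    "continuous_on {0..} p'" "continuous_on {0..} v'"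
    "\<And>t. 0 \<le> t \<Longrightarrow> R (p' t) = v t"
    "\<And>t. 0 \<le> t \<Longrightarrow> R (superpos f (R (p t)) - v' t) = p t"
    by (rule truncated_solution[OF \<Phi>]) (rule that; assumption)
  note cont = C2_function_continuous[OF F(1)]
  \<comment> \<open>Since \<open>G x \<le> g x\<close>, the truncated initial energy does not exceed
    the original one. The comparison uses integrability of both potentials along the given
    functions.\<close>
  have pot_ge: "(\<integral>x. G (rep_l2 u x) \<partial>half_line) \<le> pot u" for u
    unfolding pot_def by (rule integral_mono_AE[OF int integrable_g]) (simp add: G_le)
  \<comment> \<open>The bound on \<open>p\<close> is turned by \<open>R_bounded2\<close> into the
    radius up to which \<open>f\<close> and \<open>F\<close> agree, so the truncated solution never
    notices the truncation.\<close>
  have sup: "superpos F (R (p t)) = superpos f (R (p t))" if t: "0 \<le> t" for t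
  proof -
    have "(norm (p t))\<^sup>2 \<le> (norm (p 0))\<^sup>2 - 2 * pot2 (R (p 0))"
      by (rule energy_bound[OF sol(3,4,2,7,8) t])
    also have "\<dots> \<le> E"
      using pot_ge[of "fst \<Phi>"] pot_ge[of "snd \<Phi>"] by (simp add: sol(1) R_R_A[OF \<Phi>] pot2_def E_def)
    finally have "norm (p t) \<le> sqrt E" by (rule real_le_rsqrt)
    then have "Cs * norm (p t) \<le> M" unfolding M_def using Cs_nonneg by (rule mult_left_mono)
    then have "bounded2 M (R (p t))"
      using R_bounded2[of "p t"] by (rule bounded2_mono[rotated])
    then show ?thesis by (rule superpos_eq_truncated[OF _ cont])
  qed
  define \<phi> where "\<phi> t = (R (p t), v t)" for t
  have eq: "R (superpos F (R (p t)) - v' t) = p t" if "0 \<le> t" for t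
    using sol(8)[OF that] sup[OF that] by simp
  note S = solves_QI[OF \<Phi> sol(1,2,3,5,4,6,7) eq, folded \<phi>_def]
  show ?thesis
    using S solves_Q_unique[OF F G S(1)] by (intro exI[of _ \<phi>]) blast
qed

end

theorem corollary1:
  fixes c a1 a2 :: real and F :: "real \<Rightarrow> real" and \<Phi> :: H
  assumes "0 < c" and "0 < a1" and "0 < a2" and "a1 < a2"
    and "C2_function F" and "F 0 = 0"
    and "\<And>w. (LBINT \<xi>=0..ereal w. F \<xi>) \<le> 0"
    and "\<And>(\<Omega> :: real set) u. is_interval \<Omega> \<Longrightarrow> square_integrable (lebesgue_on \<Omega>) u \<Longrightarrow>
           integrable (lebesgue_on \<Omega>) (\<lambda>x. LBINT \<xi>=0..ereal (u x). F \<xi>)"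
    and "\<Phi> \<in> dom_A"
  shows "\<exists>\<phi>. solves_Q c a1 a2 F (\<Phi>, 0) {0..} \<phi> \<and>
             solves_P c a1 a2 F \<Phi> {0..} (\<lambda>t. fst (\<phi> t)) \<and>
             (\<forall>t\<ge>0. ((\<lambda>s. fst (\<phi> s)) has_vector_derivative snd (\<phi> t)) (at t within {0..})) \<and>
             (\<forall>T>0. \<forall>\<psi>. solves_Q c a1 a2 F (\<Phi>, 0) {0..<T} \<psi> \<longrightarrow> (\<forall>t\<in>{0..<T}. \<psi> t = \<phi> t))"
proof -
  interpret star_graph c a1 a2
    by unfold_locales (fact assms)+
  define G where "G w = (LBINT \<xi>=0..ereal w. F \<xi>)" for w
  show ?thesis
  proof (rule global_solution[OF assms(5,6) _ _ _ _ assms(9)])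
    show "(G has_real_derivative F x) (at x)" for x
      unfolding G_def[abs_def] by (rule interval_integral_has_real_derivative[OF C2_function_continuous[OF assms(5)]])
    show "G 0 = 0" by (simp add: G_def zero_ereal_def)
    show "G x \<le> 0" for x unfolding G_def by (rule assms(7))
    show "integrable half_line (\<lambda>x. G (rep_l2 u x))" for u
      unfolding G_def by (rule assms(8)[OF _ square_integrable_rep]) (simp add: is_interval_oi)
  qed
qed

end
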